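(* Let $\omega\in\widehat{\mathcal{D}}$ and $1<p<\infty$. Then $P^+_\omega:L^p_\omega\to L^p_\omega$ is bounded if and only if $\omega\in\mathcal{D}$.
   Context: $\mathbb{D}$ is the open unit disc of $\mathbb{C}$ and $dA(z)=\frac{dx\,dy}{\pi}$. A radial weight is a nonnegative function $\omega\in L^1([0,1))$ extended to $\mathbb{D}$ by $\omega(z)=\omega(|z|)$; it is assumed throughout that $\widehat{\omega}(z)=\int_{|z|}^1\omega(s)\,ds>0$ for all $z\in\mathbb{D}$. For radial weights: $\omega\in\widehat{\mathcal{D}}$ if there is $C\ge1$ with $\widehat{\omega}(r)\le C\widehat{\omega}\left(\frac{1+r}{2}\right)$ for all $0\le r<1$; $\omega\in\check{\mathcal{D}}$ if there are $K>1$ and $C>1$ with $\widehat{\omega}(r)\ge C\widehat{\omega}\left(1-\frac{1-r}{K}\right)$ for all $0\le r<1$; $\mathcal{D}=\widehat{\mathcal{D}}\cap\check{\mathcal{D}}$. $L^p_\omega$ is the space of measurable $f$ on $\mathbb{D}$ with $\|f\|_{L^p_\omega}^p=\int_{\mathbb{D}}|f(z)|^p\omega(z)\,dA(z)<\infty$. Write $\omega_x=\int_0^1r^x\omega(r)\,dr$ for $x\ge0$. The maximal Bergman projection is $P^+_\omega(f)(z)=\int_{\mathbb{D}}f(\zeta)|B^\omega_z(\zeta)|\,\omega(\zeta)\,dA(\zeta)$, where $B^\omega_z(\zeta)=\sum_{n=0}^\infty\frac{(\overline{z}\zeta)^n}{2\omega_{2n+1}}$ is the reproducing kernel of the Hilbert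 space of analytic functions in $L^2_\omega$. *)

theory Defs
  imports "HOL-Analysis.Analysis"
begin

text \<open>
  A radial weight is represented by its profile on \<open>[0,1)\<close>: the weight at a point \<open>z\<close> of the
  unit disc is \<open>\<omega> (cmod z)\<close>, and values of \<open>\<omega>\<close> outside \<open>[0,1)\<close> are never used.
\<close>

definition tail_integral :: "(real \<Rightarrow> real) \<Rightarrow> real \<Rightarrow> real" where
  "tail_integral \<omega> r = (LINT s:{r..<1}|lebesgue. \<omega> s)"

definition radial_weight :: "(real \<Rightarrow> real) \<Rightarrow> bool" where
  "radial_weight \<omega> \<longleftrightarrow>
     (\<forall>r\<in>{0..<1}. 0 \<le> \<omega> r) \<and>
     set_integrable lebesgue {0..<1} \<omega> \<and>
     (\<forall>r\<in>{0..<1}. 0 < tail_integral \<omega> r)"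

definition D_hat :: "(real \<Rightarrow> real) set" where
  "D_hat = {\<omega>. radial_weight \<omega> \<and>
     (\<exists>C\<ge>1. \<forall>r\<in>{0..<1}. tail_integral \<omega> r \<le> C * tail_integral \<omega> ((1 + r) / 2))}"

definition D_check :: "(real \<Rightarrow> real) set" where
  "D_check = {\<omega>. radial_weight \<omega> \<and>
     (\<exists>K>1. \<exists>C>1. \<forall>r\<in>{0..<1}.
        tail_integral \<omega> r \<ge> C * tail_integral \<omega> (1 - (1 - r) / K))}"

definition D_class :: "(real \<Rightarrow> real) set" where
  "D_class = D_hat \<inter> D_check"

definition disc_area :: "complex measure" where
  "disc_area = density (lebesgue_on (ball 0 1)) (\<lambda>_. ennreal (1 / pi))"

text \<open>Functions are not identified when they agree almost everywhere.\<close>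

definition Lp_space :: "(real \<Rightarrow> real) \<Rightarrow> real \<Rightarrow> (complex \<Rightarrow> complex) set" where
  "Lp_space \<omega> p = {f \<in> borel_measurable disc_area.
     integrable disc_area (\<lambda>z. cmod (f z) powr p * \<omega> (cmod z))}"

definition Lp_norm :: "(real \<Rightarrow> real) \<Rightarrow> real \<Rightarrow> (complex \<Rightarrow> complex) \<Rightarrow> real" where
  "Lp_norm \<omega> p f = (LINT z|disc_area. cmod (f z) powr p * \<omega> (cmod z)) powr (1 / p)"

definition weight_moment :: "(real \<Rightarrow> real) \<Rightarrow> real \<Rightarrow> real" where
  "weight_moment \<omega> x = (LINT r:{0..<1}|lebesgue. r powr x * \<omega> r)"

definition bergman_kernel :: "(real \<Rightarrow> real) \<Rightarrow> complex \<Rightarrow> complex \<Rightarrow> complex" where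
  "bergman_kernel \<omega> z \<zeta> =
     (\<Sum>n. (cnj z * \<zeta>) ^ n / of_real (2 * weight_moment \<omega> (2 * real n + 1)))"

text \<open>
  For \<open>f\<close> in \<open>Lp_space \<omega> p\<close> with \<open>1 < p\<close> the integral below converges absolutely at every point
  \<open>z\<close> of the disc, since \<open>bergman_kernel \<omega> z\<close> is bounded on the disc and \<open>\<omega>\<close> is integrable.
\<close>

definition maximal_bergman_projection ::
    "(real \<Rightarrow> real) \<Rightarrow> (complex \<Rightarrow> complex) \<Rightarrow> complex \<Rightarrow> complex" where
  "maximal_bergman_projection \<omega> f z =
     (LINT \<zeta>|disc_area. f \<zeta> * of_real (cmod (bergman_kernel \<omega> z \<zeta>)) * of_real (\<omega> (cmod \<zeta>)))"

definition bounded_on_Lp ::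
    "(real \<Rightarrow> real) \<Rightarrow> real \<Rightarrow> ((complex \<Rightarrow> complex) \<Rightarrow> complex \<Rightarrow> complex) \<Rightarrow> bool" where
  "bounded_on_Lp \<omega> p T \<longleftrightarrow>
     (\<exists>C. \<forall>f\<in>Lp_space \<omega> p. T f \<in> Lp_space \<omega> p \<and> Lp_norm \<omega> p (T f) \<le> C * Lp_norm \<omega> p f)"

end

theory Submission
  imports Defs
begin

text \<open>
  Write \<open>g k\<close> for the \<open>k\<close>-th moment of the weight, so that \<open>2 B\<^sub>z(\<zeta>) = K(cnj z \<cdot> \<zeta>)\<close> with
  \<open>K u = \<Sum>n. u\<^sup>n / g (2n+1)\<close>.  Doubling of the tail integral makes the coefficients of \<open>K\<close> regular: their
  first and second differences are smaller than the coefficients by factors \<open>1/n\<close> and \<open>1/n\<^sup>2\<close>.  Summation by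
  parts and Hardy's inequality then show that the mean of \<open>\<bar>K\<bar>\<close> over the circle of radius \<open>x\<close> is comparable
  to \<open>S(x) = \<Sum>n. x\<^sup>n / ((n+1) g (2n+1))\<close>.

  Necessity: the indicator function of the annulus \<open>\<rho> \<le> \<bar>z\<bar> < 1\<close> is mapped to a function which is at least
  a constant times \<open>T(\<rho>) S(\<rho>\<^sup>2)\<close> on that annulus, so \<open>T(\<rho>) S(\<rho>\<^sup>2)\<close> is bounded; as \<open>S\<close> grows by at least
  a constant multiple of \<open>j / T(r)\<close> over \<open>j\<close> dyadic blocks of indices beyond \<open>1/(1-r)\<close>, the tail integral \<open>T\<close>
  satisfies the reverse doubling condition.

  Sufficiency: under reverse doubling the sums \<open>\<Sum>k\<le>n. g(k)\<^sup>-\<^sup>\<gamma> / k\<close> and \<open>\<Sum>k\<ge>n. g(k)\<^sup>1\<^sup>-\<^sup>\<gamma> / k\<close> are dominated by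
  \<open>g(n)\<^sup>-\<^sup>\<gamma>\<close> and \<open>g(n)\<^sup>1\<^sup>-\<^sup>\<gamma>\<close> for \<open>0 < \<gamma> < 1\<close>, and Schur's test applies with powers of the tail integral.
\<close>

section \<open>Area measure in polar coordinates\<close>

text \<open>The factor 1/(n+1) in \<open>S\<close> has a separate source for each bound. For the
  upper one, the terms of the series are weighted by 1/(1 + ((n+1)|1-u|)^2), whose integral over a
  circle is O(1/(n+1)) uniformly in the radius. For the lower one, the bounded function pi - t has
  Fourier coefficients of size 1/(n+1), and the coefficients of \<open>K\<close> are positive, so
  nothing cancels. The coefficients are regular because differences of moments carry factors 1 -
  r^2: part of the power of r buys 1/n for each factor, and doubling makes up for the lowered index.
  Schur's test uses \<gamma> = 1/p; the (p-1)-st power of the test function then has exponent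
  (p-1)/p, again between 0 and 1, so one estimate for the symmetric kernel serves both conditions.
  The weight is only Lebesgue measurable and only meaningful on [0,1). All estimates are made for a
  Borel profile that is nonnegative, vanishes outside [0,1) and agrees with the weight almost
  everywhere on it; the weight itself returns at the end.\<close>

lemma nn_integral_lborel_shift:
  fixes F :: "'a::euclidean_space \<Rightarrow> ennreal"
  assumes [measurable]: "F \<in> borel_measurable borel"
  shows "(\<integral>\<^sup>+x. F (c + x) \<partial>lborel) = (\<integral>\<^sup>+x. F x \<partial>lborel)"
proof -
  have "(\<integral>\<^sup>+x. F x \<partial>lborel) = (\<integral>\<^sup>+x. F x \<partial>distr lborel borel ((+) c))"
    by (simp add: lborel_distr_plus)
  also have "\<dots> = (\<integral>\<^sup>+x. F (c + x) \<partial>lborel)"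
    by (subst nn_integral_distr) auto
  finally show ?thesis by simp
qed

lemma emeasure_unit_disc: "emeasure lborel (ball (0::complex) 1) = ennreal pi"
  using emeasure_ball[of 1 "0::complex"] unit_ball_vol_2 by simp

text \<open>
  The argument behind uniqueness of Haar measure: the double integral of
  \<open>F (c x) \<cdot> 1\<^sub>B (y - c x)\<close> over the unit disc \<open>B\<close> is computed in both orders.
\<close>
lemma nn_integral_lborel_rotate:
  fixes F :: "complex \<Rightarrow> ennreal"
  assumes [measurable]: "F \<in> borel_measurable borel" and c: "cmod c = 1"
  shows "(\<integral>\<^sup>+x. F (c * x) \<partial>lborel) = (\<integral>\<^sup>+x. F x \<partial>lborel)"
proof -
  let ?B = "ball (0::complex) 1"
  have [measurable]: "?B \<in> sets borel" by simp
  have c0: "c \<noteq> 0" using c by auto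
  have "(\<integral>\<^sup>+x. F (c * x) \<partial>lborel) * ennreal pi
      = (\<integral>\<^sup>+x. F (c * x) * (\<integral>\<^sup>+y. indicator ?B y \<partial>lborel) \<partial>lborel)"
    by (simp add: emeasure_unit_disc nn_integral_multc)
  also have "\<dots> = (\<integral>\<^sup>+x. F (c * x) * (\<integral>\<^sup>+y. indicator ?B (- (c * x) + y) \<partial>lborel) \<partial>lborel)"
    by (subst nn_integral_lborel_shift) auto
  also have "\<dots> = (\<integral>\<^sup>+x. (\<integral>\<^sup>+y. F (c * x) * indicator ?B (- (c * x) + y) \<partial>lborel) \<partial>lborel)"
    by (subst nn_integral_cmult) auto
  also have "\<dots> = (\<integral>\<^sup>+y. (\<integral>\<^sup>+x. F (c * x) * indicator ?B (- (c * x) + y) \<partial>lborel) \<partial>lborel)"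
    by (rule lborel_pair.Fubini') measurable
  \<comment> \<open>The inner variable is shifted by y/c. As |c| = 1, multiplication by c leaves
    membership in the disc unchanged.\<close>
  also have "\<dots> = (\<integral>\<^sup>+y. (\<integral>\<^sup>+x. F (y + c * x) * indicator ?B x \<partial>lborel) \<partial>lborel)"
  proof (rule nn_integral_cong)
    fix y
    have "(\<integral>\<^sup>+x. F (c * x) * indicator ?B (- (c * x) + y) \<partial>lborel)
        = (\<integral>\<^sup>+x. F (c * (y / c + x)) * indicator ?B (- (c * (y / c + x)) + y) \<partial>lborel)"
      by (subst nn_integral_lborel_shift[of "\<lambda>x. F (c * x) * indicator ?B (- (c * x) + y)" "y / c"]) auto
    also have "\<dots> = (\<integral>\<^sup>+x. F (y + c * x) * indicator ?B x \<partial>lborel)"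
      using c c0 by (intro nn_integral_cong) (auto simp: algebra_simps indicator_def norm_mult)
    finally show "(\<integral>\<^sup>+x. F (c * x) * indicator ?B (- (c * x) + y) \<partial>lborel)
        = (\<integral>\<^sup>+x. F (y + c * x) * indicator ?B x \<partial>lborel)" .
  qed
  also have "\<dots> = (\<integral>\<^sup>+x. (\<integral>\<^sup>+y. F (y + c * x) * indicator ?B x \<partial>lborel) \<partial>lborel)"
    by (rule lborel_pair.Fubini') measurable
  also have "\<dots> = (\<integral>\<^sup>+x. (\<integral>\<^sup>+y. F (c * x + y) \<partial>lborel) * indicator ?B x \<partial>lborel)"
    by (subst nn_integral_multc) (auto simp: add.commute)
  also have "\<dots> = (\<integral>\<^sup>+y. F y \<partial>lborel) * ennreal pi"
    by (subst nn_integral_lborel_shift) (auto simp: nn_integral_cmult emeasure_unit_disc)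
  finally show ?thesis
    by (simp add: mult.commute[of _ "ennreal pi"] ennreal_mult_cancel_left)
qed

text \<open>The argument a of \<open>u\<close> shifts the angle, so the integral runs over [a, a +
  2*pi). By periodicity the part beyond 2*pi moves back to [0, a).\<close>

lemma nn_integral_circle_shift:
  fixes F :: "complex \<Rightarrow> ennreal"
  assumes [measurable]: "F \<in> borel_measurable borel"
  shows "(\<integral>\<^sup>+t\<in>{0..<2*pi}. F (u * cis t) \<partial>lborel)
       = (\<integral>\<^sup>+t\<in>{0..<2*pi}. F (of_real (cmod u) * cis t) \<partial>lborel)"
proof -
  define a where "a = Arg2pi u"
  have a: "0 \<le> a" "a < 2 * pi" by (auto simp: a_def Arg2pi_ge_0 Arg2pi_lt_2pi)
  have u: "u = of_real (cmod u) * cis a"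
    using Arg2pi_eq[of u] by (simp add: a_def cis_conv_exp)
  define f where "f t = F (of_real (cmod u) * cis t)" for t
  have [measurable]: "f \<in> borel_measurable borel" unfolding f_def by (simp add: cis_conv_exp)
  have per: "f (2 * pi + t) = f t" for t
    by (simp add: f_def cis_mult[symmetric])
  have "(\<integral>\<^sup>+t\<in>{0..<2*pi}. F (u * cis t) \<partial>lborel)
      = (\<integral>\<^sup>+t. f (a + t) * indicator {a..<a + 2*pi} (a + t) \<partial>lborel)"
    by (rule nn_integral_cong, subst u)
       (auto simp: f_def indicator_def cis_mult[symmetric] mult_ac)
  also have "\<dots> = (\<integral>\<^sup>+t. f t * indicator {a..<a + 2*pi} t \<partial>lborel)"
    by (rule nn_integral_lborel_shift[where F = "\<lambda>t. f t * indicator {a..<a + 2*pi} t"]) auto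
  also have "\<dots> = (\<integral>\<^sup>+t. f t * indicator {a..<2*pi} t + f t * indicator {2*pi..<2*pi + a} t \<partial>lborel)"
    using a by (intro nn_integral_cong) (auto simp: indicator_def)
  also have "\<dots> = (\<integral>\<^sup>+t. f t * indicator {a..<2*pi} t \<partial>lborel)
                  + (\<integral>\<^sup>+t. f t * indicator {2*pi..<2*pi + a} t \<partial>lborel)"
    by (rule nn_integral_add) auto
  also have "(\<integral>\<^sup>+t. f t * indicator {2*pi..<2*pi + a} t \<partial>lborel)
      = (\<integral>\<^sup>+t. f (2*pi + t) * indicator {2*pi..<2*pi + a} (2*pi + t) \<partial>lborel)"
    by (rule nn_integral_lborel_shift[where F = "\<lambda>t. f t * indicator {2*pi..<2*pi + a} t", symmetric]) auto
  also have "\<dots> = (\<integral>\<^sup>+t. f t * indicator {0..<a} t \<partial>lborel)"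
    by (intro nn_integral_cong) (auto simp: per indicator_def)
  also have "(\<integral>\<^sup>+t. f t * indicator {a..<2*pi} t \<partial>lborel) + \<dots>
      = (\<integral>\<^sup>+t. f t * indicator {a..<2*pi} t + f t * indicator {0..<a} t \<partial>lborel)"
    by (rule nn_integral_add[symmetric]) auto
  also have "\<dots> = (\<integral>\<^sup>+t\<in>{0..<2*pi}. f t \<partial>lborel)"
    using a by (intro nn_integral_cong) (auto simp: indicator_def)
  finally show ?thesis by (simp add: f_def)
qed

section \<open>Normalised area measure: measurability, radial distribution, polar
  coordinates\<close>

lemma sets_disc_area: "sets disc_area = sets (lebesgue_on (ball 0 1))"
  and space_disc_area [simp]: "space disc_area = ball 0 1"
  by (simp_all add: disc_area_def)

lemma measurable_disc_area_eq: "measurable disc_area N = measurable (lebesgue_on (ball 0 1)) N"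
  by (rule measurable_cong_sets) (simp_all add: sets_disc_area)

lemma measurable_disc_area_borel [measurable (raw)]:
  "f \<in> borel \<rightarrow>\<^sub>M N \<Longrightarrow> f \<in> disc_area \<rightarrow>\<^sub>M N"
  unfolding measurable_disc_area_eq
  by (rule measurable_restrict_space1) (simp add: measurable_completion)

lemma nn_integral_disc_area:
  fixes F :: "complex \<Rightarrow> ennreal"
  assumes [measurable]: "F \<in> borel_measurable borel"
  shows "(\<integral>\<^sup>+z. F z \<partial>disc_area) = ennreal (1 / pi) * (\<integral>\<^sup>+z. F z * indicator (ball 0 1) z \<partial>lborel)"
proof -
  have m: "F \<in> borel_measurable (lebesgue_on (ball 0 1))"
    by (rule measurable_restrict_space1) (simp add: measurable_completion)
  have "(\<integral>\<^sup>+z. F z \<partial>disc_area) = (\<integral>\<^sup>+z. ennreal (1 / pi) * F z \<partial>lebesgue_on (ball 0 1))"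
    unfolding disc_area_def using m by (subst nn_integral_density) auto
  also have "\<dots> = ennreal (1 / pi) * (\<integral>\<^sup>+z. F z \<partial>lebesgue_on (ball 0 1))"
    using m by (subst nn_integral_cmult) auto
  also have "(\<integral>\<^sup>+z. F z \<partial>lebesgue_on (ball 0 1)) = (\<integral>\<^sup>+z. F z * indicator (ball 0 1) z \<partial>lebesgue)"
    by (subst nn_integral_restrict_space) auto
  finally show ?thesis by (simp add: nn_integral_completion)
qed

lemma emeasure_disc_area_annulus:
  "emeasure disc_area ({z. x < cmod z} \<inter> ball 0 1)
     = (if x < 0 then 1 else if x < 1 then ennreal (1 - x\<^sup>2) else 0)"
proof -
  have m: "{z::complex. x < cmod z} \<inter> ball 0 1 \<in> sets borel"
    by (intro sets.Int borel_open open_Collect_less continuous_intros) auto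
  then have ms: "{z::complex. x < cmod z} \<inter> ball 0 1 \<in> sets disc_area"
    using sets_completionI_sets[of _ lborel] by (auto simp: sets_disc_area sets_restrict_space)
  have "emeasure disc_area ({z. x < cmod z} \<inter> ball 0 1)
      = ennreal (1 / pi) * emeasure lborel ({z. x < cmod z} \<inter> ball (0::complex) 1)"
    using ms nn_integral_disc_area[OF borel_measurable_indicator[OF m]] m
    by (simp add: Int_assoc flip: indicator_inter_arith)
  also have "emeasure lborel ({z. x < cmod z} \<inter> ball (0::complex) 1)
     = (if x < 0 then ennreal pi else if x < 1 then ennreal (pi * (1 - x\<^sup>2)) else 0)"
  proof (cases "x < 0")
    case True
    then have "{z. x < cmod z} \<inter> ball (0::complex) 1 = ball 0 1"
      by (auto intro: less_le_trans)
    with True show ?thesis by (simp add: emeasure_unit_disc)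
  next
    case False
    show ?thesis
    proof (cases "x < 1")
      case True
      have "{z. x < cmod z} \<inter> ball (0::complex) 1 = ball 0 1 - cball 0 x" by auto
      also have "emeasure lborel \<dots> = emeasure lborel (ball (0::complex) 1) - emeasure lborel (cball (0::complex) x)"
        using True False
        by (intro emeasure_Diff) (auto simp: emeasure_cball)
      also have "\<dots> = ennreal pi - ennreal (pi * x\<^sup>2)"
        using False by (simp add: emeasure_unit_disc emeasure_cball unit_ball_vol_2)
      also have "\<dots> = ennreal (pi * (1 - x\<^sup>2))"
        by (subst ennreal_minus) (auto simp: algebra_simps)
      finally show ?thesis using True False by simp
    next
      case False
      then have "{z. x < cmod z} \<inter> ball (0::complex) 1 = {}" by auto
      with False show ?thesis by auto
    qed
  qed
  also have "ennreal (1 / pi) * \<dots> = (if x < 0 then 1 else if x < 1 then ennreal (1 - x\<^sup>2) else 0)"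
    by (auto simp: ennreal_mult'[symmetric] simp del: ennreal_1 intro: arg_cong[of _ _ ennreal]
             simp flip: ennreal_1)
  finally show ?thesis .
qed

text \<open>A distribution that is finite on the half-lines {x<..} is determined by them, and they
  pull back to annuli of area 1 - x^2; this is where the density 2r comes from.\<close>

lemma distr_cmod_disc_area:
  "distr disc_area borel cmod = density lborel (\<lambda>r. ennreal (2 * r) * indicator {0..<1} r)"
proof (rule measure_eqI_lessThan)
  have [measurable]: "cmod \<in> disc_area \<rightarrow>\<^sub>M borel" by measurable
  have 1: "emeasure (distr disc_area borel cmod) {x<..}
     = (if x < 0 then 1 else if x < 1 then ennreal (1 - x\<^sup>2) else 0)" for x
    by (subst emeasure_distr) (auto simp: emeasure_disc_area_annulus[symmetric] vimage_def intro!: arg_cong[of _ _ "emeasure disc_area"])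
  show "emeasure (distr disc_area borel cmod) {x<..} < \<infinity>" for x
    by (simp add: 1)
  show "emeasure (distr disc_area borel cmod) {x<..}
      = emeasure (density lborel (\<lambda>r. ennreal (2 * r) * indicator {0..<1} r)) {x<..}" for x
  proof -
    have "emeasure (density lborel (\<lambda>r. ennreal (2 * r) * indicator {0..<1} r)) {x<..}
        = (\<integral>\<^sup>+r. ennreal (2 * r) * indicator {0..<1} r * indicator {x<..} r \<partial>lborel)"
      by (subst emeasure_density) auto
    also have "\<dots> = (\<integral>\<^sup>+r. ennreal (2 * r) * indicator {max 0 x..1} r \<partial>lborel)"
    proof (rule nn_integral_cong_AE)
      have "AE r in lborel. r \<noteq> 1 \<and> r \<noteq> x"
        using AE_lborel_singleton[of "1::real"] AE_lborel_singleton[of x] by eventually_elim simp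
      then show "AE r in lborel. ennreal (2 * r) * indicator {0..<1} r * indicator {x<..} r
          = ennreal (2 * r) * indicator {max 0 x..1} r"
        by eventually_elim (auto simp: indicator_def)
    qed
    also have "\<dots> = (if x < 0 then 1 else if x < 1 then ennreal (1 - x\<^sup>2) else 0)"
    proof (cases "x < 1")
      case True
      have "(\<integral>\<^sup>+r. ennreal (2 * r) * indicator {max 0 x..1} r \<partial>lborel) = ennreal (1\<^sup>2 - (max 0 x)\<^sup>2)"
        using True by (intro nn_integral_FTC_Icc) (auto intro!: derivative_eq_intros)
      then show ?thesis using True by (auto simp: max_def)
    next
      case False
      have "(\<integral>\<^sup>+r. ennreal (2 * r) * indicator {max 0 x..1} r \<partial>lborel) = (\<integral>\<^sup>+(r::real). 0 \<partial>lborel)"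
      proof (rule nn_integral_cong_AE)
        show "AE r in lborel. ennreal (2 * r) * indicator {max 0 x..1} r = 0"
          using AE_lborel_singleton[of "1::real"] by eventually_elim (use False in auto)
      qed
      then show ?thesis using False by simp
    qed
    finally show ?thesis using 1 by simp
  qed
qed auto

lemma nn_integral_disc_radial:
  fixes R :: "real \<Rightarrow> ennreal"
  assumes [measurable]: "R \<in> borel_measurable borel"
  shows "(\<integral>\<^sup>+z. R (cmod z) \<partial>disc_area) = (\<integral>\<^sup>+r. ennreal (2 * r) * R r * indicator {0..<1} r \<partial>lborel)"
proof -
  have "(\<integral>\<^sup>+z. R (cmod z) \<partial>disc_area) = (\<integral>\<^sup>+r. R r \<partial>distr disc_area borel cmod)"
    by (subst nn_integral_distr) auto
  also have "\<dots> = (\<integral>\<^sup>+r. ennreal (2 * r) * R r * indicator {0..<1} r \<partial>lborel)"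
    unfolding distr_cmod_disc_area
    by (subst nn_integral_density) (auto intro!: nn_integral_cong simp: mult_ac)
  finally show ?thesis .
qed

text \<open>By rotation invariance \<open>F\<close> may be averaged over all rotations without
  changing its integral. The average depends on the modulus alone, so the distribution of the
  modulus finishes the computation and no Jacobian appears.\<close>

lemma nn_integral_disc_polar:
  fixes F :: "complex \<Rightarrow> ennreal"
  assumes [measurable]: "F \<in> borel_measurable borel"
  shows "(\<integral>\<^sup>+z. F z \<partial>disc_area)
     = (\<integral>\<^sup>+r. ennreal (r / pi) * (\<integral>\<^sup>+t\<in>{0..<2*pi}. F (of_real r * cis t) \<partial>lborel)
          * indicator {0..<1} r \<partial>lborel)"
proof -
  have [measurable]: "cis \<in> borel \<rightarrow>\<^sub>M borel" "ball (0::complex) 1 \<in> sets borel"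
    by (auto intro!: borel_measurable_continuous_onI continuous_intros)
  let ?I = "\<integral>\<^sup>+z. F z * indicator (ball 0 1) z \<partial>lborel"
  have rot: "(\<integral>\<^sup>+z. F (z * cis t) * indicator (ball 0 1) z \<partial>lborel) = ?I" for t
    using nn_integral_lborel_rotate[of "\<lambda>z. F z * indicator (ball 0 1) z" "cis t"]
    by (simp add: indicator_def norm_mult mult.commute)
  have 2: "(\<integral>\<^sup>+t. indicator {0..<2*pi} t \<partial>lborel) = ennreal (2 * pi)"
    by simp
  have "ennreal (2 * pi) * ?I = (\<integral>\<^sup>+t\<in>{0..<2*pi}. ?I \<partial>lborel)"
    by (subst nn_integral_cmult) (auto simp: mult.commute)
  also have "\<dots> = (\<integral>\<^sup>+t. (\<integral>\<^sup>+z. F (z * cis t) * indicator (ball 0 1) z * indicator {0..<2*pi} t \<partial>lborel) \<partial>lborel)"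
    by (subst nn_integral_multc) (auto simp: rot)
  also have "\<dots> = (\<integral>\<^sup>+z. (\<integral>\<^sup>+t\<in>{0..<2*pi}. F (z * cis t) * indicator (ball 0 1) z \<partial>lborel) \<partial>lborel)"
    by (rule lborel_pair.Fubini') measurable
  also have "\<dots> = (\<integral>\<^sup>+z. (\<integral>\<^sup>+t\<in>{0..<2*pi}. F (z * cis t) \<partial>lborel) * indicator (ball 0 1) z \<partial>lborel)"
    by (subst nn_integral_multc[symmetric]) (auto simp: mult_ac)
  \<comment> \<open>Starting the circle through z at the positive real axis shows that the inner
    integral is radial.\<close>
  also have "\<dots> = (\<integral>\<^sup>+z. (\<integral>\<^sup>+t\<in>{0..<2*pi}. F (of_real (cmod z) * cis t) \<partial>lborel)
                    * indicator (ball 0 1) z \<partial>lborel)"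
    by (subst nn_integral_circle_shift) auto
  finally have *: "ennreal (2 * pi) * ?I
      = (\<integral>\<^sup>+z. (\<integral>\<^sup>+t\<in>{0..<2*pi}. F (of_real (cmod z) * cis t) \<partial>lborel)
                    * indicator (ball 0 1) z \<partial>lborel)" .
  define A where "A r = (\<integral>\<^sup>+t\<in>{0..<2*pi}. F (of_real r * cis t) \<partial>lborel)" for r
  have [measurable]: "A \<in> borel_measurable borel" unfolding A_def by measurable
  have "?I = ennreal (1 / (2 * pi)) * (ennreal (2 * pi) * ?I)"
    by (simp add: mult.assoc[symmetric] ennreal_mult'[symmetric])
  also have "\<dots> = ennreal (1 / (2 * pi)) * (\<integral>\<^sup>+z. A (cmod z) * indicator (ball 0 1) z \<partial>lborel)"
    using * by (simp add: A_def)
  finally have "(\<integral>\<^sup>+z. F z \<partial>disc_area) = ennreal (1 / (2 * pi)) * (\<integral>\<^sup>+z. A (cmod z) \<partial>disc_area)"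
    by (simp add: nn_integral_disc_area mult_ac)
  also have "\<dots> = ennreal (1 / (2 * pi)) * (\<integral>\<^sup>+r. ennreal (2 * r) * A r * indicator {0..<1} r \<partial>lborel)"
    by (subst nn_integral_disc_radial) auto
  also have "\<dots> = (\<integral>\<^sup>+r. ennreal (1 / (2 * pi)) * (ennreal (2 * r) * A r * indicator {0..<1} r) \<partial>lborel)"
    by (subst nn_integral_cmult) auto
  also have "\<dots> = (\<integral>\<^sup>+r. ennreal (r / pi) * A r * indicator {0..<1} r \<partial>lborel)"
    by (intro nn_integral_cong)
       (auto simp: indicator_def ennreal_mult'[symmetric] mult.assoc[symmetric])
  finally show ?thesis by (simp add: A_def)
qed

text \<open>The argument of \<open>z\<close> merely rotates the circles on which
  \<open>\<zeta>\<close> runs, so \<open>z\<close> enters through its modulus only. Integrals of the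
  kernel against radial functions have this form.\<close>

lemma nn_integral_disc_polar_product:
  fixes F :: "complex \<Rightarrow> ennreal" and R :: "real \<Rightarrow> ennreal"
  assumes [measurable]: "F \<in> borel_measurable borel" "R \<in> borel_measurable borel"
  shows "(\<integral>\<^sup>+\<zeta>. F (cnj z * \<zeta>) * R (cmod \<zeta>) \<partial>disc_area)
    = (\<integral>\<^sup>+r. ennreal (r / pi) * (\<integral>\<^sup>+t\<in>{0..<2*pi}. F (of_real (cmod z * r) * cis t) \<partial>lborel)
        * R r * indicator {0..<1} r \<partial>lborel)"
proof -
  have [measurable]: "cis \<in> borel \<rightarrow>\<^sub>M borel"
    by (intro borel_measurable_continuous_onI continuous_intros)
  have "(\<integral>\<^sup>+\<zeta>. F (cnj z * \<zeta>) * R (cmod \<zeta>) \<partial>disc_area)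
    = (\<integral>\<^sup>+r. ennreal (r / pi) * (\<integral>\<^sup>+t\<in>{0..<2*pi}. F (cnj z * (of_real r * cis t)) * R (cmod (of_real r * cis t))
        \<partial>lborel) * indicator {0..<1} r \<partial>lborel)"
    by (rule nn_integral_disc_polar) measurable
  also have "\<dots> = (\<integral>\<^sup>+r. ennreal (r / pi) * (\<integral>\<^sup>+t\<in>{0..<2*pi}. F (of_real (cmod z * r) * cis t) \<partial>lborel)
        * R r * indicator {0..<1} r \<partial>lborel)"
  proof (rule nn_integral_cong)
    fix r :: real
    show "ennreal (r / pi) * (\<integral>\<^sup>+t\<in>{0..<2*pi}. F (cnj z * (of_real r * cis t)) * R (cmod (of_real r * cis t))
        \<partial>lborel) * indicator {0..<1} r
      = ennreal (r / pi) * (\<integral>\<^sup>+t\<in>{0..<2*pi}. F (of_real (cmod z * r) * cis t) \<partial>lborel)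
        * R r * indicator {0..<1} r"
    proof (cases "r \<in> {0..<1}")
      case True
      have "(\<integral>\<^sup>+t\<in>{0..<2*pi}. F (cnj z * (of_real r * cis t)) * R (cmod (of_real r * cis t)) \<partial>lborel)
          = (\<integral>\<^sup>+t. F (cnj z * of_real r * cis t) * indicator {0..<2*pi} t * R r \<partial>lborel)"
        using True by (intro nn_integral_cong) (simp add: norm_mult mult_ac)
      also have "\<dots> = (\<integral>\<^sup>+t\<in>{0..<2*pi}. F (cnj z * of_real r * cis t) \<partial>lborel) * R r"
        by (rule nn_integral_multc) measurable
      also have "(\<integral>\<^sup>+t\<in>{0..<2*pi}. F (cnj z * of_real r * cis t) \<partial>lborel)
          = (\<integral>\<^sup>+t\<in>{0..<2*pi}. F (of_real (cmod z * r) * cis t) \<partial>lborel)"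
        using True by (subst nn_integral_circle_shift) (simp_all add: norm_mult)
      finally show ?thesis by (simp add: mult_ac)
    qed simp
  qed
  finally show ?thesis .
qed

text \<open>The preimage of a null set N under the modulus has as its area the integral of 2r over
  the part of N in [0,1), hence zero. This carries the agreement of two profiles over to the
  disc.\<close>

lemma AE_disc_area_radial:
  assumes "AE r in lborel. P (r :: real)"
  shows "AE z in disc_area. P (cmod z)"
proof -
  from AE_E[OF assms] obtain N where N: "{r. \<not> P r} \<subseteq> N" "emeasure lborel N = 0" "N \<in> sets lborel"
    by auto
  have [measurable]: "N \<in> sets borel" using N(3) by simp
  have "(\<integral>\<^sup>+z. indicator N (cmod z) \<partial>disc_area) = (\<integral>\<^sup>+r. ennreal (2 * r) * indicator N r * indicator {0..<1} r \<partial>lborel)"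
    by (rule nn_integral_disc_radial) measurable
  also have "\<dots> = 0"
  proof (subst nn_integral_0_iff_AE)
    have "AE r in lborel. r \<notin> N" using N by (intro AE_not_in) auto
    then show "AE r in lborel. ennreal (2 * r) * indicator N r * indicator {0..<1} r = 0"
      by eventually_elim auto
  qed measurable
  finally have "AE z in disc_area. indicator N (cmod z) = (0 :: ennreal)"
    by (subst (asm) nn_integral_0_iff_AE) measurable
  then show ?thesis by eventually_elim (use N(1) in \<open>auto simp: indicator_def split: if_splits\<close>)
qed

text \<open>Completeness of Lebesgue measure. It is needed for the weight as a function on the disc:
  a Lebesgue measurable profile composed with \<open>cmod\<close> is not measurable by composition
  alone.\<close>

lemma borel_measurable_disc_area_AE:
  fixes f h :: "complex \<Rightarrow> real"
  assumes [measurable]: "f \<in> borel_measurable borel" and ae: "AE z in disc_area. f z = h z"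
  shows "h \<in> borel_measurable disc_area"
proof -
  have "AE z in lebesgue_on (ball 0 1). f z = h z"
    using ae unfolding disc_area_def
    by (subst (asm) AE_density) auto
  then have ae': "AE z in lebesgue. z \<in> ball 0 1 \<longrightarrow> f z = h z"
    by (subst (asm) AE_restrict_space_iff) auto
  have "(\<lambda>z. if z \<in> ball 0 1 then f z else 0) \<in> borel_measurable lebesgue"
    by (intro borel_measurable_if_I measurable_restrict_space1) (auto simp: measurable_completion)
  moreover have "AE z in lebesgue. (if z \<in> ball 0 1 then f z else 0) = (if z \<in> ball 0 1 then h z else 0)"
    using ae' by eventually_elim auto
  ultimately have "(\<lambda>z. if z \<in> ball 0 1 then h z else 0) \<in> borel_measurable lebesgue"
    by (rule borel_measurable_AE)
  then have "h \<in> borel_measurable (lebesgue_on (ball 0 1))"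
    by (rule borel_measurable_if_D)
  then show ?thesis by (simp add: measurable_disc_area_eq)
qed

section \<open>Power series with regular coefficients\<close>

text \<open>Jordan's inequality: the chord of a concave function lies below the graph.\<close>

lemma two_div_pi_mult_le_sin:
  fixes x :: real
  assumes "0 \<le> x" "x \<le> pi / 2"
  shows "2 * x / pi \<le> sin x"
proof -
  have "convex_on {0..pi/2} (\<lambda>x. - sin x)"
  proof (rule f''_ge0_imp_convex)
    show "((\<lambda>x. - sin x) has_real_derivative - cos x) (at x)" for x :: real
      by (auto intro!: derivative_eq_intros)
    show "((\<lambda>x. - cos x) has_real_derivative sin x) (at x)" for x :: real
      by (auto intro!: derivative_eq_intros)
    show "x \<in> {0..pi/2} \<Longrightarrow> 0 \<le> sin x" for x :: real
      by (auto intro!: sin_ge_zero)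
  qed auto
  from convex_onD[OF this, of "2 * x / pi" 0 "pi / 2"] assms
  show ?thesis by (simp add: field_simps)
qed

text \<open>The squared distance equals (r - cos t)^2 + (sin t)^2. For t up to pi/2 the sine alone
  suffices; beyond, the cosine is nonpositive and the distance is at least 1. The bound is therefore
  uniform in \<open>r\<close>.\<close>

lemma dist_le_cmod_one_minus_cis:
  fixes r t :: real
  assumes r: "0 \<le> r" and t: "0 \<le> t" "t \<le> pi"
  shows "t / pi \<le> cmod (1 - of_real r * cis t)"
proof (rule power2_le_imp_le)
  have eq: "(cmod (1 - of_real r * cis t))\<^sup>2 = (r - cos t)\<^sup>2 + (sin t)\<^sup>2"
  proof -
    have "(1 - r * c)\<^sup>2 + (r * s)\<^sup>2 = (r - c)\<^sup>2 + s\<^sup>2" if "s\<^sup>2 + c\<^sup>2 = 1" for s c :: real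
      using that by algebra
    from this[OF sin_cos_squared_add[of t]] show ?thesis by (simp add: cmod_power2)
  qed
  show "(t / pi)\<^sup>2 \<le> (cmod (1 - of_real r * cis t))\<^sup>2"
  proof (cases "t \<le> pi / 2")
    case True
    have "t / pi \<le> 2 * t / pi" using t by (simp add: field_simps)
    also have "\<dots> \<le> sin t" using two_div_pi_mult_le_sin[of t] True t by simp
    finally have "(t / pi)\<^sup>2 \<le> (sin t)\<^sup>2" using t by (intro power_mono) auto
    then show ?thesis unfolding eq by (simp add: add_increasing)
  next
    case False
    have "cos t \<le> 0" using False t cos_monotone_0_pi_le[of "pi / 2" t] by simp
    then have "r * cos t \<le> 0" using r by (simp add: mult_nonneg_nonpos)
    moreover have "(r - cos t)\<^sup>2 + (sin t)\<^sup>2 = r\<^sup>2 - 2 * (r * cos t) + 1"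
      using sin_cos_squared_add[of t] by (simp add: power2_diff algebra_simps)
    ultimately have "1 \<le> (r - cos t)\<^sup>2 + (sin t)\<^sup>2"
      using zero_le_power2[of r] by linarith
    moreover have "(t / pi)\<^sup>2 \<le> 1" using t by (simp add: power_le_one)
    ultimately show ?thesis unfolding eq by linarith
  qed
qed simp

lemma nn_integral_arctan_bound:
  fixes c a b :: real
  assumes c: "0 < c" and ab: "a \<le> b"
  shows "(\<integral>\<^sup>+t. ennreal (1 / (1 + (c * t)\<^sup>2)) * indicator {a..b} t \<partial>lborel) \<le> ennreal (pi / c)"
proof -
  have "(\<integral>\<^sup>+t. ennreal (1 / (1 + (c * t)\<^sup>2)) * indicator {a..b} t \<partial>lborel)
      = ennreal (arctan (c * b) / c - arctan (c * a) / c)"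
  proof (rule nn_integral_FTC_Icc)
    show "((\<lambda>t. arctan (c * t) / c) has_real_derivative 1 / (1 + (c * t)\<^sup>2)) (at t)" for t
      using c by (auto intro!: derivative_eq_intros simp: divide_simps)
  qed (use ab in auto)
  also have "arctan (c * b) / c - arctan (c * a) / c \<le> pi / c"
    using arctan_bounded[of "c * b"] arctan_bounded[of "c * a"] c
    by (simp add: diff_divide_distrib[symmetric] divide_right_mono)
  finally show ?thesis by (simp add: ennreal_leI)
qed

text \<open>With k = n + 1 this supplies the factor 1/(n+1). On [0, pi] the integrand is at most
  1/(1 + (k*t/pi)^2) for every \<open>r\<close>, an arctangent derivative; the other half circle is
  the mirror image.\<close>

lemma nn_integral_circle_one_minus_bound:
  fixes k r :: real
  assumes k: "0 < k" and r: "0 \<le> r"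
  shows "(\<integral>\<^sup>+t\<in>{0..<2*pi}. ennreal (1 / (1 + (k * cmod (1 - of_real r * cis t))\<^sup>2)) \<partial>lborel)
    \<le> ennreal (2 * pi\<^sup>2 / k)"
proof -
  define c where "c = k / pi"
  have c: "0 < c" using k by (simp add: c_def)
  let ?w = "\<lambda>t. ennreal (1 / (1 + (c * t)\<^sup>2))"
  have near: "1 / (1 + (k * cmod (1 - of_real r * cis t))\<^sup>2) \<le> 1 / (1 + (c * s)\<^sup>2)"
    if "0 \<le> s" "s \<le> pi" "cmod (1 - of_real r * cis t) = cmod (1 - of_real r * cis s)" for s t
  proof -
    have "c * s \<le> k * cmod (1 - of_real r * cis t)"
      using mult_left_mono[OF dist_le_cmod_one_minus_cis[OF r that(1,2)], of k] k that
      by (simp add: c_def)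
    then have "(c * s)\<^sup>2 \<le> (k * cmod (1 - of_real r * cis t))\<^sup>2"
      using c that by (intro power_mono) auto
    then show ?thesis by (intro divide_left_mono) (auto intro!: mult_pos_pos add_pos_nonneg)
  qed
  have refl: "cmod (1 - of_real r * cis t) = cmod (1 - of_real r * cis (2 * pi - t))" for t
  proof -
    have "1 - of_real r * cis (2 * pi - t) = cnj (1 - of_real r * cis t)"
      using cis_divide[of "2 * pi" t] by (simp add: cis_cnj divide_inverse)
    then show ?thesis by (metis complex_mod_cnj)
  qed
  have "(\<integral>\<^sup>+t\<in>{0..<2*pi}. ennreal (1 / (1 + (k * cmod (1 - of_real r * cis t))\<^sup>2)) \<partial>lborel)
     \<le> (\<integral>\<^sup>+t. ?w t * indicator {0..pi} t + ?w (-(2*pi) + t) * indicator {-pi..0} (-(2*pi) + t) \<partial>lborel)"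
  proof (rule nn_integral_mono)
    fix t :: real
    show "ennreal (1 / (1 + (k * cmod (1 - of_real r * cis t))\<^sup>2)) * indicator {0..<2*pi} t
      \<le> ?w t * indicator {0..pi} t + ?w (-(2*pi) + t) * indicator {-pi..0} (-(2*pi) + t)"
    proof (cases "0 \<le> t \<and> t \<le> pi")
      case True
      then show ?thesis using near[of t t] pi_gt_zero
        by (auto simp: indicator_def intro!: add_increasing2 ennreal_leI)
    next
      case False
      show ?thesis
      proof (cases "pi < t \<and> t < 2 * pi")
        case True
        have "(c * (2 * pi - t))\<^sup>2 = (c * (-(2*pi) + t))\<^sup>2" by (simp add: power2_eq_square algebra_simps)
        then show ?thesis using True near[of "2 * pi - t" t] refl[of t]
          by (auto simp: indicator_def intro!: add_increasing ennreal_leI)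
      qed (use False in \<open>auto simp: indicator_def\<close>)
    qed
  qed
  also have "\<dots> = (\<integral>\<^sup>+t. ?w t * indicator {0..pi} t \<partial>lborel)
      + (\<integral>\<^sup>+t. ?w (-(2*pi) + t) * indicator {-pi..0} (-(2*pi) + t) \<partial>lborel)"
    by (rule nn_integral_add) auto
  also have "(\<integral>\<^sup>+t. ?w (-(2*pi) + t) * indicator {-pi..0} (-(2*pi) + t) \<partial>lborel)
      = (\<integral>\<^sup>+t. ?w t * indicator {-pi..0} t \<partial>lborel)"
    using nn_integral_real_affine[of "\<lambda>t. ?w t * indicator {-pi..0} t" 1 "-(2*pi)"] by simp
  also have "(\<integral>\<^sup>+t. ?w t * indicator {0..pi} t \<partial>lborel) + \<dots> \<le> ennreal (pi / c) + ennreal (pi / c)"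
    by (intro add_mono nn_integral_arctan_bound c) auto
  also have "\<dots> = ennreal (2 * pi\<^sup>2 / k)"
    using k c by (subst ennreal_plus[symmetric]) (auto simp: c_def power2_eq_square field_simps)
  finally show ?thesis .
qed

text \<open>Multiplication by (1 - u)^2 acts on the coefficients as the second difference; the two
  separate terms are what the start of the sequence leaves over.\<close>

lemma summation_by_parts_twice:
  fixes s :: "nat \<Rightarrow> complex"
  assumes sm: "summable (\<lambda>n. s n * u ^ n)"
  shows "(1 - u)\<^sup>2 * (\<Sum>n. s n * u ^ n)
    = s 0 * (1 - u) + (s 1 - s 0) * u + (\<Sum>n. (s (n + 2) - 2 * s (n + 1) + s n) * u ^ (n + 2))"
proof -
  define F where "F = (\<Sum>n. s n * u ^ n)"
  have S0: "(\<lambda>n. s n * u ^ n) sums F" unfolding F_def using sm by (rule summable_sums)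
  have S1: "(\<lambda>n. s (n + 1) * u ^ (n + 1)) sums (F - s 0)"
    using sums_split_initial_segment[OF S0, of 1] by simp
  have S2: "(\<lambda>n. s (n + 2) * u ^ (n + 2)) sums (F - s 0 - s 1 * u)"
    using sums_split_initial_segment[OF S0, of 2] by (simp add: numeral_2_eq_2 algebra_simps)
  have "(\<lambda>n. s (n + 2) * u ^ (n + 2) - 2 * u * (s (n + 1) * u ^ (n + 1)) + u\<^sup>2 * (s n * u ^ n))
      sums ((F - s 0 - s 1 * u) - 2 * u * (F - s 0) + u\<^sup>2 * F)"
    by (intro sums_add sums_diff sums_mult S0 S1 S2)
  moreover have "s (n + 2) * u ^ (n + 2) - 2 * u * (s (n + 1) * u ^ (n + 1)) + u\<^sup>2 * (s n * u ^ n)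
      = (s (n + 2) - 2 * s (n + 1) + s n) * u ^ (n + 2)" for n
    by (simp add: power_add power2_eq_square algebra_simps)
  ultimately have "(\<Sum>n. (s (n + 2) - 2 * s (n + 1) + s n) * u ^ (n + 2))
      = (F - s 0 - s 1 * u) - 2 * u * (F - s 0) + u\<^sup>2 * F"
    by (simp add: sums_iff)
  then show ?thesis unfolding F_def[symmetric] by (simp add: power2_eq_square algebra_simps)
qed

text \<open>The function pi - t is bounded by pi on [0, 2*pi], and its integral against
  \<open>cis ((n + 1) * t)\<close> is 2*pi*i/(n+1). Integrating the series against it produces the
  weighted sum of the coefficients, with the constant 2*pi/pi = 2.\<close>

lemma hardy_inequality:
  fixes c :: "nat \<Rightarrow> real"
  assumes nonneg: "\<And>n. 0 \<le> c n" and sm: "summable c"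
  shows "ennreal (2 * (\<Sum>n. c n / (real n + 1)))
    \<le> (\<integral>\<^sup>+t\<in>{0..<2*pi}. ennreal (cmod (\<Sum>n. of_real (c n) * cis t ^ n)) \<partial>lborel)"
proof -
  \<comment> \<open>The frequency is \<open>Suc n\<close> rather than \<open>n\<close>: this creates
    the denominators n + 1 and avoids the frequency zero, at which the integral of pi - t
    vanishes.\<close>
  define e where "e n t = indicator {0..2*pi} t *\<^sub>R (of_real (pi - t) * cis (real (Suc n) * t))" for n t
  define f where "f n t = of_real (c n) * e n t" for n t
  have hb: "has_bochner_integral lborel (e n) (2 * pi * \<i> / of_nat (Suc n))" for n
  proof -
    let ?k = "complex_of_nat (Suc n)"
    \<comment> \<open>One integration by parts. The second term takes the same value at both
      endpoints, so only the first contributes.\<close>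
    define F where "F t = of_real (pi - t) * cis (real (Suc n) * t) / (\<i> * ?k) - cis (real (Suc n) * t) / ?k\<^sup>2" for t
    have k0: "?k \<noteq> 0" by (simp del: of_nat_Suc)
    have cis_eq: "cis (real (Suc n) * x) = exp (\<i> * ?k * of_real x)" for x
      unfolding cis_conv_exp of_real_mult of_real_of_nat_eq mult.assoc ..
    have "has_bochner_integral lborel
       (\<lambda>t. indicator {0..2*pi} t *\<^sub>R (of_real (pi - t) * cis (real (Suc n) * t))) (F (2*pi) - F 0)"
    proof (rule has_bochner_integral_FTC_Icc)
      fix t :: real
      let ?G = "\<lambda>z. (of_real pi - z) * exp (\<i> * ?k * z) / (\<i> * ?k) - exp (\<i> * ?k * z) / ?k\<^sup>2"
      have "(?G has_field_derivative
          ((-1) * exp (\<i> * ?k * t) + (exp (\<i> * ?k * t) * (\<i> * ?k)) * (of_real pi - t)) / (\<i> * ?k)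
          - (exp (\<i> * ?k * t) * (\<i> * ?k)) / ?k\<^sup>2) (at (of_real t))"
        by (intro DERIV_diff DERIV_cdivide DERIV_mult DERIV_fun_exp DERIV_cmult_Id)
           (auto intro!: derivative_eq_intros)
      also have "((-1) * exp (\<i> * ?k * t) + (exp (\<i> * ?k * t) * (\<i> * ?k)) * (of_real pi - t)) / (\<i> * ?k)
          - (exp (\<i> * ?k * t) * (\<i> * ?k)) / ?k\<^sup>2 = of_real (pi - t) * cis (real (Suc n) * t)"
      proof -
        have E: "exp (\<i> * ?k * t) = cis (real (Suc n) * t)" by (rule cis_eq[symmetric])
        have alg: "((-1) * x + (x * (\<i> * k)) * y) / (\<i> * k) - (x * (\<i> * k)) / k\<^sup>2 = y * x"
          if "k \<noteq> 0" for x y k :: complex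
          using that by (simp add: field_simps power2_eq_square)
        show ?thesis unfolding E alg[OF k0] by simp
      qed
      finally have "((\<lambda>x. ?G (of_real x)) has_vector_derivative of_real (pi - t) * cis (real (Suc n) * t)) (at t within {0..2*pi})"
        by (rule has_vector_derivative_real_field)
      moreover have "?G (of_real x) = F x" for x
        unfolding F_def cis_eq of_real_diff ..
      ultimately show "(F has_vector_derivative of_real (pi - t) * cis (real (Suc n) * t)) (at t within {0..2*pi})"
        by simp
    qed (auto intro!: continuous_intros)
    moreover have "cis (real (Suc n) * (2 * pi)) = 1"
      using cis_multiple_2pi[of "real (Suc n)"] by (simp add: mult_ac del: of_nat_Suc)
    then have "F (2*pi) - F 0 = 2 * pi * \<i> / ?k"
      using k0 by (simp add: F_def field_simps del: of_nat_Suc)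
    ultimately show ?thesis unfolding e_def by simp
  qed
  have int_e: "integrable lborel (e n)" and val_e: "integral\<^sup>L lborel (e n) = 2 * pi * \<i> / of_nat (Suc n)" for n
    using hb[of n] by (auto simp: has_bochner_integral_iff)
  have nb: "norm (e n t) \<le> pi * indicator {0..2*pi} t" for n t
    by (auto simp: e_def indicator_def norm_mult simp del: of_real_diff)
  have nf: "norm (f n t) \<le> c n * (pi * indicator {0..2*pi} t)" for n t
    using mult_left_mono[OF nb[of n t] nonneg[of n]] nonneg[of n] by (simp add: f_def norm_mult)
  have int_f: "integrable lborel (f n)" for n
    unfolding f_def by (rule integrable_mult_right) (rule int_e)
  have s1: "AE t in lborel. summable (\<lambda>n. norm (f n t))"
    by (intro AE_I2 summable_comparison_test[OF _ summable_mult2[OF sm]]) (use nf in auto)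
  have s2: "summable (\<lambda>n. LINT t|lborel. norm (f n t))"
  proof (rule summable_comparison_test[OF _ summable_mult2[OF sm]], intro exI allI impI)
    fix n
    have "(LINT t|lborel. norm (f n t)) \<le> (LINT t|lborel. c n * (pi * indicator {0..2*pi} t))"
      by (rule integral_mono) (use int_f nf in auto)
    also have "\<dots> = c n * (pi * (2 * pi))" by simp
    finally show "norm (LINT t|lborel. norm (f n t)) \<le> c n * (pi * (2 * pi))" by simp
  qed
  have sm': "summable (\<lambda>n. c n / (real n + 1))"
  proof (rule summable_comparison_test[OF _ sm], intro exI allI impI)
    show "norm (c n / (real n + 1)) \<le> c n" for n
      using divide_left_mono[of 1 "real n + 1" "c n"] nonneg[of n] by simp
  qed
  have "(\<lambda>n. integral\<^sup>L lborel (f n)) sums (LINT t|lborel. (\<Sum>n. f n t))"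
    by (rule sums_integral[OF int_f s1 s2])
  moreover have "integral\<^sup>L lborel (f n) = 2 * pi * \<i> * of_real (c n / (real n + 1))" for n
    unfolding f_def by (subst integral_mult_right_zero) (simp add: val_e add.commute)
  moreover have "(\<lambda>n. 2 * pi * \<i> * of_real (c n / (real n + 1)))
      sums (2 * pi * \<i> * of_real (\<Sum>n. c n / (real n + 1)))"
    by (intro sums_mult sums_of_real summable_sums sm')
  ultimately have eq: "(LINT t|lborel. (\<Sum>n. f n t)) = 2 * pi * \<i> * of_real (\<Sum>n. c n / (real n + 1))"
    by (simp only: sums_unique2[of "\<lambda>n. 2 * pi * \<i> * of_real (c n / (real n + 1))"])
  have pos: "0 \<le> (\<Sum>n. c n / (real n + 1))"
    by (rule suminf_nonneg[OF sm']) (use nonneg in auto)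
  have sums_t: "norm (\<Sum>n. f n t) \<le> pi * (cmod (\<Sum>n. of_real (c n) * cis t ^ n) * indicator {0..2*pi} t)" for t
  proof -
    \<comment> \<open>A factor \<open>cis t\<close> of modulus 1 is split off, which brings the
      frequencies back from n + 1 to n.\<close>
    have fn: "f n t = indicator {0..2*pi} t *\<^sub>R (of_real (pi - t) * cis t) * (of_real (c n) * cis t ^ n)" for n
    proof -
      have "cis (real (Suc n) * t) = cis t * cis t ^ n"
        using Complex.DeMoivre[of t n] cis_mult[of t "real n * t"] by (simp add: distrib_right)
      then show ?thesis by (simp add: f_def e_def mult_ac del: of_nat_Suc)
    qed
    have "summable (\<lambda>n. of_real (c n) * cis t ^ n)"
      by (rule summable_comparison_test[OF _ sm]) (use nonneg in \<open>auto simp: norm_mult norm_power\<close>)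
    then have "(\<Sum>n. f n t) = indicator {0..2*pi} t *\<^sub>R (of_real (pi - t) * cis t) * (\<Sum>n. of_real (c n) * cis t ^ n)"
      unfolding fn by (rule suminf_mult)
    then show ?thesis
      by (cases "t \<in> {0..2*pi}") (auto simp: norm_mult simp del: of_real_diff intro!: mult_right_mono)
  qed
  have "ennreal (2 * pi * (\<Sum>n. c n / (real n + 1))) = ennreal (norm (LINT t|lborel. (\<Sum>n. f n t)))"
    unfolding eq using pos by (simp add: norm_mult)
  also have "\<dots> \<le> (\<integral>\<^sup>+t. ennreal (norm (\<Sum>n. f n t)) \<partial>lborel)"
    by (rule integral_norm_bound_ennreal) (rule integrable_suminf[OF int_f s1 s2])
  also have "\<dots> \<le> (\<integral>\<^sup>+t. ennreal pi * (ennreal (cmod (\<Sum>n. of_real (c n) * cis t ^ n)) * indicator {0..<2*pi} t) \<partial>lborel)"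
  proof (rule nn_integral_mono_AE)
    show "AE t in lborel. ennreal (norm (\<Sum>n. f n t))
        \<le> ennreal pi * (ennreal (cmod (\<Sum>n. of_real (c n) * cis t ^ n)) * indicator {0..<2*pi} t)"
      using AE_lborel_singleton[of "2 * pi"]
    proof eventually_elim
      case (elim t)
      have "ennreal (norm (\<Sum>n. f n t)) \<le> ennreal (pi * (cmod (\<Sum>n. of_real (c n) * cis t ^ n) * indicator {0..2*pi} t))"
        by (rule ennreal_leI[OF sums_t])
      also have "\<dots> = ennreal pi * (ennreal (cmod (\<Sum>n. of_real (c n) * cis t ^ n)) * indicator {0..<2*pi} t)"
        using elim by (auto simp: indicator_def ennreal_mult)
      finally show ?case .
    qed
  qed
  also have "\<dots> = ennreal pi * (\<integral>\<^sup>+t\<in>{0..<2*pi}. ennreal (cmod (\<Sum>n. of_real (c n) * cis t ^ n)) \<partial>lborel)"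
    by (rule nn_integral_cmult) (simp add: cis_conv_exp)
  finally have "ennreal pi * ennreal (2 * (\<Sum>n. c n / (real n + 1)))
    \<le> ennreal pi * (\<integral>\<^sup>+t\<in>{0..<2*pi}. ennreal (cmod (\<Sum>n. of_real (c n) * cis t ^ n)) \<partial>lborel)"
    using pos by (simp add: ennreal_mult'[symmetric] mult_ac)
  then show ?thesis
    using ennreal_mult_le_mult_iff[of "ennreal pi"] by simp
qed

text \<open>The ratio of successive terms is at most (1 + B/(n+1)) * x, which eventually lies below
  (1 + x)/2.\<close>

lemma summable_mult_power_of_regular:
  fixes q :: "nat \<Rightarrow> real"
  assumes pos: "\<And>n. 0 < q n"
    and d1: "\<And>n. \<bar>q (n + 1) - q n\<bar> \<le> B * q n / (real n + 1)"
    and x: "0 \<le> x" "x < 1"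
  shows "summable (\<lambda>n. q n * x ^ n)"
proof -
  have B: "0 \<le> B" using d1[of 0] pos[of 0] by (auto simp: zero_le_mult_iff dest!: order_trans[OF abs_ge_zero])
  obtain N :: nat where N: "2 * B * x / (1 - x) \<le> real N" using real_arch_simple by blast
  show ?thesis
  proof (rule summable_ratio_test[where c = "(1 + x) / 2" and N = N])
    show "(1 + x) / 2 < 1" using x by simp
    fix n assume n: "N \<le> n"
    have "2 * B * x / (1 - x) \<le> real n + 1" using N n by linarith
    then have "2 * (B * x) \<le> (real n + 1) * (1 - x)" using x by (simp add: field_simps)
    then have "B * x / (real n + 1) \<le> (1 - x) / 2" by (simp add: field_simps)
    then have c: "(1 + B / (real n + 1)) * x \<le> (1 + x) / 2" by (simp add: algebra_simps)
    have "q (n + 1) \<le> q n * (1 + B / (real n + 1))" using d1[of n] by (simp add: algebra_simps)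
    then have "q (n + 1) * (x * x ^ n) \<le> q n * (1 + B / (real n + 1)) * (x * x ^ n)"
      using x by (intro mult_right_mono) auto
    also have "\<dots> = ((1 + B / (real n + 1)) * x) * (q n * x ^ n)" by simp
    also have "\<dots> \<le> (1 + x) / 2 * (q n * x ^ n)"
      using c x pos[of n] by (intro mult_right_mono) auto
    finally show "norm (q (Suc n) * x ^ Suc n) \<le> (1 + x) / 2 * norm (q n * x ^ n)"
      using pos[of n] pos[of "Suc n"] x by (simp add: abs_mult)
  qed
qed

text \<open>
  The terms with \<open>n < 1 / \<bar>1 - u\<bar>\<close> are estimated trivially; the remaining ones are summed by parts twice.
\<close>
lemma regular_power_series_bound:
  fixes q :: "nat \<Rightarrow> real" and u :: complex
  assumes pos: "\<And>n. 0 < q n"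
    and d1: "\<And>n. \<bar>q (n + 1) - q n\<bar> \<le> B * q n / (real n + 1)"
    and d2: "\<And>n. \<bar>q (n + 2) - 2 * q (n + 1) + q n\<bar> \<le> B * q n / (real n + 1)\<^sup>2"
    and dbl: "\<And>m n. m \<le> 2 * n + 1 \<Longrightarrow> q m \<le> B * q n"
    and u: "cmod u < 1"
  shows "cmod (\<Sum>n. of_real (q n) * u ^ n)
    \<le> (10 + 20 * B * (1 + B) + 2 * B)
        * (\<Sum>n. q n * cmod u ^ n * (1 / (1 + ((real n + 1) * cmod (1 - u))\<^sup>2)))"
proof -
  define r where "r = cmod u"
  have r: "0 \<le> r" "r < 1" using u by (auto simp: r_def)
  define \<theta> where "\<theta> = cmod (1 - u)"
  have "1 - r \<le> \<theta>" using norm_triangle_ineq2[of 1 u] by (simp add: r_def \<theta>_def)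
  with r have th: "0 < \<theta>" by simp
  have th2: "\<theta> < 2" using norm_triangle_ineq4[of 1 u] r by (simp add: r_def \<theta>_def)
  define w where "w n = 1 / (1 + ((real n + 1) * \<theta>)\<^sup>2)" for n :: nat
  have w: "0 \<le> w n" "w n \<le> 1" for n
    by (auto simp: w_def intro!: divide_nonneg_pos add_pos_nonneg)
      (simp add: divide_le_eq add_pos_nonneg)
  have B: "0 \<le> B" using d1[of 0] pos[of 0] by (auto simp: zero_le_mult_iff dest!: order_trans[OF abs_ge_zero])
  \<comment> \<open>The product of \<open>N\<close> and \<open>\<theta>\<close> lies between 1 and
    3. Hence \<open>w n\<close> is at least 1/10 for n below \<open>N\<close>, while from
    \<open>N\<close> on 1/(n+1)^2 is at most 2 * \<theta>^2 * w n.\<close>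
  define N where "N = nat \<lceil>1 / \<theta>\<rceil>"
  have N1: "1 / \<theta> \<le> real N" unfolding N_def by linarith
  have N2: "real N < 1 / \<theta> + 1" unfolding N_def using th ceiling_correct[of "1 / \<theta>"] by (simp add: of_nat_nat)
  have Npos: "0 < N" using N1 th by (metis divide_pos_pos less_le_trans of_nat_0_less_iff zero_less_one)
  have N1': "1 \<le> real N * \<theta>" using N1 th by (simp add: field_simps)
  have N2': "real N * \<theta> \<le> 3" 
  proof -
    have "real N * \<theta> < (1 / \<theta> + 1) * \<theta>" using N2 th by (rule mult_strict_right_mono)
    also have "\<dots> = 1 + \<theta>" using th by (simp add: field_simps)
    finally show ?thesis using th2 by simp
  qed
  have smq: "summable (\<lambda>n. q n * r ^ n)"
    by (rule summable_mult_power_of_regular[OF pos d1 r])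
  define t where "t n = q n * r ^ n * w n" for n
  have t0: "0 \<le> t n" for n using pos[of n] r w[of n] by (simp add: t_def)
  have smt': "summable t"
  proof (rule summable_comparison_test[OF _ smq], intro exI allI impI)
    show "norm (t n) \<le> q n * r ^ n" for n
      using t0[of n] mult_left_mono[OF w(2)[of n], of "q n * r ^ n"] pos[of n] r by (simp add: t_def)
  qed
  have smc: "summable (\<lambda>n. of_real (q n) * u ^ n)"
    by (rule summable_comparison_test[OF _ smq])
       (use pos in \<open>auto simp: norm_mult norm_power r_def less_imp_le\<close>)
  have split_t: "(\<Sum>n. t n) = (\<Sum>n<N. t n) + (\<Sum>n. t (n + N))"
    using suminf_split_initial_segment[OF smt', of N] by (simp add: add.commute)
  have smtN: "summable (\<lambda>n. t (n + N))" using smt' by (simp add: summable_iff_shift)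
  have tail0: "0 \<le> (\<Sum>n. t (n + N))" by (rule suminf_nonneg[OF smtN]) (rule t0)
  have head: "q n * r ^ n \<le> 10 * t n" if "n < N" for n
  proof -
    have "(real n + 1) * \<theta> \<le> real N * \<theta>" using that th by (intro mult_right_mono) auto
    then have "(real n + 1) * \<theta> \<le> 3" using N2' by linarith
    then have "((real n + 1) * \<theta>)\<^sup>2 \<le> 3\<^sup>2" using th by (intro power_mono) auto
    then have "1 + ((real n + 1) * \<theta>)\<^sup>2 \<le> 10" by simp
    then have "1 / 10 \<le> w n" unfolding w_def by (intro divide_left_mono mult_pos_pos add_pos_nonneg) auto
    then have "q n * r ^ n * (1 / 10) \<le> t n" unfolding t_def
      using pos[of n] r by (intro mult_left_mono) auto
    then show ?thesis by simp
  qed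
  \<comment> \<open>The boundary term is charged to the indices n in [N/2, N): there N \<le> 2 * n +
    1, so \<open>q N\<close> is at most \<open>B * q n\<close>, and r^N is at most r^n.\<close>
  have qN: "real N * (q N * r ^ N) \<le> 20 * B * (\<Sum>n<N. t n)"
  proof -
    have "real N * (q N * r ^ N) \<le> 2 * (\<Sum>n\<in>{N div 2..<N}. q N * r ^ N)"
    proof -
      have "real N \<le> 2 * real (N - N div 2)" by linarith
      then show ?thesis using mult_right_mono[of "real N" "2 * real (N - N div 2)" "q N * r ^ N"]
          less_imp_le[OF pos[of N]] r
        by (simp only: sum_constant card_atLeastLessThan mult.assoc) simp
    qed
    also have "\<dots> \<le> 2 * (\<Sum>n\<in>{N div 2..<N}. B * (10 * t n))"
    proof (intro mult_left_mono sum_mono)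
      fix n assume n: "n \<in> {N div 2..<N}"
      have "q N * r ^ N \<le> (B * q n) * r ^ n"
        using n r dbl[of N n] pos[of n] B by (intro mult_mono power_decreasing) auto
      also have "\<dots> = B * (q n * r ^ n)" by simp
      also have "\<dots> \<le> B * (10 * t n)" using head[of n] n B by (intro mult_left_mono) auto
      finally show "q N * r ^ N \<le> B * (10 * t n)" .
    qed auto
    also have "\<dots> \<le> 2 * (\<Sum>n<N. B * (10 * t n))"
      by (intro mult_left_mono sum_mono2) (use B t0 in auto)
    also have "\<dots> = 20 * B * (\<Sum>n<N. t n)" by (simp add: sum_distrib_left[symmetric])
    finally show ?thesis .
  qed
  define s :: "nat \<Rightarrow> complex" where "s n = of_real (q (n + N))" for n
  define d where "d n = s (n + 2) - 2 * s (n + 1) + s n" for n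
  define S where "S = (\<Sum>n. s n * u ^ n)"
  have sms: "summable (\<lambda>n. s n * u ^ n)"
  proof (cases "u = 0")
    case True
    then show ?thesis
      by (intro summable_finite[of "{0}"]) (auto simp: power_0_left)
  next
    case False
    have "summable (\<lambda>n. of_real (q (n + N)) * u ^ (n + N))"
      using smc by (simp only: summable_iff_shift[of "\<lambda>n. of_real (q n) * u ^ n"])
    moreover have "of_real (q (n + N)) * u ^ (n + N) = u ^ N * (s n * u ^ n)" for n
      by (simp add: s_def power_add mult_ac)
    ultimately show ?thesis using False by (simp add: summable_cmult_iff)
  qed
  have split: "(\<Sum>n. of_real (q n) * u ^ n) = (\<Sum>n<N. of_real (q n) * u ^ n) + u ^ N * S"
  proof -
    have "(\<Sum>n. of_real (q (n + N)) * u ^ (n + N)) = u ^ N * S"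
      unfolding S_def s_def[symmetric] suminf_mult[OF sms, symmetric]
      by (simp add: power_add mult_ac)
    then show ?thesis using suminf_split_initial_segment[OF smc, of N] by (simp add: add.commute)
  qed
  \<comment> \<open>The factor r^N belonging to u^N is carried along: with r^(n+2) it is at most
    r^(n+N), the power contained in \<open>t (n + N)\<close>.\<close>
  have D: "cmod (d n * u ^ (n + 2)) * r ^ N \<le> 2 * B * \<theta>\<^sup>2 * t (n + N)" for n
  proof -
    have "d n = of_real (q (n + N + 2) - 2 * q (n + N + 1) + q (n + N))"
      by (simp add: d_def s_def add_ac)
    then have "cmod (d n) \<le> B * q (n + N) / (real (n + N) + 1)\<^sup>2"
      using d2[of "n + N"] by (metis norm_of_real real_norm_def)
    moreover have "1 / (real (n + N) + 1)\<^sup>2 \<le> 2 * \<theta>\<^sup>2 * w (n + N)"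
    proof -
      define y where "y = (real (n + N) + 1) * \<theta>"
      have "real N * \<theta> \<le> y" unfolding y_def using th by (intro mult_right_mono) auto
      then have "1 \<le> y" using N1' by simp
      then have "1 \<le> y\<^sup>2" by simp
      then have "1 / y\<^sup>2 \<le> 2 / (1 + y\<^sup>2)" by (simp add: divide_simps)
      then have "\<theta>\<^sup>2 * (1 / y\<^sup>2) \<le> \<theta>\<^sup>2 * (2 / (1 + y\<^sup>2))" by (intro mult_left_mono) auto
      moreover have "\<theta>\<^sup>2 * (1 / y\<^sup>2) = 1 / (real (n + N) + 1)\<^sup>2"
        using th by (simp add: y_def power_mult_distrib)
      ultimately show ?thesis by (simp add: w_def y_def mult.commute)
    qed
    ultimately have "cmod (d n) \<le> B * q (n + N) * (2 * \<theta>\<^sup>2 * w (n + N))"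
      using mult_left_mono[of "1 / (real (n + N) + 1)\<^sup>2" "2 * \<theta>\<^sup>2 * w (n + N)" "B * q (n + N)"] B pos[of "n + N"]
      by (simp add: less_imp_le)
    moreover have "r ^ (n + 2) * r ^ N \<le> r ^ (n + N)"
      unfolding power_add[symmetric] using r by (intro power_decreasing) auto
    ultimately have "cmod (d n) * (r ^ (n + 2) * r ^ N)
        \<le> B * q (n + N) * (2 * \<theta>\<^sup>2 * w (n + N)) * r ^ (n + N)"
      using r B pos[of "n + N"] w[of "n + N"] by (intro mult_mono) (auto simp: less_imp_le)
    then show ?thesis by (simp add: t_def norm_mult norm_power r_def mult_ac)
  qed
  have smd: "summable (\<lambda>n. cmod (d n * u ^ (n + 2)) * r ^ N)"
    by (rule summable_comparison_test[OF _ summable_mult[OF smtN, of "2 * B * \<theta>\<^sup>2"]])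
       (use D r in \<open>auto intro!: exI[of _ 0]\<close>)
  \<comment> \<open>\<open>smd\<close> gives summability of the second differences only after
    division by r^N. For r = 0 the left-hand side is zero because \<open>N\<close> is
    positive.\<close>
  have tail: "cmod (\<Sum>n. d n * u ^ (n + 2)) * r ^ N \<le> 2 * B * \<theta>\<^sup>2 * (\<Sum>n. t (n + N))"
  proof (cases "r = 0")
    case True
    then show ?thesis using Npos B tail0 by (simp add: power_0_left)
  next
    case False
    then have "summable (\<lambda>n. cmod (d n * u ^ (n + 2)))"
      using smd by (simp add: mult.commute[of _ "r ^ N"] summable_cmult_iff)
    then have "cmod (\<Sum>n. d n * u ^ (n + 2)) * r ^ N
        \<le> (\<Sum>n. cmod (d n * u ^ (n + 2))) * r ^ N"
      using r by (intro mult_right_mono summable_norm) auto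
    also have "\<dots> = (\<Sum>n. cmod (d n * u ^ (n + 2)) * r ^ N)"
      by (rule suminf_mult2) fact
    also have "\<dots> \<le> (\<Sum>n. 2 * B * \<theta>\<^sup>2 * t (n + N))"
      by (rule suminf_le[OF D smd summable_mult[OF smtN]])
    also have "\<dots> = 2 * B * \<theta>\<^sup>2 * (\<Sum>n. t (n + N))" by (rule suminf_mult[OF smtN])
    finally show ?thesis .
  qed
  \<comment> \<open>The division by \<theta>^2 comes last. Before it, N * \<theta> \<ge> 1 turns
    both boundary coefficients into multiples of \<theta>^2 * N, which matches the bound
    \<open>qN\<close>.\<close>
  have "\<theta>\<^sup>2 * cmod (u ^ N * S) = cmod ((1 - u)\<^sup>2 * S) * r ^ N"
    by (simp add: norm_mult norm_power \<theta>_def r_def)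
  also have "\<dots> \<le> (q N * \<theta> + B * q N / (real N + 1) * 1
       + cmod (\<Sum>n. d n * u ^ (n + 2))) * r ^ N"
  proof (rule mult_right_mono)
    have "cmod ((1 - u)\<^sup>2 * S) \<le> cmod (s 0 * (1 - u) + (s 1 - s 0) * u)
        + cmod (\<Sum>n. d n * u ^ (n + 2))"
      unfolding S_def d_def summation_by_parts_twice[OF sms] by (rule norm_triangle_ineq)
    also have "cmod (s 0 * (1 - u) + (s 1 - s 0) * u) \<le> cmod (s 0 * (1 - u)) + cmod ((s 1 - s 0) * u)"
      by (rule norm_triangle_ineq)
    also have "cmod (s 0 * (1 - u)) = q N * \<theta>" using pos[of N] by (simp add: s_def norm_mult \<theta>_def)
    also have "cmod ((s 1 - s 0) * u) \<le> B * q N / (real N + 1) * 1"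
    proof -
      have "cmod (s 1 - s 0) \<le> B * q N / (real N + 1)"
        using d1[of N] by (simp add: s_def flip: of_real_diff)
      then show ?thesis unfolding norm_mult using r B pos[of N] by (intro mult_mono) (auto simp: r_def)
    qed
    finally show "cmod ((1 - u)\<^sup>2 * S) \<le> q N * \<theta> + B * q N / (real N + 1) * 1
       + cmod (\<Sum>n. d n * u ^ (n + 2))" by simp
  qed (use r in simp)
  also have "\<dots> = (\<theta> + B / (real N + 1)) * (q N * r ^ N)
       + cmod (\<Sum>n. d n * u ^ (n + 2)) * r ^ N"
    by (simp add: algebra_simps)
  also have "\<dots> \<le> (\<theta>\<^sup>2 * (1 + B) * real N) * (q N * r ^ N) + 2 * B * \<theta>\<^sup>2 * (\<Sum>n. t (n + N))"
  proof (intro add_mono tail mult_right_mono)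
    have "\<theta> * 1 \<le> \<theta> * (real N * \<theta>)" using N1' th by (intro mult_left_mono) auto
    moreover have "B / (real N + 1) \<le> B * (\<theta>\<^sup>2 * real N)"
    proof -
      have "1 \<le> (real N * \<theta>)\<^sup>2" using N1' by simp
      also have "\<dots> \<le> \<theta>\<^sup>2 * real N * (real N + 1)"
        using th by (simp add: power2_eq_square algebra_simps)
      finally have "1 / (real N + 1) \<le> \<theta>\<^sup>2 * real N" by (simp add: field_simps)
      from mult_left_mono[OF this B] show ?thesis by simp
    qed
    ultimately show "\<theta> + B / (real N + 1) \<le> \<theta>\<^sup>2 * (1 + B) * real N"
      by (simp add: power2_eq_square algebra_simps)
  qed (use pos[of N] r in auto)
  also have "\<dots> = \<theta>\<^sup>2 * ((1 + B) * (real N * (q N * r ^ N)) + 2 * B * (\<Sum>n. t (n + N)))"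
    by (simp add: algebra_simps)
  finally have "cmod (u ^ N * S) \<le> (1 + B) * (real N * (q N * r ^ N)) + 2 * B * (\<Sum>n. t (n + N))"
    using th by (simp add: mult_le_cancel_left_pos)
  also have "\<dots> \<le> (1 + B) * (20 * B * (\<Sum>n<N. t n)) + 2 * B * (\<Sum>n. t (n + N))"
    using qN B by (intro add_right_mono mult_left_mono) auto
  finally have "cmod (u ^ N * S) \<le> (1 + B) * (20 * B * (\<Sum>n<N. t n)) + 2 * B * (\<Sum>n. t (n + N))" .
  moreover have "cmod (\<Sum>n<N. of_real (q n) * u ^ n) \<le> 10 * (\<Sum>n<N. t n)"
    unfolding sum_distrib_left
    by (rule order_trans[OF norm_sum], rule sum_mono)
       (use head pos in \<open>auto simp: norm_mult norm_power r_def less_imp_le\<close>)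
  ultimately have "cmod (\<Sum>n. of_real (q n) * u ^ n)
      \<le> 10 * (\<Sum>n<N. t n) + ((1 + B) * (20 * B * (\<Sum>n<N. t n)) + 2 * B * (\<Sum>n. t (n + N)))"
    unfolding split by (rule order_trans[OF norm_triangle_ineq add_mono, rotated])
  also have "\<dots> = (10 + 20 * B * (1 + B)) * (\<Sum>n<N. t n) + 2 * B * (\<Sum>n. t (n + N))"
    by (simp add: algebra_simps)
  also have "\<dots> \<le> (10 + 20 * B * (1 + B) + 2 * B) * (\<Sum>n<N. t n)
      + (10 + 20 * B * (1 + B) + 2 * B) * (\<Sum>n. t (n + N))"
  proof -
    have "0 \<le> B * (1 + B)" using B by simp
    then have "10 + 20 * B * (1 + B) \<le> 10 + 20 * B * (1 + B) + 2 * B" "2 * B \<le> 10 + 20 * B * (1 + B) + 2 * B"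
      using B by (simp_all add: mult.assoc)
    moreover have "0 \<le> (\<Sum>n<N. t n)" by (rule sum_nonneg) (rule t0)
    ultimately show ?thesis using tail0 by (blast intro: add_mono mult_right_mono)
  qed
  also have "\<dots> = (10 + 20 * B * (1 + B) + 2 * B) * (\<Sum>n. t n)"
    unfolding split_t by (simp add: algebra_simps)
  finally show ?thesis by (simp add: t_def[abs_def] w_def r_def \<theta>_def)
qed

section \<open>Moments of doubling measures\<close>

text \<open>Keeps (1 - x)^n above a positive constant as long as n * x stays bounded.\<close>

lemma exp_le_one_minus:
  fixes x :: real
  assumes "0 \<le> x" "x \<le> 1 / 2"
  shows "exp (- 2 * x) \<le> 1 - x"
proof -
  have "- 2 * x \<le> - x - 2 * x\<^sup>2"
    using assms mult_right_mono[of x "1 / 2" x] by (simp add: power2_eq_square)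
  also have "\<dots> \<le> ln (1 - x)" using assms by (rule ln_one_minus_pos_lower_bound)
  finally show ?thesis using assms by (simp add: ln_ge_iff)
qed

text \<open>x^j is the smallest of the powers 1, ..., x^j, and their sum times 1 - x telescopes.
  Each factor 1 - x can thus be traded, together with x^j, for 1/(j+1).\<close>

lemma power_mult_one_minus_le:
  fixes x :: real
  assumes "0 \<le> x" "x \<le> 1"
  shows "x ^ j * (1 - x) \<le> 1 / (real j + 1)"
proof -
  have "(real j + 1) * (x ^ j * (1 - x)) = (\<Sum>i\<le>j. x ^ j) * (1 - x)" by simp
  also have "\<dots> \<le> (\<Sum>i\<le>j. x ^ i) * (1 - x)"
    using assms by (intro mult_right_mono sum_mono power_decreasing) auto
  also have "\<dots> = 1 - x ^ Suc j" using sum_gp0[of x j] assms by (cases "x = 1") auto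
  also have "\<dots> \<le> 1" using assms by simp
  finally show ?thesis by (simp add: field_simps)
qed

text \<open>
  \<open>W\<close> is the measure \<open>\<omega>(r) dr\<close> on \<open>[0,1)\<close>, \<open>T\<close> the tail integral of the weight
  and \<open>g k\<close> its \<open>k\<close>-th moment.
\<close>
locale doubling_measure = finite_measure W for W :: "real measure" +
  fixes C :: real
  assumes sets_W [measurable_cong]: "sets W = sets borel"
    and AE_W: "AE r in W. 0 \<le> r \<and> r < 1"
    and C1: "1 \<le> C"
    and tail_pos: "\<And>r. 0 \<le> r \<Longrightarrow> r < 1 \<Longrightarrow> 0 < measure W {r..}"
    and doubling: "\<And>r. 0 \<le> r \<Longrightarrow> r < 1 \<Longrightarrow> measure W {r..} \<le> C * measure W {(1 + r) / 2..}"
begin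

definition T :: "real \<Rightarrow> real" where "T r = measure W {r..}"
definition g :: "nat \<Rightarrow> real" where "g k = (LINT r|W. r ^ k)"

lemma T_antimono: "r \<le> s \<Longrightarrow> T s \<le> T r"
  unfolding T_def by (rule finite_measure_mono) auto

lemma T_nonneg: "0 \<le> T r"
  by (simp add: T_def)

lemma T_pos: "0 \<le> r \<Longrightarrow> r < 1 \<Longrightarrow> 0 < T r"
  unfolding T_def by (rule tail_pos)

lemma integrable_bounded:
  fixes f :: "real \<Rightarrow> real"
  assumes "f \<in> borel_measurable borel" "\<And>r. 0 \<le> r \<Longrightarrow> r < 1 \<Longrightarrow> \<bar>f r\<bar> \<le> b"
  shows "integrable W f"
proof (rule integrable_const_bound)
  show "AE r in W. norm (f r) \<le> b" using AE_W by eventually_elim (use assms in auto)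
qed (use assms in auto)

lemma integrable_power [simp]: "integrable W (\<lambda>r. r ^ k)"
  by (rule integrable_bounded[where b = 1]) (auto simp: power_le_one)

lemma integrable_tail [simp]: "integrable W (indicator {a..} :: real \<Rightarrow> real)"
  by (rule integrable_bounded[where b = 1]) (auto simp: indicator_def)

lemma integral_mono_unit:
  fixes f h :: "real \<Rightarrow> real"
  assumes "integrable W f" "integrable W h" "\<And>r. 0 \<le> r \<Longrightarrow> r < 1 \<Longrightarrow> f r \<le> h r"
  shows "integral\<^sup>L W f \<le> integral\<^sup>L W h"
proof (rule integral_mono_AE)
  show "AE r in W. f r \<le> h r" using AE_W by eventually_elim (use assms in auto)
qed (use assms in auto)

lemma g_antimono: "k \<le> l \<Longrightarrow> g l \<le> g k"
  unfolding g_def by (rule integral_mono_unit) (auto intro: power_decreasing)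

lemma integral_tail: "(LINT r|W. c * indicator {a..} r) = c * T a"
  by (simp add: T_def)

lemma power_mult_T_le_g:
  assumes "0 \<le> a"
  shows "a ^ k * T a \<le> g k"
proof -
  have "(LINT r|W. a ^ k * indicator {a..} r) \<le> g k"
    unfolding g_def
  proof (rule integral_mono_unit)
    show "integrable W (\<lambda>r. a ^ k * indicator {a..} r)" by (intro integrable_mult_right) simp
  qed (use assms in \<open>auto simp: indicator_def intro: power_mono\<close>)
  then show ?thesis by (simp only: integral_tail)
qed

lemma g_pos: "0 < g k"
proof -
  have "0 < (1/2) ^ k * T (1/2)" using T_pos[of "1/2"] by simp
  also have "\<dots> \<le> g k" by (rule power_mult_T_le_g) simp
  finally show ?thesis .
qed

lemma g_nonneg: "0 \<le> g k"
  by (rule less_imp_le[OF g_pos])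

text \<open>r^k is the length of [0, r^k], and l \<le> r^k means root k l \<le> r; Tonelli does the
  rest. In this form doubling passes from tails to moments pointwise in \<open>l\<close>.\<close>

lemma g_layer_cake:
  assumes k: "0 < k"
  shows "ennreal (g k) = (\<integral>\<^sup>+l. ennreal (T (root k l)) * indicator {0..<1} l \<partial>lborel)"
proof -
  interpret pair_sigma_finite W lborel ..
  have "ennreal (g k) = (\<integral>\<^sup>+r. ennreal (r ^ k) \<partial>W)"
    unfolding g_def
  proof (rule nn_integral_eq_integral[symmetric])
    show "AE r in W. 0 \<le> r ^ k" using AE_W by eventually_elim auto
  qed simp
  also have "\<dots> = (\<integral>\<^sup>+r. (\<integral>\<^sup>+l. indicator {p. 0 \<le> snd p \<and> snd p \<le> fst p ^ k} (r, l) \<partial>lborel) \<partial>W)"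
  proof (rule nn_integral_cong_AE)
    show "AE r in W. ennreal (r ^ k) = (\<integral>\<^sup>+l. indicator {p. 0 \<le> snd p \<and> snd p \<le> fst p ^ k} (r, l) \<partial>lborel)"
      using AE_W
    proof eventually_elim
      case (elim r)
      have "(\<integral>\<^sup>+l. indicator {p. 0 \<le> snd p \<and> snd p \<le> fst p ^ k} (r, l) \<partial>lborel)
          = (\<integral>\<^sup>+l. indicator {0..r ^ k} l \<partial>lborel)"
        by (intro nn_integral_cong) (auto simp: indicator_def)
      then show ?case using elim by simp
    qed
  qed
  also have "\<dots> = (\<integral>\<^sup>+l. (\<integral>\<^sup>+r. indicator {p. 0 \<le> snd p \<and> snd p \<le> fst p ^ k} (r, l) \<partial>W) \<partial>lborel)"
    by (rule Fubini'[symmetric]) measurable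
  also have "\<dots> = (\<integral>\<^sup>+l. ennreal (T (root k l)) * indicator {0..<1} l \<partial>lborel)"
  proof (rule nn_integral_cong)
    fix l :: real
    have "(\<integral>\<^sup>+r. indicator {p. 0 \<le> snd p \<and> snd p \<le> fst p ^ k} (r, l) \<partial>W)
        = (\<integral>\<^sup>+r. indicator {root k l..} r * indicator {0..<1} l \<partial>W)"
    proof (rule nn_integral_cong_AE)
      show "AE r in W. indicator {p. 0 \<le> snd p \<and> snd p \<le> fst p ^ k} (r, l)
          = (indicator {root k l..} r * indicator {0..<1} l :: ennreal)"
        using AE_W
      proof eventually_elim
        case (elim r)
        show ?case
        proof (cases "0 \<le> l")
          case True
          have "l \<le> r ^ k \<longleftrightarrow> root k l \<le> r"
            using real_root_le_iff[OF k, of l "r ^ k"] elim k by (simp add: real_root_power_cancel)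
          moreover have "r ^ k < 1" using elim k by (simp add: power_less_one_iff)
          ultimately show ?thesis using True by (auto simp: indicator_def)
        qed (auto simp: indicator_def)
      qed
    qed
    also have "\<dots> = ennreal (T (root k l)) * indicator {0..<1} l"
      by (simp add: nn_integral_multc T_def emeasure_eq_measure)
    finally show "(\<integral>\<^sup>+r. indicator {p. 0 \<le> snd p \<and> snd p \<le> fst p ^ k} (r, l) \<partial>W)
        = ennreal (T (root k l)) * indicator {0..<1} l" .
  qed
  finally show ?thesis .
qed

text \<open>At level \<open>l\<close> the two tails start at x = root k l and at sqrt x. Since sqrt
  x \<le> (1 + x)/2, the doubling condition at x compares them with the same constant
  \<open>C\<close>.\<close>

lemma g_doubling:
  assumes k: "0 < k"
  shows "g k \<le> C * g (2 * k)"
proof -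
  have "ennreal (g k) \<le> (\<integral>\<^sup>+l. ennreal C * (ennreal (T (root (2 * k) l)) * indicator {0..<1} l) \<partial>lborel)"
    unfolding g_layer_cake[OF k]
  proof (rule nn_integral_mono)
    fix l :: real
    show "ennreal (T (root k l)) * indicator {0..<1} l \<le> ennreal C * (ennreal (T (root (2 * k) l)) * indicator {0..<1} l)"
    proof (cases "l \<in> {0..<1}")
      case True
      define x where "x = root k l"
      have x: "0 \<le> x" "x < 1" using True k by (auto simp: x_def)
      have "root (2 * k) l = sqrt x"
        by (simp add: x_def real_root_mult_exp sqrt_def)
      moreover have "sqrt x \<le> (1 + x) / 2" using arith_geo_mean_sqrt[of 1 x] x by simp
      ultimately have "T ((1 + x) / 2) \<le> T (root (2 * k) l)" by (simp add: T_antimono)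
      then have "C * T ((1 + x) / 2) \<le> C * T (root (2 * k) l)" using C1 by (intro mult_left_mono) auto
      then have "T x \<le> C * T (root (2 * k) l)"
        using doubling[OF x] unfolding T_def by linarith
      then show ?thesis using True C1 T_nonneg
        by (simp add: x_def[symmetric] ennreal_mult'[symmetric] ennreal_leI)
    qed auto
  qed
  also have "\<dots> = ennreal C * ennreal (g (2 * k))"
  proof -
    have "(\<lambda>l. T (root (2 * k) l)) \<in> borel_measurable borel"
    proof -
      have "mono (\<lambda>x. - T x)" by (auto simp: mono_def T_antimono)
      then have "(\<lambda>x. - T x) \<in> borel_measurable borel" by (rule borel_measurable_mono)
      then have "(\<lambda>x. - (- T x)) \<in> borel_measurable borel" by (rule borel_measurable_uminus)
      then have [measurable]: "T \<in> borel_measurable borel" by simp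
      have [measurable]: "root (2 * k) \<in> borel_measurable borel"
        by (intro borel_measurable_continuous_onI continuous_intros)
      show ?thesis by measurable
    qed
    then show ?thesis using k by (subst g_layer_cake) (auto intro!: nn_integral_cmult)
  qed
  finally show ?thesis
    using C1 g_pos[of "2 * k"] by (simp add: ennreal_mult'[symmetric])
qed

lemma g_doubling_power: "0 < k \<Longrightarrow> g k \<le> C ^ j * g (2 ^ j * k)"
proof (induction j)
  case (Suc j)
  have "C ^ j * g (2 ^ j * k) \<le> C ^ j * (C * g (2 * (2 ^ j * k)))"
    using Suc.prems C1 by (intro mult_left_mono g_doubling) auto
  then show ?case using Suc by (simp add: mult_ac)
qed simp

text \<open>On [1 - 1/k, 1) the integrand r^k is at least (1 - 1/k)^k, hence at least exp (-2) when
  k \<ge> 2.\<close>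

lemma T_le_g: "\<exists>E>0. \<forall>k\<ge>1. T (1 - 1 / real k) \<le> E * g k"
proof (intro exI conjI allI impI)
  show "0 < C * exp 2" using C1 by simp
  fix k :: nat assume k: "1 \<le> k"
  show "T (1 - 1 / real k) \<le> C * exp 2 * g k"
  \<comment> \<open>For k = 1 the cut point is 0, where that lower bound is void; one doubling step
    moves it to 1/2.\<close>
  proof (cases "k = 1")
    case True
    have "T 0 \<le> C * T (1 / 2)" using doubling[of 0] by (simp add: T_def)
    also have "T (1 / 2) \<le> 2 * g 1" using power_mult_T_le_g[of "1/2" 1] by simp
    also have "2 * g 1 \<le> exp 2 * g 1"
      using exp_ge_add_one_self[of "2::real"] g_pos[of 1] by (intro mult_right_mono) auto
    finally show ?thesis using True C1 by (simp add: mult.assoc mult_left_mono)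
  next
    case False
    with k have k2: "2 \<le> real k" by simp
    have "exp (- 2 * (1 / real k)) \<le> 1 - 1 / real k"
      by (rule exp_le_one_minus) (use k2 in \<open>auto simp: field_simps\<close>)
    then have "exp (- 2 * (1 / real k)) ^ k \<le> (1 - 1 / real k) ^ k" by (intro power_mono) auto
    then have "exp (- 2) \<le> (1 - 1 / real k) ^ k" using k by (simp flip: exp_of_nat_mult)
    then have "exp (- 2) * T (1 - 1 / real k) \<le> (1 - 1 / real k) ^ k * T (1 - 1 / real k)"
      by (intro mult_right_mono T_nonneg)
    also have "\<dots> \<le> g k" by (rule power_mult_T_le_g) (use k in auto)
    finally have "T (1 - 1 / real k) \<le> exp 2 * g k" by (simp add: exp_minus field_simps)
    also have "\<dots> \<le> C * (exp 2 * g k)" using C1 g_pos[of k] by simp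
    finally show ?thesis by (simp add: mult.assoc)
  qed
qed

text \<open>Cutting the integral of r^k at 1 - 1/k leaves a lower part of the same order as the
  whole. Passing first to g (2^j * k), at the price C^j, shrinks the lower part to exp (1 - 2^j) * g
  k; for suitable j it is absorbed into the left-hand side.\<close>

lemma g_le_T: "\<exists>D>0. \<forall>k\<ge>1. g k \<le> D * T (1 - 1 / real k)"
proof -
  \<comment> \<open>C^j is at most (2^j)^i, a fixed power of 2^j, so exp (2^j) eventually outgrows
    it.\<close>
  obtain i :: nat where i: "C \<le> 2 ^ i" using real_arch_pow[of 2 C] by (auto intro: less_imp_le)
  have "((\<lambda>x::real. x ^ i / exp x) \<longlongrightarrow> 0) at_top" by (rule tendsto_power_div_exp_0)
  moreover have "filterlim (\<lambda>j. 2 ^ j :: real) at_top sequentially"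
    by (rule filterlim_at_top_mono[OF filterlim_real_sequentially])
       (auto intro!: always_eventually less_imp_le of_nat_less_two_power)
  ultimately have "(\<lambda>j. (2 ^ j :: real) ^ i / exp (2 ^ j)) \<longlonglongrightarrow> 0" by (rule filterlim_compose)
  then have "eventually (\<lambda>j. (2 ^ j :: real) ^ i / exp (2 ^ j) < 1 / (2 * exp 1)) sequentially"
    by (rule order_tendstoD) simp
  then obtain j where j: "(2 ^ j :: real) ^ i / exp (2 ^ j) < 1 / (2 * exp 1)"
    by (auto simp: eventually_sequentially)
  have "C ^ j \<le> (2 ^ i) ^ j" using i C1 by (intro power_mono) auto
  also have "\<dots> = (2 ^ j) ^ i" by (simp add: power_mult[symmetric] mult.commute)
  finally have "C ^ j * exp (1 - 2 ^ j) \<le> (2 ^ j) ^ i * exp (1 - 2 ^ j)" by simp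
  also have "\<dots> < 1 / 2" using j by (simp add: exp_diff field_simps)
  finally have j': "C ^ j * exp (1 - 2 ^ j) < 1 / 2" .
  show ?thesis
  proof (intro exI conjI allI impI)
    show "0 < 2 * C ^ j" using C1 by simp
    fix k :: nat assume k: "1 \<le> k"
    define r where "r = 1 - 1 / real k"
    have r: "0 \<le> r" "r < 1" using k by (auto simp: r_def)
    have "r ^ k \<le> exp (- (1 / real k)) ^ k"
      using r exp_ge_add_one_self[of "- (1 / real k)"] unfolding r_def by (intro power_mono) auto
    also have "\<dots> = exp (-1)" using k by (simp flip: exp_of_nat_mult)
    finally have rk: "r ^ k \<le> exp (-1)" .
    have "g (2 ^ j * k) \<le> (LINT s|W. indicator {r..} s + exp (1 - 2 ^ j) * s ^ k)"
      unfolding g_def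
    proof (rule integral_mono_unit)
      fix s :: real assume s: "0 \<le> s" "s < 1"
      show "s ^ (2 ^ j * k) \<le> indicator {r..} s + exp (1 - 2 ^ j) * s ^ k"
      proof (cases "r \<le> s")
        case True
        then show ?thesis using s by (auto intro!: add_increasing2 power_le_one)
      next
        case False
        have "s ^ (2 ^ j * k) = (s ^ k) ^ (2 ^ j - 1) * s ^ k"
          by (simp add: power_mult mult.commute[of _ k] flip: power_Suc2)
        also have "\<dots> \<le> (r ^ k) ^ (2 ^ j - 1) * s ^ k"
          using s r False by (intro mult_right_mono power_mono) auto
        also have "\<dots> \<le> exp (-1) ^ (2 ^ j - 1) * s ^ k"
          using s r rk by (intro mult_right_mono power_mono) auto
        also have "exp (-1) ^ (2 ^ j - 1) = exp (1 - 2 ^ j :: real)"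
          by (simp add: of_nat_diff flip: exp_of_nat_mult)
        finally show ?thesis using False by simp
      qed
    qed (intro Bochner_Integration.integrable_add integrable_mult_right integrable_tail integrable_power)+
    also have "\<dots> = T r + exp (1 - 2 ^ j) * g k"
      by (subst Bochner_Integration.integral_add) (simp_all add: T_def g_def)
    finally have "C ^ j * g (2 ^ j * k) \<le> C ^ j * (T r + exp (1 - 2 ^ j) * g k)"
      using C1 by (intro mult_left_mono) auto
    then have "g k \<le> C ^ j * T r + C ^ j * exp (1 - 2 ^ j) * g k"
      using g_doubling_power[of k j] k by (simp add: algebra_simps)
    moreover have "C ^ j * exp (1 - 2 ^ j) * g k \<le> 1 / 2 * g k"
      using j' g_pos[of k] by (intro mult_right_mono) auto
    ultimately show "g k \<le> 2 * C ^ j * T (1 - 1 / real k)" by (simp add: r_def)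
  qed
qed

text \<open>Three doublings take 2i+1 to 16i+8, which exceeds 2N+1. The pair i = 0, N = 2 occurs
  below at n = 0 and is out of reach of two doublings.\<close>

lemma odd_moment_le:
  assumes "N \<le> 8 * i + 3"
  shows "g (2 * i + 1) \<le> C ^ 3 * g (2 * N + 1)"
proof -
  have "g (2 * i + 1) \<le> C ^ 3 * g (2 ^ 3 * (2 * i + 1))" by (rule g_doubling_power) simp
  also have "\<dots> \<le> C ^ 3 * g (2 * N + 1)"
    using assms C1 by (intro mult_left_mono g_antimono) auto
  finally show ?thesis .
qed

text \<open>Differences of odd moments are integrals of r^(2n+1) times 1 - r^2 or its square. Part
  of the power is paired with each such factor and gains 1/n; the rest is a moment whose index is
  about halved, comparable to the original by doubling. Quotient formulas carry this over to the
  reciprocals.\<close>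

lemma inverse_odd_moments_regular:
  fixes q defines "q \<equiv> \<lambda>n. 1 / g (2 * n + 1)"
  shows "\<exists>B. (\<forall>n. \<bar>q (n + 1) - q n\<bar> \<le> B * q n / (real n + 1)) \<and>
    (\<forall>n. \<bar>q (n + 2) - 2 * q (n + 1) + q n\<bar> \<le> B * q n / (real n + 1)\<^sup>2) \<and>
    (\<forall>m n. m \<le> 2 * n + 1 \<longrightarrow> q m \<le> B * q n)"
proof -
  define m where "m n = g (2 * n + 1)" for n
  define D where "D = C ^ 3"
  have D1: "1 \<le> D" using C1 by (simp add: D_def)
  have mpos: "0 < m n" for n by (simp add: m_def g_pos)
  have mle: "m i \<le> D * m N" if "N \<le> 8 * i + 3" for i N
    using odd_moment_le[OF that] by (simp add: m_def D_def)
  have m_anti: "m (n + 1) \<le> m n" for n by (simp add: m_def g_antimono)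
  \<comment> \<open>The bound is in terms of \<open>m (n + 2)\<close>, the smallest moment in play,
    because the second difference of the reciprocals has it in the denominator.\<close>
  have d1: "m n - m (n + 1) \<le> 2 * D * m (n + 2) / (real n + 1)" for n
  proof -
    define j where "j = n div 2"
    have "m n - m (n + 1) = (LINT r|W. r ^ (2 * n + 1) - r ^ (2 * (n + 1) + 1))"
      unfolding m_def g_def by (rule Bochner_Integration.integral_diff[symmetric]) (rule integrable_power)+
    also have "\<dots> \<le> (LINT r|W. 2 / (real n + 1) * r ^ (2 * (n - j) + 1))"
    proof (rule integral_mono_unit)
      fix r :: real assume r: "0 \<le> r" "r < 1"
      have x: "0 \<le> r\<^sup>2" "r\<^sup>2 \<le> 1" using r by (auto intro: power_le_one)
      have "2 * n + 1 = 2 * j + (2 * (n - j) + 1)" by (simp add: j_def)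
      then have "r ^ (2 * n + 1) = (r\<^sup>2) ^ j * r ^ (2 * (n - j) + 1)"
        by (metis power_add power_mult)
      moreover have "r ^ (2 * (n + 1) + 1) = r ^ (2 * n + 1) * r\<^sup>2" by (simp add: power2_eq_square)
      ultimately have "r ^ (2 * n + 1) - r ^ (2 * (n + 1) + 1) = ((r\<^sup>2) ^ j * (1 - r\<^sup>2)) * r ^ (2 * (n - j) + 1)"
        by (simp only: right_diff_distrib left_diff_distrib mult_1_right mult_ac)
      also have "\<dots> \<le> 1 / (real j + 1) * r ^ (2 * (n - j) + 1)"
        using power_mult_one_minus_le[OF x, of j] r by (intro mult_right_mono) auto
      also have "\<dots> \<le> 2 / (real n + 1) * r ^ (2 * (n - j) + 1)"
      proof (rule mult_right_mono)
        have "n + 1 \<le> 2 * (j + 1)" unfolding j_def by presburger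
        from of_nat_mono[OF this, where 'a = real] have "real n + 1 \<le> 2 * (real j + 1)" by simp
        then show "1 / (real j + 1) \<le> 2 / (real n + 1)" by (simp add: field_simps)
      qed (use r in simp)
      finally show "r ^ (2 * n + 1) - r ^ (2 * (n + 1) + 1) \<le> 2 / (real n + 1) * r ^ (2 * (n - j) + 1)" .
    qed (simp_all del: power_Suc)
    also have "\<dots> = 2 / (real n + 1) * m (n - j)"
      by (subst integral_mult_right_zero) (simp add: m_def g_def)
    also have "\<dots> \<le> 2 / (real n + 1) * (D * m (n + 2))"
      by (intro mult_left_mono mle) (auto simp: j_def)
    finally show ?thesis by simp
  qed
  have d2: "m n - 2 * m (n + 1) + m (n + 2) \<le> 16 * D * m (n + 2) / (real n + 1)\<^sup>2"
    and d2': "0 \<le> m n - 2 * m (n + 1) + m (n + 2)" for n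
  proof -
    \<comment> \<open>Two factors 1 - r^2 occur; each receives about a quarter of the power of r^2,
      and about half remains.\<close>
    define j where "j = n div 4"
    have eq: "m n - 2 * m (n + 1) + m (n + 2)
        = (LINT r|W. r ^ (2 * n + 1) - 2 * r ^ (2 * (n + 1) + 1) + r ^ (2 * (n + 2) + 1))"
      unfolding m_def g_def
      by (simp only: Bochner_Integration.integral_add Bochner_Integration.integral_diff integrable_power
          integrable_mult_right Bochner_Integration.integrable_diff integral_mult_right_zero)
    have fact: "r ^ (2 * n + 1) - 2 * r ^ (2 * (n + 1) + 1) + r ^ (2 * (n + 2) + 1)
        = ((r\<^sup>2) ^ j * (1 - r\<^sup>2))\<^sup>2 * r ^ (2 * (n - 2 * j) + 1)" for r :: real
    proof -
      have "2 * n + 1 = 2 * j * 2 + (2 * (n - 2 * j) + 1)" by (simp add: j_def)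
      then have 1: "r ^ (2 * n + 1) = ((r\<^sup>2) ^ j)\<^sup>2 * r ^ (2 * (n - 2 * j) + 1)"
        by (metis power_add power_mult)
      have 2: "r ^ (2 * (n + 1) + 1) = r ^ (2 * n + 1) * r\<^sup>2"
        "r ^ (2 * (n + 2) + 1) = r ^ (2 * n + 1) * (r\<^sup>2)\<^sup>2"
        by (simp_all add: power_add power2_eq_square)
      show ?thesis unfolding 2 1 by (simp add: power2_eq_square algebra_simps)
    qed
    show "0 \<le> m n - 2 * m (n + 1) + m (n + 2)"
      unfolding eq fact
    proof (rule integral_nonneg_AE)
      show "AE r in W. 0 \<le> ((r\<^sup>2) ^ j * (1 - r\<^sup>2))\<^sup>2 * r ^ (2 * (n - 2 * j) + 1)"
        using AE_W by eventually_elim auto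
    qed
    have "m n - 2 * m (n + 1) + m (n + 2) \<le> (LINT r|W. 16 / (real n + 1)\<^sup>2 * r ^ (2 * (n - 2 * j) + 1))"
      unfolding eq
    proof (rule integral_mono_unit)
      fix r :: real assume r: "0 \<le> r" "r < 1"
      have x: "0 \<le> r\<^sup>2" "r\<^sup>2 \<le> 1" using r by (auto intro: power_le_one)
      have "((r\<^sup>2) ^ j * (1 - r\<^sup>2))\<^sup>2 \<le> (1 / (real j + 1))\<^sup>2"
        using power_mult_one_minus_le[OF x, of j] x by (intro power_mono) auto
      also have "\<dots> \<le> (4 / (real n + 1))\<^sup>2"
      proof (rule power_mono)
        have "n + 1 \<le> 4 * (j + 1)" unfolding j_def by presburger
        from of_nat_mono[OF this, where 'a = real] have "real n + 1 \<le> 4 * (real j + 1)" by simp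
        then show "1 / (real j + 1) \<le> 4 / (real n + 1)" by (simp add: field_simps)
      qed simp
      finally show "r ^ (2 * n + 1) - 2 * r ^ (2 * (n + 1) + 1) + r ^ (2 * (n + 2) + 1)
          \<le> 16 / (real n + 1)\<^sup>2 * r ^ (2 * (n - 2 * j) + 1)"
        unfolding fact using r by (intro mult_right_mono) (auto simp: power_divide)
    qed (simp_all del: power_Suc)
    also have "\<dots> = 16 / (real n + 1)\<^sup>2 * m (n - 2 * j)"
      by (subst integral_mult_right_zero) (simp add: m_def g_def)
    also have "\<dots> \<le> 16 / (real n + 1)\<^sup>2 * (D * m (n + 2))"
      by (intro mult_left_mono mle) (auto simp: j_def)
    finally show "m n - 2 * m (n + 1) + m (n + 2) \<le> 16 * D * m (n + 2) / (real n + 1)\<^sup>2" by simp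
  qed
  have q: "q n = 1 / m n" for n by (simp add: q_def m_def)
  show ?thesis
  proof (intro exI conjI allI impI)
    fix n :: nat
    have "\<bar>q (n + 1) - q n\<bar> = (m n - m (n + 1)) / (m n * m (n + 1))"
      using mpos[of n] mpos[of "n + 1"] m_anti[of n] by (simp add: q field_simps abs_if)
    also have "\<dots> \<le> (2 * D * m (n + 1) / (real n + 1)) / (m n * m (n + 1))"
    proof (rule divide_right_mono)
      have "2 * D * m (n + 2) / (real n + 1) \<le> 2 * D * m (n + 1) / (real n + 1)"
        using m_anti[of "n + 1"] D1 by (intro divide_right_mono mult_left_mono) auto
      then show "m n - m (n + 1) \<le> 2 * D * m (n + 1) / (real n + 1)" using d1[of n] by simp
    qed (use mpos[of n] mpos[of "n + 1"] in simp)
    also have "\<dots> = 2 * D * q n / (real n + 1)"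
      using mpos[of n] mpos[of "n + 1"] by (simp add: q)
    also have "\<dots> \<le> 24 * D\<^sup>2 * q n / (real n + 1)"
    proof (intro divide_right_mono mult_right_mono)
      show "2 * D \<le> 24 * D\<^sup>2" using D1 mult_right_mono[of 1 D D] by (simp add: power2_eq_square)
    qed (use mpos[of n] in \<open>auto simp: q\<close>)
    finally show "\<bar>q (n + 1) - q n\<bar> \<le> 24 * D\<^sup>2 * q n / (real n + 1)" .
  next
    fix n :: nat
    define M where "M = m (n + 2)"
    define N where "N = real n + 1"
    define a where "a = m n - m (n + 1)"
    define b where "b = m (n + 1) - m (n + 2)"
    have N: "0 < N" by (simp add: N_def)
    have M: "0 < M" by (simp add: M_def mpos)
    have ab: "0 \<le> a" "0 \<le> b" "b \<le> a" "a \<le> 2 * D * M / N" "a - b \<le> 16 * D * M / N\<^sup>2"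
      using m_anti[of n] m_anti[of "n + 1"] d1[of n] d2[of n] d2'[of n]
      by (simp_all add: a_def b_def M_def N_def)
    have mn: "m n \<le> D * M" unfolding M_def by (rule mle) simp
    have "m n * (a - b) \<le> D * M * (16 * D * M / N\<^sup>2)"
      using mn ab mpos[of n] D1 M by (intro mult_mono) auto
    have "a * (a + b) \<le> (2 * D * M / N) * (2 * (2 * D * M / N))"
      using ab D1 M N by (intro mult_mono) auto
    \<comment> \<open>24 = 16 + 8: the second difference of \<open>m\<close> contributes 16, the
      product of first differences 2 * 4.\<close>
    have num: "m n * (a - b) + a * (a + b) \<le> 24 * D\<^sup>2 * M\<^sup>2 / N\<^sup>2"
    proof -
      have "D * M * (16 * D * M / N\<^sup>2) + (2 * D * M / N) * (2 * (2 * D * M / N)) = 24 * D\<^sup>2 * M\<^sup>2 / N\<^sup>2"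
        using N by (simp add: power2_eq_square field_simps)
      with \<open>m n * (a - b) \<le> D * M * (16 * D * M / N\<^sup>2)\<close> \<open>a * (a + b) \<le> (2 * D * M / N) * (2 * (2 * D * M / N))\<close>
      show ?thesis by linarith
    qed
    have "\<bar>q (n + 2) - 2 * q (n + 1) + q n\<bar> = \<bar>a * (a + b) - m n * (a - b)\<bar> / (m n * m (n + 1) * m (n + 2))"
    proof -
      \<comment> \<open>The numerator is arranged so that every term contains either two first
        differences or one second difference \<open>a - b\<close>.\<close>
      have "q (n + 2) - 2 * q (n + 1) + q n = (a * (a + b) - m n * (a - b)) / (m n * m (n + 1) * m (n + 2))"
      proof -
        have alg: "1 / z - 2 * (1 / y) + 1 / x = ((x - y) * ((x - y) + (y - z)) - x * ((x - y) - (y - z))) / (x * y * z)"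
          if "0 < x" "0 < y" "0 < z" for x y z :: real
        proof -
          have "(x - y) * ((x - y) + (y - z)) - x * ((x - y) - (y - z)) = x * y - 2 * (x * z) + y * z"
            by (simp add: algebra_simps)
          then show ?thesis using that by (simp add: add_divide_distrib diff_divide_distrib)
        qed
        show ?thesis unfolding q a_def b_def by (rule alg[OF mpos mpos mpos])
      qed
      then show ?thesis
        using mpos[of n] mpos[of "n + 1"] mpos[of "n + 2"] by (simp add: abs_mult)
    qed
    also have "\<dots> \<le> (24 * D\<^sup>2 * M\<^sup>2 / N\<^sup>2) / (m n * m (n + 1) * m (n + 2))"
    proof (rule divide_right_mono)
      have "0 \<le> m n * (a - b)" "0 \<le> a * (a + b)" using ab mpos[of n] by auto
      then show "\<bar>a * (a + b) - m n * (a - b)\<bar> \<le> 24 * D\<^sup>2 * M\<^sup>2 / N\<^sup>2" using num by linarith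
    qed (use mpos[of n] mpos[of "n + 1"] mpos[of "n + 2"] in auto)
    also have "\<dots> \<le> (24 * D\<^sup>2 * M\<^sup>2 / N\<^sup>2) / (m n * M * M)"
    proof (rule divide_left_mono)
      show "m n * M * M \<le> m n * m (n + 1) * m (n + 2)"
        using m_anti[of "n + 1"] mpos[of n] M by (intro mult_mono) (auto simp: M_def)
    qed (use D1 M mpos[of n] mpos[of "n + 1"] mpos[of "n + 2"] in auto)
    also have "\<dots> = 24 * D\<^sup>2 * q n / N\<^sup>2"
      using M by (simp add: q power2_eq_square)
    finally show "\<bar>q (n + 2) - 2 * q (n + 1) + q n\<bar> \<le> 24 * D\<^sup>2 * q n / (real n + 1)\<^sup>2"
      by (simp add: N_def)
  next
    fix k n :: nat assume "k \<le> 2 * n + 1"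
    then have "m n \<le> D * m k" by (intro mle) auto
    also have "\<dots> \<le> 24 * D\<^sup>2 * m k"
      using D1 mult_right_mono[of 1 D D] mpos[of k] by (intro mult_right_mono) (auto simp: power2_eq_square)
    finally show "q k \<le> 24 * D\<^sup>2 * q n" using mpos[of n] mpos[of k] by (simp add: q field_simps)
  qed
qed

text \<open>Going from \<open>g\<close> to \<open>T\<close> and back costs D * E. Iterating the
  hypothesis until c^i exceeds 2 * D * E leaves the factor 1/2; the dilation becomes K^i, rounded up
  to an integer.\<close>

lemma g_reverse_doubling:
  assumes K: "1 < K" and c: "1 < c"
    and rev: "\<And>r. 0 \<le> r \<Longrightarrow> r < 1 \<Longrightarrow> c * T (1 - (1 - r) / K) \<le> T r"
  shows "\<exists>L\<ge>2. \<forall>k\<ge>1. g (L * k) \<le> g k / 2"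
proof -
  obtain E where E: "0 < E" "\<And>k. 1 \<le> k \<Longrightarrow> T (1 - 1 / real k) \<le> E * g k" using T_le_g by blast
  obtain D where D: "0 < D" "\<And>k. 1 \<le> k \<Longrightarrow> g k \<le> D * T (1 - 1 / real k)" using g_le_T by blast
  obtain i where i: "2 * D * E < c ^ i" using real_arch_pow[OF c] by blast
  have iter: "c ^ i * T (1 - (1 - r) / K ^ i) \<le> T r" if "0 \<le> r" "r < 1" for r i
  proof (induction i)
    case (Suc i)
    define s where "s = 1 - (1 - r) / K ^ i"
    have "(1 - r) / K ^ i \<le> 1 - r"
      using that K divide_left_mono[of 1 "K ^ i" "1 - r"] by (simp add: one_le_power)
    moreover have "0 < (1 - r) / K ^ i" using that K by simp
    ultimately have s: "0 \<le> s" "s < 1" using that(1) unfolding s_def by linarith+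
    have "c ^ Suc i * T (1 - (1 - s) / K) \<le> c ^ i * T s"
      using rev[OF s] c mult_left_mono[of "c * T (1 - (1 - s) / K)" "T s" "c ^ i"] by (simp add: mult_ac)
    also have "\<dots> \<le> T r" using Suc by (simp add: s_def)
    finally show ?case by (simp add: s_def mult.commute)
  qed simp
  define L where "L = max 2 (nat \<lceil>K ^ i\<rceil>)"
  have L: "2 \<le> L" "K ^ i \<le> real L"
  proof -
    have "K ^ i \<le> real (nat \<lceil>K ^ i\<rceil>)" by linarith
    also have "\<dots> \<le> real L" by (simp add: L_def)
    finally show "K ^ i \<le> real L" .
  qed (simp add: L_def)
  show ?thesis
  proof (intro exI conjI allI impI)
    show "2 \<le> L" by fact
    fix k :: nat assume k: "1 \<le> k"
    have "1 \<le> L * k" using k L by (simp add: Suc_le_eq)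
    then have "g (L * k) \<le> D * T (1 - 1 / real (L * k))" by (rule D)
    also have "T (1 - 1 / real (L * k)) \<le> T (1 - (1 - (1 - 1 / real k)) / K ^ i)"
    proof (rule T_antimono)
      have "1 / (real L * real k) \<le> 1 / (K ^ i * real k)"
        using L k K by (intro divide_left_mono mult_right_mono) auto
      then show "1 - (1 - (1 - 1 / real k)) / K ^ i \<le> 1 - 1 / real (L * k)"
        by (simp add: mult.commute)
    qed
    also have "\<dots> \<le> T (1 - 1 / real k) / c ^ i"
      using iter[of "1 - 1 / real k" i] k c by (simp add: field_simps)
    also have "\<dots> \<le> E * g k / c ^ i" using E(2)[OF k] c by (intro divide_right_mono) auto
    finally have "g (L * k) \<le> D * (E * g k / c ^ i)" using D(1) by simp
    also have "\<dots> = (D * E / c ^ i) * g k" by simp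
    also have "\<dots> \<le> (1 / 2) * g k"
      using i c g_pos[of k] by (intro mult_right_mono) (auto simp: field_simps)
    finally show "g (L * k) \<le> g k / 2" by simp
  qed
qed

text \<open>Put h = 1 - r and apply the hypothesis at 1 - h/K. For n between 1/h and K/h the powers
  stay above exp (-4) and g (2n+1) is at most D * T r, while the harmonic sum over j dyadic blocks
  is at least j/2. So j * T (1 - h/K) is at most a constant times T r, and a large j yields the
  factor 2.\<close>

lemma reverse_doubling_of_moment_sum:
  assumes A: "\<And>\<rho> N. 1 / 2 \<le> \<rho> \<Longrightarrow> \<rho> < 1 \<Longrightarrow>
      T \<rho> * (\<Sum>n<N. \<rho> ^ (2 * n) / ((real n + 1) * g (2 * n + 1))) \<le> A"
  shows "\<exists>K>1. \<exists>c>1. \<forall>r\<in>{0..<1}. c * T (1 - (1 - r) / K) \<le> T r"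
proof -
  obtain D where D: "0 < D" "\<And>k. 1 \<le> k \<Longrightarrow> g k \<le> D * T (1 - 1 / real k)" using g_le_T by blast
  have harm: "real j / 2 \<le> (\<Sum>n\<in>{M..<2 ^ j * M}. 1 / (real n + 1))" if M: "1 \<le> M" for M j
  proof (induction j)
    case (Suc j)
    have "1 / 2 = (\<Sum>n\<in>{2 ^ j * M..<2 * (2 ^ j * M)}. 1 / (2 * (2 ^ j * real M)))"
      using M by (simp add: field_simps)
    also have "\<dots> \<le> (\<Sum>n\<in>{2 ^ j * M..<2 * (2 ^ j * M)}. 1 / (real n + 1))"
    proof (intro sum_mono divide_left_mono)
      fix n assume "n \<in> {2 ^ j * M..<2 * (2 ^ j * M)}"
      then have "n + 1 \<le> 2 * (2 ^ j * M)" by simp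
      then have "real (n + 1) \<le> real (2 * (2 ^ j * M))" by (rule of_nat_mono)
      then show "real n + 1 \<le> 2 * (2 ^ j * real M)" by simp
    qed (use M in auto)
    finally have "real (Suc j) / 2 \<le> (\<Sum>n\<in>{M..<2 ^ j * M}. 1 / (real n + 1))
        + (\<Sum>n\<in>{2 ^ j * M..<2 * (2 ^ j * M)}. 1 / (real n + 1))"
      using Suc by simp
    also have "\<dots> = (\<Sum>n\<in>{M..<2 * (2 ^ j * M)}. 1 / (real n + 1))"
      by (rule sum.atLeastLessThan_concat) (use M in auto)
    finally show ?case by (simp add: mult.assoc)
  qed simp
  obtain j :: nat where j0: "4 * D * A * exp 4 \<le> real j" using real_arch_simple by blast
  \<comment> \<open>The exponent is j + 1 because rounding 1/h up to \<open>M\<close> may double it,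
    and n * x \<le> 1 has to hold for all n below 2^j * M.\<close>
  define K :: real where "K = 2 ^ (j + 1)"
  have K2: "2 \<le> K" by (simp add: K_def)
  show ?thesis
  proof (intro exI conjI ballI)
    show "1 < K" using K2 by simp
    show "(1::real) < 2" by simp
    fix r :: real assume "r \<in> {0..<1}"
    then have r: "0 \<le> r" "r < 1" by auto
    define h where "h = 1 - r"
    have h: "0 < h" "h \<le> 1" using r by (auto simp: h_def)
    define x where "x = h / K"
    have x: "0 < x" "x \<le> 1 / 2" using h K2 by (auto simp: x_def field_simps)
    define M where "M = nat \<lceil>1 / h\<rceil>"
    have M1: "1 / h \<le> real M" unfolding M_def by linarith
    have "1 \<le> 1 / h" using h by simp
    then have M: "1 \<le> M" using M1 by linarith
    have "real M < 1 / h + 1" unfolding M_def using h ceiling_correct[of "1 / h"] by (simp add: of_nat_nat)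
    with \<open>1 \<le> 1 / h\<close> have M2: "real M \<le> 2 / h" by simp
    have summand: "exp (- 4) / (D * T r) * (1 / (real n + 1)) \<le> (1 - x) ^ (2 * n) / ((real n + 1) * g (2 * n + 1))"
      if n: "n \<in> {M..<2 ^ j * M}" for n
    proof -
      have "real n \<le> 2 ^ j * real M" using n of_nat_mono[of n "2 ^ j * M"] by simp
      also have "\<dots> \<le> 2 ^ j * (2 / h)" using M2 by (intro mult_left_mono) auto
      also have "\<dots> = 1 / x" by (simp add: x_def K_def)
      finally have "real n * x \<le> 1" using x by (simp add: field_simps)
      then have "exp (- 4) \<le> exp (- 2 * x) ^ (2 * n)"
        by (simp add: mult_ac flip: exp_of_nat_mult)
      also have "\<dots> \<le> (1 - x) ^ (2 * n)" using x by (intro power_mono exp_le_one_minus) auto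
      finally have 1: "exp (- 4) \<le> (1 - x) ^ (2 * n)" .
      have "1 / h \<le> real (2 * n + 1)" using M1 n by auto
      then have "1 / real (2 * n + 1) \<le> h" using h by (simp add: field_simps)
      then have "T (1 - 1 / real (2 * n + 1)) \<le> T r" by (intro T_antimono) (simp add: h_def)
      then have "g (2 * n + 1) \<le> D * T r"
        using D(2)[of "2 * n + 1"] D(1) mult_left_mono[of "T (1 - 1 / real (2 * n + 1))" "T r" D] by linarith
      then have "exp (- 4) / (D * T r) \<le> (1 - x) ^ (2 * n) / g (2 * n + 1)"
        using 1 g_pos[of "2 * n + 1"] x by (intro frac_le) auto
      then have "exp (- 4) / (D * T r) * (1 / (real n + 1)) \<le> (1 - x) ^ (2 * n) / g (2 * n + 1) * (1 / (real n + 1))"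
        by (intro mult_right_mono) auto
      then show ?thesis by (simp add: mult.commute)
    qed
    have "exp (- 4) / (D * T r) * (real j / 2) \<le> exp (- 4) / (D * T r) * (\<Sum>n\<in>{M..<2 ^ j * M}. 1 / (real n + 1))"
      using harm[OF M, of j] D(1) T_nonneg by (intro mult_left_mono) auto
    also have "\<dots> \<le> (\<Sum>n\<in>{M..<2 ^ j * M}. (1 - x) ^ (2 * n) / ((real n + 1) * g (2 * n + 1)))"
      unfolding sum_distrib_left by (rule sum_mono) (rule summand)
    also have "\<dots> \<le> (\<Sum>n<2 ^ j * M. (1 - x) ^ (2 * n) / ((real n + 1) * g (2 * n + 1)))"
      by (rule sum_mono2) (use x g_nonneg in auto)
    finally have "T (1 - x) * (exp (- 4) / (D * T r) * (real j / 2))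
        \<le> T (1 - x) * (\<Sum>n<2 ^ j * M. (1 - x) ^ (2 * n) / ((real n + 1) * g (2 * n + 1)))"
      by (rule mult_left_mono[OF _ T_nonneg])
    also have "\<dots> \<le> A" using x by (intro A) auto
    finally have "T (1 - x) * (exp (- 4) / (D * T r) * (real j / 2)) \<le> A" .
    then have *: "T (1 - x) * real j \<le> 2 * D * A * exp 4 * T r"
    proof -
      have "T (1 - x) * real j = (T (1 - x) * (exp (- 4) / (D * T r) * (real j / 2))) * (2 * exp 4 * (D * T r))"
        using D(1) T_pos[OF r] by (simp add: exp_minus)
      also have "\<dots> \<le> A * (2 * exp 4 * (D * T r))"
        using \<open>T (1 - x) * (exp (- 4) / (D * T r) * (real j / 2)) \<le> A\<close> D(1) T_nonneg[of r]
        by (intro mult_right_mono) auto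
      finally show ?thesis by (simp add: mult_ac)
    qed
    show "2 * T (1 - (1 - r) / K) \<le> T r"
    \<comment> \<open>A nonpositive \<open>A\<close> contradicts the hypothesis already for a
      one-term sum; a positive one can be cancelled.\<close>
    proof (cases "A \<le> 0")
      case True
      have "0 < T (1 - x) * (\<Sum>n<1. (1 - x) ^ (2 * n) / ((real n + 1) * g (2 * n + 1)))"
        using x T_pos[of "1 - x"] g_pos[of 1] by simp
      then show ?thesis using A[of "1 - x" 1] x True by simp
    next
      case False
      then have pos: "0 < 4 * D * A * exp 4" using D(1) by simp
      have "T (1 - x) * (4 * D * A * exp 4) \<le> T (1 - x) * real j"
        using j0 by (intro mult_left_mono T_nonneg)
      with * have "(2 * T (1 - x)) * (2 * D * A * exp 4) \<le> T r * (2 * D * A * exp 4)"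
        by (simp add: mult_ac)
      then have "2 * T (1 - x) \<le> T r" by (rule mult_right_le_imp_le) (use pos in simp)
      then show ?thesis by (simp add: x_def h_def)
    qed
  qed
qed

end

section \<open>Reverse doubling and powers of the tail\<close>

text \<open>1/(n+1)^2 is at most 1/n - 1/(n+1), and the sum telescopes.\<close>

lemma sum_inverse_squares_tail_le:
  assumes N: "1 \<le> N" and m: "N \<le> m"
  shows "(\<Sum>n\<in>{N..<m}. real N / (real n + 1)\<^sup>2) \<le> 1 - real N / real m"
  using m
proof (induction m rule: dec_induct)
  case (step m)
  have m0: "0 < real m" using N step by simp
  have "(\<Sum>n\<in>{N..<Suc m}. real N / (real n + 1)\<^sup>2) \<le> 1 - real N / real m + real N / (real m + 1)\<^sup>2"
    using step by simp
  also have "real N / (real m + 1)\<^sup>2 \<le> real N / (real m * (real m + 1))"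
    using m0 by (intro divide_left_mono) (auto simp: power2_eq_square intro!: mult_right_mono)
  also have "\<dots> = real N / real m - real N / real (Suc m)"
    using m0 by (simp add: field_simps)
  finally show ?case by simp
qed (use N in simp)

text \<open>The explicit constant comes from (1 + y/m)^m \<le> exp y at y = x/2.\<close>

lemma power_mult_exp_minus_half_le:
  fixes x :: real
  assumes x: "0 \<le> x" and m: "0 < m"
  shows "x ^ m * exp (- (x / 2)) \<le> (2 * real m) ^ m"
proof -
  have "(x / (2 * real m)) ^ m \<le> (1 + (x / 2) / real m) ^ m"
    using x m by (intro power_mono) (auto simp: field_simps)
  also have "\<dots> \<le> exp (x / 2)"
    by (rule exp_ge_one_plus_x_over_n_power_n) (use x m in auto)
  finally have "x ^ m \<le> exp (x / 2) * (2 * real m) ^ m"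
    using m by (simp add: power_divide field_simps)
  then show ?thesis by (simp add: exp_minus field_simps)
qed

text \<open>Reverse doubling is assumed for the moments and with an integer dilation, so that index
  ranges can be cut into blocks of ratio \<open>L\<close>.\<close>

locale regular_measure = doubling_measure +
  fixes L :: nat
  assumes L2: "2 \<le> L" and rev: "\<And>k. 1 \<le> k \<Longrightarrow> g (L * k) \<le> g k / 2"
begin

lemma powr_g_antimono: "0 \<le> a \<Longrightarrow> k \<le> l \<Longrightarrow> g k powr (- a) \<le> g l powr (- a)"
  using g_pos g_antimono by (intro powr_mono2') auto

text \<open>The block (n/L, n] contributes at most \<open>L * g n powr (- a)\<close>. Below it the
  induction hypothesis applies at n div L, where reverse doubling gains c = 2 powr (- a) <
  1.\<close>

lemma sum_below_le:
  assumes a: "0 < a"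
  shows "\<exists>A>0. \<forall>n\<ge>1. (\<Sum>k\<in>{1..n}. g k powr (- a) / real k) \<le> A * g n powr (- a)"
proof -
  define c where "c = 2 powr (- a)"
  have c: "0 < c" "c < 1" using a by (auto simp: c_def powr_less_one)
  \<comment> \<open>The solution of A * c + L = A, which closes the induction.\<close>
  define A where "A = real L / (1 - c)"
  have A: "0 < A" "A * c + real L = A"
  proof -
    have "A * (1 - c) = real L" using c by (simp add: A_def)
    then show "A * c + real L = A" by (simp add: algebra_simps)
  qed (use c L2 in \<open>simp add: A_def\<close>)
  have "(\<Sum>k\<in>{1..n}. g k powr (- a) / real k) \<le> A * g n powr (- a)" if "1 \<le> n" for n
    using that
  proof (induction n rule: less_induct)
    case (less n)
    define m where "m = n div L"
    have mn: "m < n" using less.prems L2 by (auto simp: m_def)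
    have split: "{1..n} = {1..m} \<union> {m+1..n}" using mn by auto
    have "(\<Sum>k\<in>{1..n}. g k powr (- a) / real k)
        = (\<Sum>k\<in>{1..m}. g k powr (- a) / real k) + (\<Sum>k\<in>{m+1..n}. g k powr (- a) / real k)"
      unfolding split by (rule sum.union_disjoint) auto
    also have "(\<Sum>k\<in>{1..m}. g k powr (- a) / real k) \<le> A * c * g n powr (- a)"
    proof (cases "1 \<le> m")
      case True
      have "L * m \<le> n" by (simp add: m_def)
      then have "2 * g n \<le> g m" using rev[OF True] g_antimono[of "L * m" n] by simp
      then have "g m powr (- a) \<le> (2 * g n) powr (- a)"
        using a g_pos[of n] by (intro powr_mono2') auto
      then have "g m powr (- a) \<le> c * g n powr (- a)"
        using g_pos[of n] by (simp add: c_def powr_mult)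
      then have "A * g m powr (- a) \<le> A * c * g n powr (- a)"
        using A by (simp add: mult.assoc)
      then show ?thesis using less.IH[OF mn True] by simp
    next
      case False
      then show ?thesis using A c by simp
    qed
    also have "(\<Sum>k\<in>{m+1..n}. g k powr (- a) / real k) \<le> real L * g n powr (- a)"
    proof -
      have "(\<Sum>k\<in>{m+1..n}. g k powr (- a) / real k) \<le> (\<Sum>k\<in>{m+1..n}. g n powr (- a) * (real L / real n))"
      proof (rule sum_mono)
        fix k assume k: "k \<in> {m+1..n}"
        have "n < L * (m + 1)" using L2 by (simp add: m_def) (metis dividend_less_times_div mult.commute mult_Suc_right add.commute less_le_trans pos2)
        also have "\<dots> \<le> L * k" using k by (intro mult_le_mono2) simp
        finally have "real n \<le> real L * real k" by (metis of_nat_le_iff of_nat_mult less_imp_le)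
        then have "1 / real k \<le> real L / real n" using k less.prems by (simp add: field_simps)
        moreover have "g k powr (- a) \<le> g n powr (- a)" using a k by (intro powr_g_antimono) auto
        ultimately have "g k powr (- a) * (1 / real k) \<le> g n powr (- a) * (real L / real n)"
          by (intro mult_mono) auto
        then show "g k powr (- a) / real k \<le> g n powr (- a) * (real L / real n)" by simp
      qed
      also have "\<dots> = real (n - m) / real n * (real L * g n powr (- a))" by simp
      also have "\<dots> \<le> 1 * (real L * g n powr (- a))"
        using less.prems by (intro mult_right_mono) (auto simp: divide_le_eq)
      finally show ?thesis by simp
    qed
    finally have "(\<Sum>k\<in>{1..n}. g k powr (- a) / real k) \<le> (A * c + real L) * g n powr (- a)"
      by (simp add: algebra_simps)
    then show ?case by (simp only: A)
  qed
  with A show ?thesis by blast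
qed

text \<open>Dual to \<open>sum_below_le\<close>: blocks [n, L * n) are peeled off at the bottom, and
  reverse doubling makes the bounds for successive blocks decay with ratio \<open>c\<close>.\<close>

lemma sum_above_le:
  assumes d: "0 < d"
  shows "\<exists>A>0. \<forall>n\<ge>1. \<forall>m. (\<Sum>k\<in>{n..<m}. g k powr d / real k) \<le> A * g n powr d"
proof -
  define c where "c = 2 powr (- d)"
  have c: "0 < c" "c < 1" using d by (auto simp: c_def powr_less_one)
  define A where "A = real L / (1 - c)"
  have A: "0 < A" "real L + A * c = A"
  proof -
    have "A * (1 - c) = real L" using c by (simp add: A_def)
    then show "real L + A * c = A" by (simp add: algebra_simps)
  qed (use c L2 in \<open>simp add: A_def\<close>)
  have block: "(\<Sum>k\<in>{n..<m}. g k powr d / real k) \<le> real L * g n powr d" if "1 \<le> n" "m \<le> L * n" for n m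
  proof -
    have "(\<Sum>k\<in>{n..<m}. g k powr d / real k) \<le> (\<Sum>k\<in>{n..<m}. g n powr d / real n)"
      using that d g_antimono g_nonneg by (intro sum_mono frac_le powr_mono2) auto
    also have "\<dots> = real (m - n) / real n * g n powr d" by simp
    also have "\<dots> \<le> real L * g n powr d"
    proof (rule mult_right_mono)
      have "real (m - n) \<le> real (L * n)" using that by linarith
      then show "real (m - n) / real n \<le> real L" using that by (simp add: divide_le_eq)
    qed simp
    finally show ?thesis .
  qed
  have "(\<Sum>k\<in>{n..<m}. g k powr d / real k) \<le> A * g n powr d" if "1 \<le> n" for n m
    using that
  proof (induction "m - n" arbitrary: n rule: less_induct)
    case less
    show ?case
    proof (cases "m \<le> L * n")
      case True
      have "real L \<le> A" using A c by (metis add_le_cancel_left add.right_neutral less_imp_le mult_nonneg_nonneg)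
      then have "real L * g n powr d \<le> A * g n powr d" by (intro mult_right_mono) auto
      then show ?thesis using block[OF less.prems True] by simp
    next
      case False
      have Ln: "n < L * n" using less.prems L2 by simp
      have "(\<Sum>k\<in>{n..<m}. g k powr d / real k)
          = (\<Sum>k\<in>{n..<L*n}. g k powr d / real k) + (\<Sum>k\<in>{L*n..<m}. g k powr d / real k)"
        using False Ln by (intro sum.atLeastLessThan_concat[symmetric]) auto
      also have "(\<Sum>k\<in>{n..<L*n}. g k powr d / real k) \<le> real L * g n powr d"
        by (rule block) (use less.prems in auto)
      also have "(\<Sum>k\<in>{L*n..<m}. g k powr d / real k) \<le> A * g (L * n) powr d"
      proof (rule less.hyps)
        show "m - L * n < m - n" using False Ln by linarith
        show "1 \<le> L * n" using Ln by linarith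
      qed
      also have "g (L * n) powr d \<le> (g n / 2) powr d"
        using rev[OF less.prems] d g_nonneg by (intro powr_mono2) auto
      also have "\<dots> = c * g n powr d"
        using g_pos[of n] by (simp add: c_def powr_divide powr_minus field_simps)
      finally have "(\<Sum>k\<in>{n..<m}. g k powr d / real k) \<le> (real L + A * c) * g n powr d"
        using A(1) by (simp add: algebra_simps)
      then show ?thesis by (simp only: A)
    qed
  qed
  with A show ?thesis by blast
qed

text \<open>Doubling limits the decay of the moments to a power of the index: a step from N to 2N
  costs \<open>C\<close>, which the ratio repays with 2^\<beta>. The prefactor \<open>C\<close>
  covers the last, incomplete step.\<close>

lemma g_polynomial_doubling:
  assumes \<beta>: "C \<le> 2 ^ \<beta>" and "1 \<le> N" "N \<le> \<nu>"
  shows "g N \<le> C * (real \<nu> / real N) ^ \<beta> * g \<nu>"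
  using assms(2,3)
proof (induction "\<nu> - N" arbitrary: N rule: less_induct)
  case less
  have N0: "0 < real N" using less.prems by simp
  have dbl: "g N \<le> C * g (2 * N)" using g_doubling[of N] less.prems by simp
  show ?case
  proof (cases "\<nu> \<le> 2 * N")
    case True
    have "g N \<le> C * g \<nu>"
      using dbl g_antimono[OF True] C1 mult_left_mono[of "g (2 * N)" "g \<nu>" C] by linarith
    also have "\<dots> \<le> C * (real \<nu> / real N) ^ \<beta> * g \<nu>"
    proof (rule mult_right_mono)
      have "1 \<le> (real \<nu> / real N) ^ \<beta>" using less.prems by (intro one_le_power) simp
      then show "C \<le> C * (real \<nu> / real N) ^ \<beta>" using C1 by simp
    qed (use g_pos[of \<nu>] in simp)
    finally show ?thesis .
  next
    case False
    have "g (2 * N) \<le> C * (real \<nu> / real (2 * N)) ^ \<beta> * g \<nu>"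
      by (rule less.hyps) (use False less.prems in auto)
    then have "C * g (2 * N) \<le> C * (C * (real \<nu> / real (2 * N)) ^ \<beta> * g \<nu>)"
      using C1 by (intro mult_left_mono) auto
    also have "\<dots> = (C / 2 ^ \<beta>) * (C * (real \<nu> / real N) ^ \<beta> * g \<nu>)"
      using N0 by (simp add: power_divide power_mult_distrib)
    also have "\<dots> \<le> 1 * (C * (real \<nu> / real N) ^ \<beta> * g \<nu>)"
      using \<beta> C1 g_pos[of \<nu>] by (intro mult_right_mono) (auto simp: divide_le_eq)
    finally show ?thesis using dbl by simp
  qed
qed

text \<open>The scale of s: the index n with 1 - 1/n \<le> s < 1 - 1/(n+1). Integer scales allow
  powers of the tail to be compared directly with partial sums over indices.\<close>

definition step :: "real \<Rightarrow> nat" where "step s = nat \<lfloor>1 / (1 - s)\<rfloor>"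

text \<open>Up to constants this is \<open>T s powr (- a)\<close>.\<close>
definition \<Phi> :: "real \<Rightarrow> real \<Rightarrow> real" where "\<Phi> a s = g (step s) powr (- a)"

lemma step_bounds:
  assumes "0 \<le> s" "s < 1"
  shows "1 \<le> step s" "1 - 1 / real (step s) \<le> s" "s \<le> 1 - 1 / (real (step s) + 1)"
proof -
  have 1: "1 \<le> 1 / (1 - s)" using assms by simp
  then have "1 \<le> \<lfloor>1 / (1 - s)\<rfloor>" by linarith
  then show st: "1 \<le> step s" unfolding step_def by linarith
  have r: "real (step s) = of_int \<lfloor>1 / (1 - s)\<rfloor>"
    unfolding step_def by (rule of_nat_nat) (use \<open>1 \<le> \<lfloor>1 / (1 - s)\<rfloor>\<close> in linarith)
  have "real (step s) \<le> 1 / (1 - s)" unfolding r by linarith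
  then show "1 - 1 / real (step s) \<le> s" using st assms by (simp add: field_simps)
  have "1 / (1 - s) < real (step s) + 1" unfolding r by linarith
  then have "1 < (real (step s) + 1) * (1 - s)" using assms by (simp add: field_simps)
  then have "1 / (real (step s) + 1) < 1 - s" by (simp add: field_simps)
  then show "s \<le> 1 - 1 / (real (step s) + 1)" by simp
qed

lemma \<Phi>_measurable [measurable]: "\<Phi> a \<in> borel_measurable borel"
proof -
  have [measurable]: "step \<in> borel \<rightarrow>\<^sub>M count_space UNIV" unfolding step_def by measurable
  show ?thesis unfolding \<Phi>_def by measurable
qed

lemma \<Phi>_pos: "0 < \<Phi> a s"
  using g_pos[of "step s"] by (simp add: \<Phi>_def)

lemma \<Phi>_nonneg: "0 \<le> \<Phi> a s"
  by (rule less_imp_le[OF \<Phi>_pos])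

text \<open>The upper half of the indices below N = \<open>step s\<close> suffices: there s^n is at
  least exp (-2), the denominators are at most N, and doubling compares the moments near N/2 with
  the one at N. As a < 1, the loss C powr a is at most C.\<close>

lemma \<Phi>_le_sum:
  assumes a: "0 < a" "a < 1" and s: "0 \<le> s" "s < 1"
  shows "\<Phi> a s \<le> 2 * exp 2 * C * (\<Sum>n<step s. s ^ n * (g (n + 1) powr (- a) / (real n + 1)))"
proof -
  define N where "N = step s"
  have N: "1 \<le> N" "1 - 1 / real N \<le> s" using step_bounds[OF s] by (auto simp: N_def)
  have sn: "exp (- 2) \<le> s ^ n" if "n < N" for n
  proof (cases "N = 1")
    case True
    then show ?thesis using that by simp
  next
    case False
    with N have N2: "2 \<le> real N" by simp
    have "exp (- 2) \<le> exp (- 2 * (1 / real N)) ^ n"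
      using that by (simp flip: exp_of_nat_mult) (simp add: field_simps)
    also have "\<dots> \<le> (1 - 1 / real N) ^ n"
      using N2 by (intro power_mono exp_le_one_minus) (auto simp: field_simps)
    also have "\<dots> \<le> s ^ n" using N by (intro power_mono) auto
    finally show ?thesis .
  qed
  define h where "h = N div 2"
  have "\<Phi> a s = g N powr (- a)" by (simp add: \<Phi>_def N_def)
  also have "\<dots> \<le> C * g (h + 1) powr (- a)"
  proof -
    have "g (h + 1) \<le> C * g (2 * (h + 1))" by (rule g_doubling) simp
    also have "\<dots> \<le> C * g N" using C1 by (intro mult_left_mono g_antimono) (auto simp: h_def)
    finally have "g (h + 1) / C \<le> g N" using C1 by (simp add: field_simps)
    then have "g N powr (- a) \<le> (g (h + 1) / C) powr (- a)"
      using C1 g_pos[of "h + 1"] a by (intro powr_mono2') auto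
    also have "\<dots> = C powr a * g (h + 1) powr (- a)"
      using C1 g_pos[of "h + 1"] by (simp add: powr_divide powr_minus field_simps)
    also have "\<dots> \<le> C powr 1 * g (h + 1) powr (- a)"
      using C1 a by (intro mult_right_mono powr_mono) auto
    finally show ?thesis using C1 by simp
  qed
  also have "g (h + 1) powr (- a) \<le> 2 * (\<Sum>n\<in>{h..<N}. g (h + 1) powr (- a) / real N)"
  proof -
    have "1 \<le> 2 * (real (N - h) / real N)" using N unfolding h_def by (simp add: field_simps)
    from mult_right_mono[OF this, of "g (h + 1) powr (- a)"] show ?thesis by simp
  qed
  also have "(\<Sum>n\<in>{h..<N}. g (h + 1) powr (- a) / real N)
      \<le> (\<Sum>n\<in>{h..<N}. exp 2 * (s ^ n * (g (n + 1) powr (- a) / (real n + 1))))"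
  proof (rule sum_mono)
    fix n assume n: "n \<in> {h..<N}"
    have "g (h + 1) powr (- a) / real N \<le> g (n + 1) powr (- a) / (real n + 1)"
      using n a by (intro frac_le powr_g_antimono) auto
    also have "\<dots> = 1 * (g (n + 1) powr (- a) / (real n + 1))" by simp
    also have "\<dots> \<le> (exp 2 * s ^ n) * (g (n + 1) powr (- a) / (real n + 1))"
    proof (rule mult_right_mono)
      have "exp 2 * exp (- 2) \<le> exp 2 * s ^ n" using sn[of n] n by (intro mult_left_mono) auto
      then show "1 \<le> exp 2 * s ^ n" by (simp flip: exp_add)
    qed simp
    finally show "g (h + 1) powr (- a) / real N \<le> exp 2 * (s ^ n * (g (n + 1) powr (- a) / (real n + 1)))"
      by (simp add: mult.assoc)
  qed
  also have "\<dots> \<le> (\<Sum>n<N. exp 2 * (s ^ n * (g (n + 1) powr (- a) / (real n + 1))))"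
    by (rule sum_mono2) (use s in auto)
  also have "\<dots> = exp 2 * (\<Sum>n<N. s ^ n * (g (n + 1) powr (- a) / (real n + 1)))"
    by (simp add: sum_distrib_left)
  finally show ?thesis using C1 by (simp add: N_def mult_ac)
qed

text \<open>Below N = \<open>step s\<close> the powers of s are dropped and
  \<open>sum_below_le\<close> applies. Beyond N put x = (n+1)/N: the reciprocal moments grow at most
  like x^\<beta>, while s^n is at most exp (1 - x/2).\<close>

lemma sum_le_\<Phi>:
  assumes a: "0 < a" "a < 1"
  shows "\<exists>A>0. \<forall>s m. 0 \<le> s \<longrightarrow> s < 1 \<longrightarrow>
    (\<Sum>n<m. s ^ n * (g (n + 1) powr (- a) / (real n + 1))) \<le> A * \<Phi> a s"
proof -
  obtain A1 where A1: "0 < A1"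
    "\<And>n. 1 \<le> n \<Longrightarrow> (\<Sum>k\<in>{1..n}. g k powr (- a) / real k) \<le> A1 * g n powr (- a)"
    using sum_below_le[OF a(1)] by blast
  obtain \<beta> :: nat where \<beta>: "C \<le> 2 ^ \<beta>" using real_arch_pow[of 2 C] by (auto intro: less_imp_le)
  \<comment> \<open>The power is \<beta> + 1 because one more factor x, compensated in the
    denominator, turns 1/(n+1) into the summable N/(n+1)^2.\<close>
  define E where "E = exp 1 * C * (2 * real (\<beta> + 1)) ^ (\<beta> + 1)"
  have E: "0 < E" using C1 by (simp add: E_def)
  have main: "(\<Sum>n<m. s ^ n * (g (n + 1) powr (- a) / (real n + 1))) \<le> (A1 + E) * \<Phi> a s"
    if s: "0 \<le> s" "s < 1" for s m
  proof -
    define N where "N = step s"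
    have N: "1 \<le> N" "s \<le> 1 - 1 / (real N + 1)" using step_bounds[OF s] by (auto simp: N_def)
    define t where "t n = s ^ n * (g (n + 1) powr (- a) / (real n + 1))" for n
    have t0: "0 \<le> t n" for n using s by (simp add: t_def)
    have head: "(\<Sum>n<N. t n) \<le> A1 * \<Phi> a s"
    proof -
      have "(\<Sum>n<N. t n) \<le> (\<Sum>n<N. g (Suc n) powr (- a) / real (Suc n))"
        unfolding t_def
      proof (rule sum_mono)
        fix n
        have "s ^ n * (g (n + 1) powr (- a) / (real n + 1)) \<le> 1 * (g (n + 1) powr (- a) / (real n + 1))"
          using s by (intro mult_right_mono power_le_one) auto
        then show "s ^ n * (g (n + 1) powr (- a) / (real n + 1)) \<le> g (Suc n) powr (- a) / real (Suc n)"
          by (simp add: add.commute)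
      qed
      also have "\<dots> = (\<Sum>k\<in>{1..N}. g k powr (- a) / real k)"
        by (rule sum.reindex_bij_witness[of _ "\<lambda>k. k - 1" Suc]) auto
      also have "\<dots> \<le> A1 * g N powr (- a)" by (rule A1(2)[OF N(1)])
      finally show ?thesis by (simp add: \<Phi>_def N_def)
    qed
    have tail: "t n \<le> E * \<Phi> a s * (real N / (real n + 1)\<^sup>2)" if n: "N \<le> n" for n
    proof -
      define x where "x = (real n + 1) / real N"
      have x1: "1 \<le> x" using n N by (simp add: x_def)
      have "g N \<le> C * x ^ \<beta> * g (n + 1)"
        using g_polynomial_doubling[OF \<beta>, of N "n + 1"] n N by (simp add: x_def add.commute)
      then have "g N / (C * x ^ \<beta>) \<le> g (n + 1)"
        using C1 x1 by (simp add: field_simps)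
      then have "g (n + 1) powr (- a) \<le> (g N / (C * x ^ \<beta>)) powr (- a)"
        using C1 x1 g_pos[of N] a by (intro powr_mono2') auto
      also have "\<dots> = (C * x ^ \<beta>) powr a * g N powr (- a)"
        using C1 x1 g_pos[of N] by (simp add: powr_divide powr_minus field_simps)
      also have "\<dots> \<le> (C * x ^ \<beta>) powr 1 * g N powr (- a)"
        using C1 x1 a mult_mono[of 1 C 1 "x ^ \<beta>"] by (intro mult_right_mono powr_mono) auto
      finally have gn: "g (n + 1) powr (- a) \<le> C * x ^ \<beta> * g N powr (- a)"
        using C1 x1 by simp
      have "s ^ n \<le> exp (- (1 / (real N + 1))) ^ n"
        using s N exp_ge_add_one_self[of "- (1 / (real N + 1))"] by (intro power_mono) auto
      also have "\<dots> = exp (- (real n / (real N + 1)))" by (simp flip: exp_of_nat_mult)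
      also have "\<dots> \<le> exp (1 - x / 2)"
      proof -
        have "real n / (2 * real N) \<le> real n / (real N + 1)" using N by (intro divide_left_mono) auto
        moreover have "x / 2 = real n / (2 * real N) + 1 / (2 * real N)"
          using N by (simp add: x_def field_simps)
        moreover have "1 / (2 * real N) \<le> 1" using N by (simp add: field_simps)
        ultimately have "- (real n / (real N + 1)) \<le> 1 - x / 2" by linarith
        then show ?thesis by simp
      qed
      finally have sn: "s ^ n \<le> exp 1 * exp (- (x / 2))" by (simp flip: exp_add)
      have "t n \<le> (exp 1 * exp (- (x / 2))) * ((C * x ^ \<beta> * g N powr (- a)) / (real n + 1))"
        unfolding t_def using sn gn s by (intro mult_mono divide_right_mono) auto
      also have "\<dots> = exp 1 * C * (x ^ (\<beta> + 1) * exp (- (x / 2))) * g N powr (- a) / (x * (real n + 1))"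
      proof -
        have "(e * y) * ((c * xb * G) / k) = e * c * ((xb * x) * y) * G / (x * k)"
          if "k \<noteq> 0" for e y c xb G k :: real
          using that x1 by (simp add: field_simps)
        from this[of "real n + 1"] show ?thesis by simp
      qed
      also have "\<dots> \<le> exp 1 * C * (2 * real (\<beta> + 1)) ^ (\<beta> + 1) * g N powr (- a) / (x * (real n + 1))"
        using x1 C1 power_mult_exp_minus_half_le[of x "\<beta> + 1"]
        by (intro divide_right_mono mult_right_mono mult_left_mono) auto
      also have "\<dots> = E * \<Phi> a s * (real N / (real n + 1)\<^sup>2)"
        using N by (simp add: E_def \<Phi>_def N_def[symmetric] x_def power2_eq_square)
      finally show ?thesis .
    qed
    have "(\<Sum>n<m. t n) \<le> (\<Sum>n<max m N. t n)"
      by (rule sum_mono2) (use t0 in auto)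
    also have "\<dots> = (\<Sum>n<N. t n) + (\<Sum>n\<in>{N..<max m N}. t n)"
      by (simp add: lessThan_atLeast0 sum.atLeastLessThan_concat)
    also have "(\<Sum>n\<in>{N..<max m N}. t n) \<le> (\<Sum>n\<in>{N..<max m N}. E * \<Phi> a s * (real N / (real n + 1)\<^sup>2))"
      by (rule sum_mono) (use tail in auto)
    also have "\<dots> = E * \<Phi> a s * (\<Sum>n\<in>{N..<max m N}. real N / (real n + 1)\<^sup>2)"
      by (simp add: sum_distrib_left)
    also have "\<dots> \<le> E * \<Phi> a s * 1"
    proof (rule mult_left_mono)
      have "0 \<le> real N / real (max m N)" by simp
      then show "(\<Sum>n\<in>{N..<max m N}. real N / (real n + 1)\<^sup>2) \<le> 1"
        using sum_inverse_squares_tail_le[OF N(1), of "max m N"] by linarith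
    qed (use E \<Phi>_pos[of a s] in simp)
    finally show ?thesis using head by (simp add: t_def algebra_simps)
  qed
  show ?thesis using main A1(1) E by (intro exI[of _ "A1 + E"]) auto
qed

text \<open>The exponent n + 1 includes the factor r of the polar area element.\<close>

abbreviation I :: "real \<Rightarrow> nat \<Rightarrow> ennreal" where
  "I a n \<equiv> \<integral>\<^sup>+s. ennreal (s ^ (n + 1) * \<Phi> a s) \<partial>W"

text \<open>The sum dominating \<open>\<Phi> a\<close> turns the integral into a sum of moments g
  (n+1+k) with weights \<open>b k\<close>. For k \<le> n the moment is at most g (n+1), and
  \<open>sum_below_le\<close> bounds the weights; for larger k it is at most g (k+1), and
  \<open>sum_above_le\<close> applies with exponent 1 - a.\<close>

lemma nn_integral_\<Phi>_le:
  assumes a: "0 < a" "a < 1"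
  shows "\<exists>A>0. \<forall>n. I a n \<le> ennreal (A * g (n + 1) powr (1 - a))"
proof -
  obtain A1 where A1: "0 < A1"
    "\<And>n. 1 \<le> n \<Longrightarrow> (\<Sum>k\<in>{1..n}. g k powr (- a) / real k) \<le> A1 * g n powr (- a)"
    using sum_below_le[OF a(1)] by blast
  obtain A2 where A2: "0 < A2"
    "\<And>n m. 1 \<le> n \<Longrightarrow> (\<Sum>k\<in>{n..<m}. g k powr (1 - a) / real k) \<le> A2 * g n powr (1 - a)"
    using sum_above_le[of "1 - a"] a by auto
  define b where "b n = g (n + 1) powr (- a) / (real n + 1)" for n
  have b0: "0 \<le> b n" for n by (simp add: b_def)
  define c where "c = 2 * exp 2 * C"
  have c: "0 < c" using C1 by (simp add: c_def)
  have int_pow: "(\<integral>\<^sup>+s. ennreal (s ^ k) \<partial>W) = ennreal (g k)" for k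
    unfolding g_def
  proof (rule nn_integral_eq_integral)
    show "AE s in W. 0 \<le> s ^ k" using AE_W by eventually_elim auto
  qed simp
  have part: "(\<Sum>k<m. b k * g (n + 1 + k)) \<le> (A1 + A2) * g (n + 1) powr (1 - a)" for m n
  proof -
    define M where "M = max m (n + 1)"
    have pw: "g k powr (- a) * g k = g k powr (1 - a)" for k
      using g_pos[of k] powr_mult_base[of "g k" "- a"] by (simp add: mult.commute)
    have "(\<Sum>k<m. b k * g (n + 1 + k)) \<le> (\<Sum>k<M. b k * g (n + 1 + k))"
      by (rule sum_mono2) (use b0 g_nonneg in \<open>auto simp: M_def\<close>)
    also have "\<dots> = (\<Sum>k<n+1. b k * g (n + 1 + k)) + (\<Sum>k\<in>{n+1..<M}. b k * g (n + 1 + k))"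
      unfolding lessThan_atLeast0 by (rule sum.atLeastLessThan_concat[symmetric]) (auto simp: M_def)
    also have "(\<Sum>k<n+1. b k * g (n + 1 + k)) \<le> (\<Sum>k<n+1. b k * g (n + 1))"
      by (intro sum_mono mult_left_mono g_antimono b0) auto
    also have "\<dots> = (\<Sum>k<n+1. b k) * g (n + 1)" by (rule sum_distrib_right[symmetric])
    also have "(\<Sum>k<n+1. b k) = (\<Sum>k\<in>{1..n+1}. g k powr (- a) / real k)"
      by (rule sum.reindex_bij_witness[of _ "\<lambda>k. k - 1" Suc]) (auto simp: b_def add.commute)
    also have "\<dots> * g (n + 1) \<le> A1 * g (n + 1) powr (- a) * g (n + 1)"
      by (intro mult_right_mono A1(2) g_nonneg) auto
    also have "\<dots> = A1 * g (n + 1) powr (1 - a)" using pw[of "n + 1"] by simp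
    also have "(\<Sum>k\<in>{n+1..<M}. b k * g (n + 1 + k)) \<le> (\<Sum>k\<in>{n+1..<M}. b k * g (k + 1))"
      by (intro sum_mono mult_left_mono g_antimono b0) auto
    also have "\<dots> = (\<Sum>k\<in>{n+2..<M+1}. g k powr (1 - a) / real k)"
    proof (rule sum.reindex_bij_witness[of _ "\<lambda>k. k - 1" Suc])
      fix k assume "k \<in> {n+1..<M}"
      show "g (Suc k) powr (1 - a) / real (Suc k) = b k * g (k + 1)"
        using pw[of "Suc k"] by (simp add: b_def add.commute)
    qed auto
    also have "\<dots> \<le> A2 * g (n + 2) powr (1 - a)" by (rule A2(2)) simp
    also have "\<dots> \<le> A2 * g (n + 1) powr (1 - a)"
      using A2 a g_nonneg g_antimono[of "n + 1" "n + 2"] by (intro mult_left_mono powr_mono2) auto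
    finally show ?thesis by (simp add: algebra_simps)
  qed
  show ?thesis
  proof (intro exI conjI allI)
    show "0 < c * (A1 + A2)" using c A1 A2 by simp
    fix n
    have "I a n
        \<le> (\<integral>\<^sup>+s. (\<Sum>k. ennreal (c * b k) * ennreal (s ^ (n + 1 + k))) \<partial>W)"
    proof (rule nn_integral_mono_AE)
      show "AE s in W. ennreal (s ^ (n + 1) * \<Phi> a s) \<le> (\<Sum>k. ennreal (c * b k) * ennreal (s ^ (n + 1 + k)))"
        using AE_W
      proof eventually_elim
        case (elim s)
        then have s: "0 \<le> s" "s < 1" by auto
        have "s ^ (n + 1) * \<Phi> a s \<le> s ^ (n + 1) * (c * (\<Sum>k<step s. s ^ k * b k))"
          using \<Phi>_le_sum[OF a s] s by (intro mult_left_mono) (auto simp: b_def c_def)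
        also have "\<dots> = (\<Sum>k<step s. (c * b k) * s ^ (n + 1 + k))"
          by (simp add: sum_distrib_left power_add mult_ac)
        finally have "ennreal (s ^ (n + 1) * \<Phi> a s) \<le> ennreal (\<Sum>k<step s. (c * b k) * s ^ (n + 1 + k))"
          by (rule ennreal_leI)
        also have "\<dots> = (\<Sum>k<step s. ennreal (c * b k) * ennreal (s ^ (n + 1 + k)))"
          using s c b0 by (subst sum_ennreal[symmetric]) (auto simp: ennreal_mult)
        \<comment> \<open>The limit \<open>step s\<close> depends on s; extending the sum to all k
          makes the exchange with the integral possible.\<close>
        also have "\<dots> \<le> (\<Sum>k. ennreal (c * b k) * ennreal (s ^ (n + 1 + k)))"
          by (rule sum_le_suminf) auto
        finally show ?case .
      qed
    qed
    also have "\<dots> = (\<Sum>k. \<integral>\<^sup>+s. ennreal (c * b k) * ennreal (s ^ (n + 1 + k)) \<partial>W)"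
      by (rule nn_integral_suminf) measurable
    also have "\<dots> = (\<Sum>k. ennreal (c * b k * g (n + 1 + k)))"
    proof (rule suminf_cong)
      fix k
      have "(\<integral>\<^sup>+s. ennreal (c * b k) * ennreal (s ^ (n + 1 + k)) \<partial>W) = ennreal (c * b k) * (\<integral>\<^sup>+s. ennreal (s ^ (n + 1 + k)) \<partial>W)"
        by (rule nn_integral_cmult) measurable
      also have "\<dots> = ennreal (c * b k * g (n + 1 + k))"
        unfolding int_pow using c b0[of k] by (subst ennreal_mult'[symmetric]) auto
      finally show "(\<integral>\<^sup>+s. ennreal (c * b k) * ennreal (s ^ (n + 1 + k)) \<partial>W) = ennreal (c * b k * g (n + 1 + k))" .
    qed
    also have "\<dots> \<le> ennreal (c * (A1 + A2) * g (n + 1) powr (1 - a))"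
      unfolding suminf_eq_SUP
    proof (rule SUP_least)
      fix m
      have "(\<Sum>k<m. ennreal (c * b k * g (n + 1 + k))) = ennreal (c * (\<Sum>k<m. b k * g (n + 1 + k)))"
        using c b0 g_nonneg by (subst sum_ennreal) (auto simp: sum_distrib_left mult.assoc)
      also have "\<dots> \<le> ennreal (c * (A1 + A2) * g (n + 1) powr (1 - a))"
        using mult_left_mono[OF part[of n m], of c] c by (intro ennreal_leI) (simp add: mult.assoc)
      finally show "(\<Sum>k<m. ennreal (c * b k * g (n + 1 + k))) \<le> ennreal (c * (A1 + A2) * g (n + 1) powr (1 - a))" .
    qed
    finally show "I a n \<le> ennreal (c * (A1 + A2) * g (n + 1) powr (1 - a))" .
  qed
qed

text \<open>The bound for \<open>I a n\<close> and g (n+1) \<le> C * g (2n+1) together leave the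
  coefficients g (n+1) powr (- a) / (n+1), which \<open>sum_le_\<Phi>\<close> sums back to
  \<open>\<Phi> a x\<close>.\<close>

lemma suminf_moments_\<Phi>_le:
  assumes a: "0 < a" "a < 1"
  shows "\<exists>A>0. \<forall>x. 0 \<le> x \<longrightarrow> x < 1 \<longrightarrow>
    (\<Sum>n. ennreal (x ^ n / (g (2 * n + 1) * (real n + 1))) * I a n)
      \<le> ennreal (A * \<Phi> a x)"
proof -
  obtain A1 where A1: "0 < A1"
    "\<And>n. I a n \<le> ennreal (A1 * g (n + 1) powr (1 - a))"
    using nn_integral_\<Phi>_le[OF a] by blast
  obtain A2 where A2: "0 < A2" "\<And>s m. 0 \<le> s \<Longrightarrow> s < 1 \<Longrightarrow>
    (\<Sum>n<m. s ^ n * (g (n + 1) powr (- a) / (real n + 1))) \<le> A2 * \<Phi> a s"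
    using sum_le_\<Phi>[OF a] by blast
  show ?thesis
  proof (intro exI conjI allI impI)
    show "0 < C * A1 * A2" using C1 A1 A2 by simp
    fix x :: real assume x: "0 \<le> x" "x < 1"
    have term_le: "ennreal (x ^ n / (g (2 * n + 1) * (real n + 1))) * I a n
        \<le> ennreal (C * A1 * (x ^ n * (g (n + 1) powr (- a) / (real n + 1))))" for n
    proof -
      have "ennreal (x ^ n / (g (2 * n + 1) * (real n + 1))) * I a n
          \<le> ennreal (x ^ n / (g (2 * n + 1) * (real n + 1))) * ennreal (A1 * g (n + 1) powr (1 - a))"
        by (intro mult_left_mono A1) auto
      also have "\<dots> = ennreal (x ^ n / (g (2 * n + 1) * (real n + 1)) * (A1 * g (n + 1) powr (1 - a)))"
        using x A1 g_nonneg by (intro ennreal_mult[symmetric]) auto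
      also have "\<dots> \<le> ennreal (C * A1 * (x ^ n * (g (n + 1) powr (- a) / (real n + 1))))"
      proof (rule ennreal_leI)
        have "g (n + 1) \<le> C * g (2 * (n + 1))" by (rule g_doubling) simp
        also have "\<dots> \<le> C * g (2 * n + 1)" using C1 by (intro mult_left_mono g_antimono) auto
        finally have "g (n + 1) / g (2 * n + 1) \<le> C" using g_pos[of "2 * n + 1"] by (simp add: divide_le_eq)
        then have "x ^ n * A1 / (real n + 1) * g (n + 1) powr (- a) * (g (n + 1) / g (2 * n + 1))
            \<le> x ^ n * A1 / (real n + 1) * g (n + 1) powr (- a) * C"
          using x A1 by (intro mult_left_mono) auto
        moreover have "g (n + 1) powr (1 - a) = g (n + 1) powr (- a) * g (n + 1)"
          using g_pos[of "n + 1"] powr_mult_base[of "g (n + 1)" "- a"] by (simp add: mult.commute)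
        ultimately show "x ^ n / (g (2 * n + 1) * (real n + 1)) * (A1 * g (n + 1) powr (1 - a))
            \<le> C * A1 * (x ^ n * (g (n + 1) powr (- a) / (real n + 1)))"
          by (simp add: mult_ac)
      qed
      finally show ?thesis .
    qed
    have "(\<Sum>n. ennreal (x ^ n / (g (2 * n + 1) * (real n + 1))) * I a n)
        \<le> (\<Sum>n. ennreal (C * A1 * (x ^ n * (g (n + 1) powr (- a) / (real n + 1)))))"
      by (intro suminf_le term_le) auto
    also have "\<dots> \<le> ennreal (C * A1 * A2 * \<Phi> a x)"
      unfolding suminf_eq_SUP
    proof (rule SUP_least)
      fix m
      have "(\<Sum>n<m. ennreal (C * A1 * (x ^ n * (g (n + 1) powr (- a) / (real n + 1)))))
          = ennreal (C * A1 * (\<Sum>n<m. x ^ n * (g (n + 1) powr (- a) / (real n + 1))))"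
        using C1 A1 x by (subst sum_ennreal) (auto simp: sum_distrib_left)
      also have "\<dots> \<le> ennreal (C * A1 * A2 * \<Phi> a x)"
        using mult_left_mono[OF A2(2)[OF x, of m], of "C * A1"] C1 A1 by (intro ennreal_leI) (simp add: mult.assoc)
      finally show "(\<Sum>n<m. ennreal (C * A1 * (x ^ n * (g (n + 1) powr (- a) / (real n + 1)))))
          \<le> ennreal (C * A1 * A2 * \<Phi> a x)" .
    qed
    finally show "(\<Sum>n. ennreal (x ^ n / (g (2 * n + 1) * (real n + 1))) * I a n)
      \<le> ennreal (C * A1 * A2 * \<Phi> a x)" .
  qed
qed

end

section \<open>Schur's test\<close>

text \<open>Hoelder's inequality for the splitting of |f| into |f| * \<phi>^(-1/q) and \<phi>^(1/q)
  bounds the p-th power of the inner integral by (A * \<phi> x)^(p-1) * U x; Tonelli and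
  \<open>H2\<close> then integrate out x. Hoelder itself is obtained from Young's inequality with an
  optimised scaling.\<close>

lemma schur_test:
  fixes k :: "'a \<Rightarrow> 'a \<Rightarrow> real" and \<phi> :: "'a \<Rightarrow> real" and f :: "'a \<Rightarrow> complex"
  assumes M: "sigma_finite_measure M" and p: "1 < p"
    and k_meas [measurable]: "(\<lambda>(x, y). k x y) \<in> borel_measurable (M \<Otimes>\<^sub>M M)"
    and k0: "\<And>x y. 0 \<le> k x y"
    and [measurable]: "\<phi> \<in> borel_measurable M" "f \<in> borel_measurable M"
    and \<phi>: "\<And>x. 0 < \<phi> x" and A: "0 < A" and B: "0 < B"
    and H1: "\<And>x. x \<in> space M \<Longrightarrow> (\<integral>\<^sup>+y. ennreal (k x y * \<phi> y) \<partial>M) \<le> ennreal (A * \<phi> x)"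
    and H2: "\<And>y. y \<in> space M \<Longrightarrow>
      (\<integral>\<^sup>+x. ennreal (k x y * \<phi> x powr (p - 1)) \<partial>M) \<le> ennreal (B * \<phi> y powr (p - 1))"
  shows "(\<integral>\<^sup>+x. ennreal (cmod (LINT y|M. f y * of_real (k x y)) powr p) \<partial>M)
    \<le> ennreal (A powr (p - 1) * B) * (\<integral>\<^sup>+y. ennreal (cmod (f y) powr p) \<partial>M)"
proof -
  interpret M: sigma_finite_measure M by (rule M)
  interpret MM: pair_sigma_finite M M ..
  define q where "q = p / (p - 1)"
  have q: "1 < q" "1 / p + 1 / q = 1" "p / q = p - 1"
    using p by (auto simp: q_def field_simps)
  define U where "U x = (\<integral>\<^sup>+y. ennreal (k x y * (cmod (f y) powr p * \<phi> y powr - (p - 1))) \<partial>M)" for x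
  have pointwise: "ennreal (cmod (LINT y|M. f y * of_real (k x y)) powr p)
      \<le> ennreal ((A * \<phi> x) powr (p - 1)) * U x" if x: "x \<in> space M" for x
  proof -
    define a where "a = cmod (LINT y|M. f y * of_real (k x y))"
    define V where "V = A * \<phi> x"
    have V: "0 < V" using A \<phi> by (simp add: V_def)
    have [measurable]: "k x \<in> borel_measurable M"
      using measurable_Pair2[OF k_meas x] by simp
    have a_le: "ennreal a \<le> (\<integral>\<^sup>+y. ennreal (k x y * cmod (f y)) \<partial>M)"
    \<comment> \<open>Without integrability the Bochner integral is 0 by convention, and the bound
      is trivial.\<close>
    proof (cases "integrable M (\<lambda>y. f y * of_real (k x y))")
      case True
      from integral_norm_bound_ennreal[OF True] show ?thesis
        using k0 by (simp add: a_def norm_mult mult.commute)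
    qed (simp add: a_def not_integrable_integral_eq)
    \<comment> \<open>Stated for every positive finite upper bound \<open>u\<close>, since \<tau>
      divides by \<open>u\<close> and \<open>U x\<close> may vanish; \<open>u\<close> is let down to
      \<open>U x\<close> afterwards.\<close>
    have key: "a powr p \<le> V powr (p - 1) * u" if u: "0 < u" "U x \<le> ennreal u" for u
    proof -
      \<comment> \<open>The scaling for which the two terms of Young's inequality become 1/p and 1/q
        times the same quantity V powr (1/q) * u powr (1/p).\<close>
      define \<tau> where "\<tau> = (V / u) powr (1 / (p * q))"
      have \<tau>: "0 < \<tau>" using V u by (simp add: \<tau>_def)
      have young: "cmod (f y) \<le> \<tau> powr p / p * (cmod (f y) powr p * \<phi> y powr - (p - 1)) + \<tau> powr (- q) / q * \<phi> y" for y
      proof -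
        have "(\<tau> * cmod (f y) * \<phi> y powr (- (1 / q))) * (\<phi> y powr (1 / q) / \<tau>)
          \<le> (\<tau> * cmod (f y) * \<phi> y powr (- (1 / q))) powr p / p + (\<phi> y powr (1 / q) / \<tau>) powr q / q"
          using \<tau> by (intro Youngs_inequality p q) auto
        also have "(\<tau> * cmod (f y) * \<phi> y powr (- (1 / q))) powr p
            = \<tau> powr p * (cmod (f y) powr p * \<phi> y powr - (p - 1))"
          using \<tau> q(3) by (simp add: powr_mult powr_powr)
        also have "(\<phi> y powr (1 / q) / \<tau>) powr q = \<tau> powr (- q) * \<phi> y"
          using \<tau> q \<phi>[of y] by (simp add: powr_divide powr_powr powr_minus_divide)
        also have "(\<tau> * cmod (f y) * \<phi> y powr (- (1 / q))) * (\<phi> y powr (1 / q) / \<tau>) = cmod (f y)"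
          using \<tau> \<phi>[of y] by (simp add: powr_minus field_simps)
        finally show ?thesis by simp
      qed
      have "ennreal a \<le> (\<integral>\<^sup>+y. ennreal (k x y * cmod (f y)) \<partial>M)" by (rule a_le)
      also have "\<dots> \<le> (\<integral>\<^sup>+y. ennreal (\<tau> powr p / p) * ennreal (k x y * (cmod (f y) powr p * \<phi> y powr - (p - 1)))
          + ennreal (\<tau> powr (- q) / q) * ennreal (k x y * \<phi> y) \<partial>M)"
      proof (rule nn_integral_mono)
        fix y
        have "k x y * cmod (f y) \<le> k x y * (\<tau> powr p / p * (cmod (f y) powr p * \<phi> y powr - (p - 1)) + \<tau> powr (- q) / q * \<phi> y)"
          by (intro mult_left_mono young k0)
        also have "\<dots> = \<tau> powr p / p * (k x y * (cmod (f y) powr p * \<phi> y powr - (p - 1))) + \<tau> powr (- q) / q * (k x y * \<phi> y)"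
          by (simp add: algebra_simps)
        finally have "ennreal (k x y * cmod (f y)) \<le> ennreal (\<tau> powr p / p * (k x y * (cmod (f y) powr p * \<phi> y powr - (p - 1)))
            + \<tau> powr (- q) / q * (k x y * \<phi> y))"
          by (rule ennreal_leI)
        also have "\<dots> = ennreal (\<tau> powr p / p) * ennreal (k x y * (cmod (f y) powr p * \<phi> y powr - (p - 1)))
          + ennreal (\<tau> powr (- q) / q) * ennreal (k x y * \<phi> y)"
        proof -
          have lin: "ennreal (\<alpha> * X + \<beta> * Y) = ennreal \<alpha> * ennreal X + ennreal \<beta> * ennreal Y"
            if "0 \<le> \<alpha>" "0 \<le> X" "0 \<le> \<beta>" "0 \<le> Y" for \<alpha> X \<beta> Y :: real
            using that by (simp add: ennreal_mult)
          show ?thesis by (rule lin) (use k0[of x y] p q \<phi>[of y] in auto)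
        qed
        finally show "ennreal (k x y * cmod (f y)) \<le> \<dots>" .
      qed
      also have "\<dots> = ennreal (\<tau> powr p / p) * U x + ennreal (\<tau> powr (- q) / q) * (\<integral>\<^sup>+y. ennreal (k x y * \<phi> y) \<partial>M)"
        unfolding U_def by (subst nn_integral_add) (auto simp: nn_integral_cmult)
      also have "\<dots> \<le> ennreal (\<tau> powr p / p) * ennreal u + ennreal (\<tau> powr (- q) / q) * ennreal V"
        unfolding V_def by (intro add_mono mult_left_mono u H1 x) auto
      also have "\<dots> = ennreal (\<tau> powr p / p * u + \<tau> powr (- q) / q * V)"
        using p q u V by (simp add: ennreal_mult'[symmetric] less_imp_le flip: ennreal_plus)
      finally have "a \<le> \<tau> powr p / p * u + \<tau> powr (- q) / q * V"
        using p q u V by (subst (asm) ennreal_le_iff) (auto intro!: add_nonneg_nonneg mult_nonneg_nonneg)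
      also have "\<tau> powr p / p * u = (1 / p) * (V powr (1 / q) * u powr (1 / p))"
      proof -
        have "\<tau> powr p = (V / u) powr (1 / q)" using p by (simp add: \<tau>_def powr_powr)
        then have "\<tau> powr p * (u powr (1 / p) * u powr (1 / q)) = V powr (1 / q) * u powr (1 / p)"
          using V u by (simp add: powr_divide)
        moreover have "u powr (1 / p) * u powr (1 / q) = u" using u q(2) by (simp flip: powr_add)
        ultimately have "\<tau> powr p * u = V powr (1 / q) * u powr (1 / p)" by simp
        then show ?thesis by simp
      qed
      also have "\<tau> powr (- q) / q * V = (1 / q) * (V powr (1 / q) * u powr (1 / p))"
      proof -
        have "\<tau> powr (- q) = (V / u) powr (- (1 / p))" using q p by (simp add: \<tau>_def powr_powr)
        then have "\<tau> powr (- q) * (V powr (1 / p) * V powr (1 / q)) = V powr (1 / q) * u powr (1 / p)"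
          using V u by (simp add: powr_divide powr_minus_divide)
        moreover have "V powr (1 / p) * V powr (1 / q) = V" using V q(2) by (simp flip: powr_add)
        ultimately have "\<tau> powr (- q) * V = V powr (1 / q) * u powr (1 / p)" by simp
        then show ?thesis by simp
      qed
      also have "(1 / p) * (V powr (1 / q) * u powr (1 / p)) + (1 / q) * (V powr (1 / q) * u powr (1 / p))
          = V powr (1 / q) * u powr (1 / p)"
        using q(2) by (simp only: distrib_right[symmetric] mult_1_left)
      finally have "a powr p \<le> (V powr (1 / q) * u powr (1 / p)) powr p"
        using p by (intro powr_mono2) (auto simp: a_def)
      also have "\<dots> = V powr (p - 1) * u"
        using p V u q(3) by (simp add: powr_mult powr_powr)
      finally show ?thesis .
    qed
    have "ennreal (a powr p) \<le> ennreal (V powr (p - 1)) * U x"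
    proof (cases "U x")
      case (real u0)
      have Vp: "0 < V powr (p - 1)" using V by simp
      have "a powr p / V powr (p - 1) \<le> u0"
      proof (rule dense_ge)
        fix u assume "u0 < u"
        then have "a powr p \<le> V powr (p - 1) * u" using real by (intro key) auto
        then show "a powr p / V powr (p - 1) \<le> u" using Vp by (simp add: field_simps)
      qed
      then have "a powr p \<le> V powr (p - 1) * u0" using Vp by (simp add: field_simps)
      then show ?thesis using real by (simp add: ennreal_mult'[symmetric] ennreal_leI)
    next
      case top
      then show ?thesis using V by (simp add: ennreal_mult_top)
    qed
    then show ?thesis by (simp add: a_def V_def)
  qed
  have k_swap [measurable]: "(\<lambda>(y, x). k x y) \<in> borel_measurable (M \<Otimes>\<^sub>M M)"
    using measurable_compose[OF measurable_pair_swap' k_meas] by (simp add: split_beta')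
  define F where "F y = cmod (f y) powr p * \<phi> y powr - (p - 1)" for y
  have [measurable]: "F \<in> borel_measurable M" unfolding F_def by measurable
  have F0: "0 \<le> F y" for y by (simp add: F_def)
  have "(\<integral>\<^sup>+x. ennreal (cmod (LINT y|M. f y * of_real (k x y)) powr p) \<partial>M)
      \<le> (\<integral>\<^sup>+x. ennreal ((A * \<phi> x) powr (p - 1)) * U x \<partial>M)"
    by (rule nn_integral_mono) (rule pointwise)
  also have "\<dots> = (\<integral>\<^sup>+x. (\<integral>\<^sup>+y. ennreal ((A * \<phi> x) powr (p - 1)) * ennreal (k x y * F y) \<partial>M) \<partial>M)"
  proof (rule nn_integral_cong)
    fix x assume x: "x \<in> space M"
    have [measurable]: "k x \<in> borel_measurable M"
      using measurable_Pair2[OF k_meas x] by simp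
    show "ennreal ((A * \<phi> x) powr (p - 1)) * U x = (\<integral>\<^sup>+y. ennreal ((A * \<phi> x) powr (p - 1)) * ennreal (k x y * F y) \<partial>M)"
      unfolding U_def F_def by (rule nn_integral_cmult[symmetric]) measurable
  qed
  also have "\<dots> = (\<integral>\<^sup>+y. (\<integral>\<^sup>+x. ennreal ((A * \<phi> x) powr (p - 1)) * ennreal (k x y * F y) \<partial>M) \<partial>M)"
    by (rule MM.Fubini'[symmetric]) measurable
  also have "\<dots> \<le> (\<integral>\<^sup>+y. ennreal (A powr (p - 1) * B) * ennreal (cmod (f y) powr p) \<partial>M)"
  proof (rule nn_integral_mono)
    fix y assume y: "y \<in> space M"
    have [measurable]: "(\<lambda>x. k x y) \<in> borel_measurable M"
      using measurable_Pair2[OF k_swap y] by simp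
    have "(\<integral>\<^sup>+x. ennreal ((A * \<phi> x) powr (p - 1)) * ennreal (k x y * F y) \<partial>M)
        = (\<integral>\<^sup>+x. ennreal (A powr (p - 1) * F y) * ennreal (k x y * \<phi> x powr (p - 1)) \<partial>M)"
      using A \<phi> k0 F0 by (intro nn_integral_cong) (simp add: powr_mult less_imp_le ennreal_mult'[symmetric] mult_ac)
    also have "\<dots> = ennreal (A powr (p - 1) * F y) * (\<integral>\<^sup>+x. ennreal (k x y * \<phi> x powr (p - 1)) \<partial>M)"
      by (rule nn_integral_cmult) measurable
    also have "\<dots> \<le> ennreal (A powr (p - 1) * F y) * ennreal (B * \<phi> y powr (p - 1))"
      by (intro mult_left_mono H2 y) auto
    also have "\<dots> = ennreal (A powr (p - 1) * B * (F y * \<phi> y powr (p - 1)))"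
      using F0[of y] B by (subst ennreal_mult[symmetric]) (auto simp: mult_ac)
    also have "F y * \<phi> y powr (p - 1) = cmod (f y) powr p"
      using \<phi>[of y] by (simp add: F_def mult.assoc flip: powr_add)
    also have "ennreal (A powr (p - 1) * B * cmod (f y) powr p) = ennreal (A powr (p - 1) * B) * ennreal (cmod (f y) powr p)"
      using B by (intro ennreal_mult) auto
    finally show "(\<integral>\<^sup>+x. ennreal ((A * \<phi> x) powr (p - 1)) * ennreal (k x y * F y) \<partial>M)
      \<le> ennreal (A powr (p - 1) * B) * ennreal (cmod (f y) powr p)" .
  qed
  also have "\<dots> = ennreal (A powr (p - 1) * B) * (\<integral>\<^sup>+y. ennreal (cmod (f y) powr p) \<partial>M)"
    by (rule nn_integral_cmult) measurable
  finally show ?thesis .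
qed

section \<open>The maximal projection\<close>

text \<open>With \<open>w\<close> equal to zero outside [0,1), integrals over the whole line replace
  those over [0,1).\<close>

locale doubling_weight = doubling_measure "density lborel (\<lambda>r. ennreal (w r))" C for w :: "real \<Rightarrow> real" and C +
  assumes w_measurable [measurable]: "w \<in> borel_measurable borel"
    and w_nonneg: "\<And>r. 0 \<le> w r"
    and w_zero: "\<And>r. r \<notin> {0..<1} \<Longrightarrow> w r = 0"
begin

abbreviation W :: "real measure" where "W \<equiv> density lborel (\<lambda>r. ennreal (w r))"

definition q :: "nat \<Rightarrow> real" where "q n = 1 / g (2 * n + 1)"
definition K :: "complex \<Rightarrow> complex" where "K u = (\<Sum>n. of_real (q n) * u ^ n)"
definition k :: "complex \<Rightarrow> complex \<Rightarrow> real" where "k z \<zeta> = cmod (K (cnj z * \<zeta>)) / 2"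
definition M :: "complex measure" where "M = density disc_area (\<lambda>z. ennreal (w (cmod z)))"

lemma q_pos: "0 < q n"
  by (simp add: q_def g_pos)

lemma q_nonneg: "0 \<le> q n"
  by (rule less_imp_le[OF q_pos])

lemma obtain_regular:
  obtains B where "0 \<le> B" "\<And>n. \<bar>q (n + 1) - q n\<bar> \<le> B * q n / (real n + 1)"
    "\<And>n. \<bar>q (n + 2) - 2 * q (n + 1) + q n\<bar> \<le> B * q n / (real n + 1)\<^sup>2"
    "\<And>m n. m \<le> 2 * n + 1 \<Longrightarrow> q m \<le> B * q n"
proof -
  obtain B where B: "\<And>n. \<bar>q (n + 1) - q n\<bar> \<le> B * q n / (real n + 1)"
    "\<And>n. \<bar>q (n + 2) - 2 * q (n + 1) + q n\<bar> \<le> B * q n / (real n + 1)\<^sup>2"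
    "\<And>m n. m \<le> 2 * n + 1 \<Longrightarrow> q m \<le> B * q n"
    using inverse_odd_moments_regular unfolding q_def by blast
  have "0 < B * q 0" using B(3)[of 0 0] q_pos[of 0] by linarith
  then have "0 \<le> B" using q_pos[of 0] by (simp add: zero_less_mult_iff)
  then show thesis using that B by blast
qed

lemma summable_q: "0 \<le> x \<Longrightarrow> x < 1 \<Longrightarrow> summable (\<lambda>n. q n * x ^ n)"
  using obtain_regular summable_mult_power_of_regular[of q, OF q_pos] by metis

lemma summable_K:
  assumes "cmod u < 1"
  shows "summable (\<lambda>n. of_real (q n) * u ^ n)"
  by (rule summable_comparison_test[OF _ summable_q[OF norm_ge_zero assms]])
     (use q_nonneg in \<open>auto simp: norm_mult norm_power\<close>)

abbreviation circ :: "real \<Rightarrow> ennreal" where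
  "circ x \<equiv> \<integral>\<^sup>+t. ennreal (cmod (K (of_real x * cis t))) * indicator {0..<2*pi} t \<partial>lborel"

lemma K_measurable [measurable]: "K \<in> borel_measurable borel"
  unfolding K_def by measurable

text \<open>The pointwise bound for series with regular coefficients is integrated term by term; the
  weight of index n contributes at most 2*pi^2/(n+1).\<close>

lemma circle_integral_K_le:
  "\<exists>A>0. \<forall>x. 0 \<le> x \<longrightarrow> x < 1 \<longrightarrow>
    circ x
      \<le> (\<Sum>n. ennreal (A * (x ^ n / (g (2 * n + 1) * (real n + 1)))))"
proof -
  obtain B where B: "0 \<le> B" "\<And>n. \<bar>q (n + 1) - q n\<bar> \<le> B * q n / (real n + 1)"
    "\<And>n. \<bar>q (n + 2) - 2 * q (n + 1) + q n\<bar> \<le> B * q n / (real n + 1)\<^sup>2"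
    "\<And>m n. m \<le> 2 * n + 1 \<Longrightarrow> q m \<le> B * q n"
    using obtain_regular by blast
  define D where "D = 10 + 20 * B * (1 + B) + 2 * B"
  have D: "0 < D" unfolding D_def using B(1) by (intro add_pos_nonneg) auto
  show ?thesis
  proof (intro exI conjI allI impI)
    show "0 < D * (2 * pi\<^sup>2)" using D by simp
    fix x :: real assume x: "0 \<le> x" "x < 1"
    define v where "v n t = 1 / (1 + ((real n + 1) * cmod (1 - of_real x * cis t))\<^sup>2)" for n t
    have v: "0 \<le> v n t" "v n t \<le> 1" for n t
      by (auto simp: v_def intro!: divide_nonneg_pos add_pos_nonneg) (simp add: divide_le_eq add_pos_nonneg)
    have [measurable]: "cis \<in> borel \<rightarrow>\<^sub>M borel"
      by (intro borel_measurable_continuous_onI continuous_intros)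
    have [measurable]: "v n \<in> borel_measurable borel" for n
      unfolding v_def by measurable
    have "ennreal (cmod (K (of_real x * cis t))) \<le> (\<Sum>n. ennreal (D * (q n * x ^ n)) * ennreal (v n t))" for t
    proof -
      have sm: "summable (\<lambda>n. q n * x ^ n * v n t)"
      proof (rule summable_comparison_test[OF _ summable_q[OF x]], intro exI allI impI)
        fix n
        have "q n * x ^ n * v n t \<le> q n * x ^ n * 1"
          using v x q_nonneg by (intro mult_left_mono) auto
        then show "norm (q n * x ^ n * v n t) \<le> q n * x ^ n"
          using v[of n t] x q_nonneg[of n] by simp
      qed
      have "cmod (K (of_real x * cis t)) \<le> D * (\<Sum>n. q n * cmod (of_real x * cis t) ^ n
          * (1 / (1 + ((real n + 1) * cmod (1 - of_real x * cis t))\<^sup>2)))"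
        unfolding K_def D_def
        by (rule regular_power_series_bound[OF q_pos B(2,3,4)]) (use x in \<open>auto simp: norm_mult\<close>)
      also have "\<dots> = D * (\<Sum>n. q n * x ^ n * v n t)"
        using x by (simp add: norm_mult v_def)
      also have "\<dots> = (\<Sum>n. D * (q n * x ^ n * v n t))" by (rule suminf_mult[OF sm, symmetric])
      finally have "ennreal (cmod (K (of_real x * cis t))) \<le> ennreal (\<Sum>n. D * (q n * x ^ n * v n t))"
        by (rule ennreal_leI)
      also have "\<dots> = (\<Sum>n. ennreal (D * (q n * x ^ n * v n t)))"
        using D x v q_nonneg by (intro suminf_ennreal2[symmetric] summable_mult sm) auto
      also have "\<dots> = (\<Sum>n. ennreal (D * (q n * x ^ n)) * ennreal (v n t))"
        using D x v q_nonneg by (subst ennreal_mult[symmetric]) (auto simp: mult.assoc)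
      finally show ?thesis .
    qed
    then have "circ x
        \<le> (\<integral>\<^sup>+t. (\<Sum>n. ennreal (D * (q n * x ^ n)) * (ennreal (v n t) * indicator {0..<2*pi} t)) \<partial>lborel)"
      by (intro nn_integral_mono) (auto simp: indicator_def)
    also have "\<dots> = (\<Sum>n. \<integral>\<^sup>+t. ennreal (D * (q n * x ^ n)) * (ennreal (v n t) * indicator {0..<2*pi} t) \<partial>lborel)"
      by (rule nn_integral_suminf) measurable
    also have "\<dots> \<le> (\<Sum>n. ennreal (D * (2 * pi\<^sup>2) * (x ^ n / (g (2 * n + 1) * (real n + 1)))))"
    proof (rule suminf_le)
      fix n
      have "(\<integral>\<^sup>+t. ennreal (D * (q n * x ^ n)) * (ennreal (v n t) * indicator {0..<2*pi} t) \<partial>lborel)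
          = ennreal (D * (q n * x ^ n)) * (\<integral>\<^sup>+t\<in>{0..<2*pi}. ennreal (v n t) \<partial>lborel)"
        by (rule nn_integral_cmult) measurable
      also have "\<dots> \<le> ennreal (D * (q n * x ^ n)) * ennreal (2 * pi\<^sup>2 / (real n + 1))"
        unfolding v_def by (intro mult_left_mono nn_integral_circle_one_minus_bound x) auto
      also have "\<dots> = ennreal (D * (q n * x ^ n) * (2 * pi\<^sup>2 / (real n + 1)))"
        using D x q_nonneg by (intro ennreal_mult[symmetric]) auto
      also have "D * (q n * x ^ n) * (2 * pi\<^sup>2 / (real n + 1)) = D * (2 * pi\<^sup>2) * (x ^ n / (g (2 * n + 1) * (real n + 1)))"
        by (simp add: q_def)
      finally show "(\<integral>\<^sup>+t. ennreal (D * (q n * x ^ n)) * (ennreal (v n t) * indicator {0..<2*pi} t) \<partial>lborel)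
        \<le> ennreal (D * (2 * pi\<^sup>2) * (x ^ n / (g (2 * n + 1) * (real n + 1))))" .
    qed auto
    finally show "circ x
      \<le> (\<Sum>n. ennreal (D * (2 * pi\<^sup>2) * (x ^ n / (g (2 * n + 1) * (real n + 1)))))" .
  qed
qed

text \<open>Hardy's inequality for the coefficients q n * x^n. The smaller radius \<open>y\<close>
  provides one lower bound valid for all circles of radius at least \<open>y\<close>, as required on
  an annulus.\<close>

lemma circle_integral_K_ge:
  assumes x: "0 \<le> y" "y \<le> x" "x < 1"
  shows "ennreal (2 * (\<Sum>n<N. y ^ n / ((real n + 1) * g (2 * n + 1))))
    \<le> circ x"
proof -
  have x0: "0 \<le> x" using x by simp
  have nn: "0 \<le> q n * x ^ n" for n using q_nonneg x0 by simp
  have sm: "summable (\<lambda>n. q n * x ^ n / (real n + 1))"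
  proof (rule summable_comparison_test[OF _ summable_q[OF x0 x(3)]], intro exI allI impI)
    show "norm (q n * x ^ n / (real n + 1)) \<le> q n * x ^ n" for n
      using divide_left_mono[of 1 "real n + 1" "q n * x ^ n"] nn[of n]
      by (subst real_norm_def, subst abs_of_nonneg) auto
  qed
  have "(\<Sum>n<N. y ^ n / ((real n + 1) * g (2 * n + 1))) \<le> (\<Sum>n<N. q n * x ^ n / (real n + 1))"
  proof (rule sum_mono)
    fix n
    have "q n / (real n + 1) * y ^ n \<le> q n / (real n + 1) * x ^ n"
      using x q_nonneg by (intro mult_left_mono power_mono) auto
    then show "y ^ n / ((real n + 1) * g (2 * n + 1)) \<le> q n * x ^ n / (real n + 1)"
      by (simp add: q_def mult.commute)
  qed
  also have "\<dots> \<le> (\<Sum>n. q n * x ^ n / (real n + 1))"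
    by (rule sum_le_suminf[OF sm]) (use nn in auto)
  finally have "ennreal (2 * (\<Sum>n<N. y ^ n / ((real n + 1) * g (2 * n + 1))))
      \<le> ennreal (2 * (\<Sum>n. q n * x ^ n / (real n + 1)))"
    by (intro ennreal_leI) simp
  also have "\<dots> \<le> (\<integral>\<^sup>+t\<in>{0..<2*pi}. ennreal (cmod (\<Sum>n. of_real (q n * x ^ n) * cis t ^ n)) \<partial>lborel)"
    by (rule hardy_inequality[OF nn summable_q[OF x0 x(3)]])
  also have "(\<lambda>t. \<Sum>n. of_real (q n * x ^ n) * cis t ^ n) = (\<lambda>t. K (of_real x * cis t))"
    by (simp add: K_def power_mult_distrib mult.assoc)
  finally show ?thesis .
qed

section \<open>Weighted area and the kernel on it\<close>

lemma sets_M [measurable_cong]: "sets M = sets disc_area"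
  by (simp add: M_def)

lemma space_M [simp]: "space M = ball 0 1"
  by (simp add: M_def)

lemma nn_integral_M:
  assumes [measurable]: "F \<in> borel_measurable disc_area"
  shows "(\<integral>\<^sup>+z. F z \<partial>M) = (\<integral>\<^sup>+z. ennreal (w (cmod z)) * F z \<partial>disc_area)"
  unfolding M_def by (rule nn_integral_density) measurable

lemma nn_integral_W:
  assumes [measurable]: "F \<in> borel_measurable borel"
  shows "(\<integral>\<^sup>+r. F r \<partial>W) = (\<integral>\<^sup>+r. ennreal (w r) * F r \<partial>lborel)"
  by (rule nn_integral_density) measurable

lemma finite_measure_M: "finite_measure M"
proof
  have "emeasure M (space M) = (\<integral>\<^sup>+z. ennreal (w (cmod z)) * 1 \<partial>disc_area)"
    by (subst nn_integral_M[symmetric]) auto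
  also have "\<dots> = (\<integral>\<^sup>+r. ennreal (2 * r) * (ennreal (w r) * 1) * indicator {0..<1} r \<partial>lborel)"
    by (rule nn_integral_disc_radial) measurable
  also have "\<dots> \<le> (\<integral>\<^sup>+r. ennreal 2 * ennreal (w r) \<partial>lborel)"
  proof (rule nn_integral_mono)
    fix r
    show "ennreal (2 * r) * (ennreal (w r) * 1) * indicator {0..<1} r \<le> ennreal 2 * ennreal (w r)"
      by (cases "r \<in> {0..<1}") (auto intro!: mult_right_mono ennreal_leI simp del: ennreal_numeral)
  qed
  also have "\<dots> = ennreal 2 * (\<integral>\<^sup>+r. ennreal (w r) * 1 \<partial>lborel)"
    by (subst nn_integral_cmult) auto
  also have "(\<integral>\<^sup>+r. ennreal (w r) * 1 \<partial>lborel) = emeasure W UNIV"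
    by (subst nn_integral_W[symmetric]) auto
  also have "ennreal 2 * \<dots> < \<infinity>"
    by (simp add: emeasure_eq_measure ennreal_mult_less_top)
  finally show "emeasure M (space M) \<noteq> \<infinity>" by simp
qed

lemma measurable_ident_M [measurable]: "(\<lambda>z. z) \<in> M \<rightarrow>\<^sub>M borel"
  by measurable

lemma k_nonneg: "0 \<le> k z \<zeta>"
  by (simp add: k_def)

text \<open>The coefficients of \<open>K\<close> are real, so conjugating the argument conjugates
  the value.\<close>

lemma k_sym:
  assumes "cmod z < 1" "cmod \<zeta> < 1"
  shows "k z \<zeta> = k \<zeta> z"
proof -
  define u where "u = cnj z * \<zeta>"
  have u: "cmod u < 1"
    using assms mult_strict_mono[of "cmod z" 1 "cmod \<zeta>" 1] by (simp add: u_def norm_mult)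
  have "(\<lambda>n. cnj (of_real (q n) * u ^ n)) sums cnj (K u)"
    unfolding K_def sums_cnj by (rule summable_sums[OF summable_K[OF u]])
  then have "K (cnj u) = cnj (K u)"
    unfolding K_def by (simp add: sums_iff)
  then have "cmod (K (cnj u)) = cmod (K u)" by simp
  then show ?thesis by (simp add: k_def u_def mult.commute)
qed

lemma k_measurable [measurable]: "(\<lambda>(z, \<zeta>). k z \<zeta>) \<in> borel_measurable (M \<Otimes>\<^sub>M M)"
proof -
  have [measurable]: "cnj \<in> borel_measurable borel"
    by (intro borel_measurable_continuous_onI continuous_intros)
  have [measurable]: "fst \<in> M \<Otimes>\<^sub>M M \<rightarrow>\<^sub>M borel" "snd \<in> M \<Otimes>\<^sub>M M \<rightarrow>\<^sub>M borel"
    using measurable_compose[OF measurable_fst measurable_ident_M] measurable_compose[OF measurable_snd measurable_ident_M]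
    by auto
  show ?thesis unfolding k_def split_beta' by measurable
qed

lemma k_measurable2 [measurable]: "k z \<in> borel_measurable borel"
  unfolding k_def by measurable

text \<open>The bound is the series at radius |z|. It makes \<open>k z\<close> integrable over the
  finite measure \<open>M\<close>.\<close>

lemma k_bounded:
  assumes z: "z \<in> ball 0 1"
  shows "\<exists>b. \<forall>\<zeta>\<in>ball 0 1. k z \<zeta> \<le> b"
proof (intro exI ballI)
  fix \<zeta> :: complex assume \<zeta>: "\<zeta> \<in> ball 0 1"
  have bd: "cmod (of_real (q n) * (cnj z * \<zeta>) ^ n) \<le> q n * cmod z ^ n" for n
  proof -
    have "cmod z ^ n * cmod \<zeta> ^ n \<le> cmod z ^ n * 1"
      using \<zeta> by (intro mult_left_mono power_le_one) auto
    then show ?thesis using q_pos[of n] by (simp add: norm_mult norm_power power_mult_distrib)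
  qed
  have "cmod (K (cnj z * \<zeta>)) \<le> (\<Sum>n. q n * cmod z ^ n)"
    unfolding K_def by (rule norm_suminf_le[OF bd]) (use z in \<open>auto intro: summable_q\<close>)
  then show "k z \<zeta> \<le> (\<Sum>n. q n * cmod z ^ n) / 2" by (simp add: k_def)
qed

text \<open>The constant 1/(2*pi) joins 1/pi from the area element with the 1/2 in \<open>k\<close>;
  the restriction to [0,1) is hidden in \<open>w\<close>.\<close>

lemma nn_integral_k_radial:
  fixes R :: "real \<Rightarrow> ennreal"
  assumes [measurable]: "R \<in> borel_measurable borel"
  shows "(\<integral>\<^sup>+\<zeta>. ennreal (k z \<zeta>) * R (cmod \<zeta>) \<partial>M)
    = (\<integral>\<^sup>+r. ennreal (w r) * (ennreal (r / (2 * pi)) *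
        circ (cmod z * r) * R r) \<partial>lborel)"
proof -
  have "(\<integral>\<^sup>+\<zeta>. ennreal (k z \<zeta>) * R (cmod \<zeta>) \<partial>M)
      = (\<integral>\<^sup>+\<zeta>. ennreal (cmod (K (cnj z * \<zeta>))) * (ennreal (1 / 2) * ennreal (w (cmod \<zeta>)) * R (cmod \<zeta>)) \<partial>disc_area)"
  proof -
    have "ennreal (k z \<zeta>) = ennreal (cmod (K (cnj z * \<zeta>))) * ennreal (1 / 2)" for \<zeta>
      by (subst ennreal_mult[symmetric]) (auto simp: k_def)
    then show ?thesis by (subst nn_integral_M) (auto intro!: nn_integral_cong simp: mult_ac)
  qed
  also have "\<dots> = (\<integral>\<^sup>+r. ennreal (r / pi) *
      circ (cmod z * r)
        * (ennreal (1 / 2) * ennreal (w r) * R r) * indicator {0..<1} r \<partial>lborel)"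
    by (rule nn_integral_disc_polar_product) measurable
  also have "\<dots> = (\<integral>\<^sup>+r. ennreal (w r) * (ennreal (r / (2 * pi)) *
        circ (cmod z * r) * R r) \<partial>lborel)"
  proof (rule nn_integral_cong)
    fix r
    have c: "ennreal (1 / 2) * ennreal (r / pi) = ennreal (r / (2 * pi))"
      by (subst ennreal_mult'[symmetric]) auto
    show "ennreal (r / pi) *
      circ (cmod z * r)
        * (ennreal (1 / 2) * ennreal (w r) * R r) * indicator {0..<1} r
      = ennreal (w r) * (ennreal (r / (2 * pi)) *
        circ (cmod z * r) * R r)"
      unfolding c[symmetric] by (cases "r \<in> {0..<1}") (auto simp: w_zero mult_ac)
  qed
  finally show ?thesis .
qed

section \<open>Necessity: testing the projection on annuli\<close>

lemma T_le_measure_annulus: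
  assumes "1 / 2 \<le> \<rho>"
  shows "T \<rho> \<le> measure M {z \<in> space M. \<rho> \<le> cmod z}"
proof -
  interpret M: finite_measure M by (rule finite_measure_M)
  have sE: "{z \<in> space M. \<rho> \<le> cmod z} \<in> sets M" by measurable
  have "ennreal (T \<rho>) = emeasure W {\<rho>..}"
    by (simp add: T_def emeasure_eq_measure)
  also have "\<dots> = (\<integral>\<^sup>+r. ennreal (w r) * indicator {\<rho>..} r \<partial>lborel)"
    by (rule emeasure_density) auto
  also have "\<dots> \<le> (\<integral>\<^sup>+r. ennreal (2 * r) * (ennreal (w r) * indicator {\<rho>..} r) * indicator {0..<1} r \<partial>lborel)"
  proof (rule nn_integral_mono)
    fix r
    show "ennreal (w r) * indicator {\<rho>..} r \<le> ennreal (2 * r) * (ennreal (w r) * indicator {\<rho>..} r) * indicator {0..<1} r"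
    proof (cases "r \<in> {0..<1} \<and> \<rho> \<le> r")
      case True
      \<comment> \<open>On the annulus the density 2r of the modulus is at least 1, since \<rho>
        \<ge> 1/2.\<close>
      then have "1 \<le> 2 * r" using assms by simp
      then have "w r \<le> 2 * r * w r" using w_nonneg[of r] mult_right_mono[of 1 "2 * r" "w r"] by simp
      then show ?thesis using True by (simp add: ennreal_mult'[symmetric] ennreal_leI)
    qed (auto simp: w_zero indicator_def)
  qed
  also have "\<dots> = (\<integral>\<^sup>+z. ennreal (w (cmod z)) * indicator {\<rho>..} (cmod z) \<partial>disc_area)"
    by (rule nn_integral_disc_radial[symmetric]) measurable
  also have "\<dots> = (\<integral>\<^sup>+z. indicator {\<rho>..} (cmod z) \<partial>M)"
    by (rule nn_integral_M[symmetric]) measurable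
  also have "\<dots> = (\<integral>\<^sup>+z. indicator {z \<in> space M. \<rho> \<le> cmod z} z \<partial>M)"
    by (rule nn_integral_cong) (auto simp: indicator_def)
  also have "\<dots> = ennreal (measure M {z \<in> space M. \<rho> \<le> cmod z})"
    unfolding nn_integral_indicator[OF sE] by (rule M.emeasure_eq_measure)
  finally show ?thesis by simp
qed

text \<open>For two points of the annulus the product of the moduli is at least \<rho>^2, so each
  circular mean of |K| involved is at least 2 * S; the remaining radial integral of the weight is
  \<open>T \<rho>\<close>, and 2 * \<rho> \<ge> 1 absorbs the polar factor.\<close>

lemma integral_k_annulus_ge:
  assumes \<rho>: "1 / 2 \<le> \<rho>" "\<rho> < 1" and z: "\<rho> \<le> cmod z" "cmod z < 1"
  shows "T \<rho> * (\<Sum>n<N. \<rho> ^ (2 * n) / ((real n + 1) * g (2 * n + 1))) / (2 * pi)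
    \<le> (LINT \<zeta>|M. indicator {\<zeta>. \<rho> \<le> cmod \<zeta>} \<zeta> * k z \<zeta>)"
proof -
  interpret M: finite_measure M by (rule finite_measure_M)
  define S where "S = (\<Sum>n<N. \<rho> ^ (2 * n) / ((real n + 1) * g (2 * n + 1)))"
  have S0: "0 \<le> S" unfolding S_def using \<rho> g_nonneg by (intro sum_nonneg) auto
  obtain b where b: "\<forall>\<zeta>\<in>ball 0 1. k z \<zeta> \<le> b" using k_bounded[of z] z by auto
  have int: "integrable M (\<lambda>\<zeta>. indicator {\<zeta>. \<rho> \<le> cmod \<zeta>} \<zeta> * k z \<zeta>)"
  proof (rule M.integrable_const_bound[where B = b])
    show "AE \<zeta> in M. norm (indicator {\<zeta>. \<rho> \<le> cmod \<zeta>} \<zeta> * k z \<zeta>) \<le> b"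
    proof (rule AE_I2)
      fix \<zeta> assume "\<zeta> \<in> space M"
      then have "0 \<le> k z \<zeta>" "k z \<zeta> \<le> b" using b k_nonneg by auto
      then show "norm (indicator {\<zeta>. \<rho> \<le> cmod \<zeta>} \<zeta> * k z \<zeta>) \<le> b" by (auto simp: indicator_def)
    qed
  qed measurable
  have "ennreal (T \<rho> * S / (2 * pi)) \<le> ennreal (\<rho> / (2 * pi) * (2 * S)) * ennreal (T \<rho>)"
  proof -
    have "1 * (T \<rho> * S / (2 * pi)) \<le> (2 * \<rho>) * (T \<rho> * S / (2 * pi))"
      using \<rho> S0 T_nonneg[of \<rho>] by (intro mult_right_mono) auto
    then have "T \<rho> * S / (2 * pi) \<le> \<rho> / (2 * pi) * (2 * S) * T \<rho>" by (simp add: mult_ac)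
    then show ?thesis using T_nonneg[of \<rho>] by (simp add: ennreal_mult''[symmetric] ennreal_leI)
  qed
  also have "\<dots> = ennreal (\<rho> / (2 * pi) * (2 * S)) * (\<integral>\<^sup>+r. ennreal (w r) * indicator {\<rho>..} r \<partial>lborel)"
    by (subst emeasure_density[symmetric]) (auto simp: T_def emeasure_eq_measure)
  also have "\<dots> = (\<integral>\<^sup>+r. ennreal (\<rho> / (2 * pi) * (2 * S)) * (ennreal (w r) * indicator {\<rho>..} r) \<partial>lborel)"
    by (rule nn_integral_cmult[symmetric]) measurable
  also have "\<dots> \<le> (\<integral>\<^sup>+r. ennreal (w r) * (ennreal (r / (2 * pi)) *
        circ (cmod z * r)
          * indicator {\<rho>..} r) \<partial>lborel)"
  proof (rule nn_integral_mono)
    fix r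
    show "ennreal (\<rho> / (2 * pi) * (2 * S)) * (ennreal (w r) * indicator {\<rho>..} r)
      \<le> ennreal (w r) * (ennreal (r / (2 * pi)) *
        circ (cmod z * r)
          * indicator {\<rho>..} r)"
    proof (cases "r \<in> {0..<1} \<and> \<rho> \<le> r")
      case True
      have "\<rho> * \<rho> \<le> cmod z * r" using True z \<rho> by (intro mult_mono) auto
      moreover have "cmod z * r < 1" using True z mult_strict_mono[of "cmod z" 1 r 1] by simp
      ultimately have "ennreal (2 * S) \<le> circ (cmod z * r)"
        using circle_integral_K_ge[of "\<rho> * \<rho>" "cmod z * r" N] \<rho>
        by (simp add: S_def power_mult power2_eq_square)
      moreover have "ennreal (\<rho> / (2 * pi)) \<le> ennreal (r / (2 * pi))"
        using True by (intro ennreal_leI divide_right_mono) auto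
      ultimately have "ennreal (\<rho> / (2 * pi)) * ennreal (2 * S) \<le> ennreal (r / (2 * pi)) *
        circ (cmod z * r)"
        by (intro mult_mono) auto
      then have "ennreal (w r) * (ennreal (\<rho> / (2 * pi)) * ennreal (2 * S)) \<le> ennreal (w r) * (ennreal (r / (2 * pi)) *
        circ (cmod z * r))"
        by (rule mult_left_mono) simp
      moreover have "ennreal (\<rho> / (2 * pi) * (2 * S)) = ennreal (\<rho> / (2 * pi)) * ennreal (2 * S)"
        using S0 \<rho> by (intro ennreal_mult) auto
      ultimately show ?thesis using True by (simp add: mult.commute)
    qed (auto simp: w_zero indicator_def)
  qed
  also have "\<dots> = (\<integral>\<^sup>+\<zeta>. ennreal (k z \<zeta>) * indicator {\<rho>..} (cmod \<zeta>) \<partial>M)"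
    by (rule nn_integral_k_radial[symmetric]) measurable
  also have "\<dots> = (\<integral>\<^sup>+\<zeta>. ennreal (indicator {\<zeta>. \<rho> \<le> cmod \<zeta>} \<zeta> * k z \<zeta>) \<partial>M)"
    by (intro nn_integral_cong) (auto simp: indicator_def)
  also have "\<dots> = ennreal (LINT \<zeta>|M. indicator {\<zeta>. \<rho> \<le> cmod \<zeta>} \<zeta> * k z \<zeta>)"
    using k_nonneg by (intro nn_integral_eq_integral[OF int]) auto
  finally show ?thesis
    by (subst (asm) ennreal_le_iff) (auto simp: S_def k_nonneg intro!: integral_nonneg_AE)
qed

abbreviation proj :: "(complex \<Rightarrow> complex) \<Rightarrow> complex \<Rightarrow> complex" where
  "proj f z \<equiv> LINT \<zeta>|M. f \<zeta> * of_real (k z \<zeta>)"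

text \<open>The indicator of the annulus has norm m powr (1/p), and its image is at least S/(2*pi)
  on the same annulus. As m > 0, the factor m powr (1/p) cancels, leaving S \<le> 2*pi*A uniformly
  in \<rho> and N.\<close>

lemma reverse_doubling_of_bounded:
  assumes p: "0 < p"
    and bounded: "\<And>f. f \<in> borel_measurable M \<Longrightarrow> integrable M (\<lambda>z. cmod (f z) powr p) \<Longrightarrow>
      integrable M (\<lambda>z. cmod (proj f z) powr p) \<and>
      (LINT z|M. cmod (proj f z) powr p) powr (1 / p)
        \<le> A * (LINT z|M. cmod (f z) powr p) powr (1 / p)"
  shows "\<exists>K>1. \<exists>c>1. \<forall>r\<in>{0..<1}. c * T (1 - (1 - r) / K) \<le> T r"
proof (rule reverse_doubling_of_moment_sum)
  interpret M: finite_measure M by (rule finite_measure_M)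
  fix \<rho> :: real and N :: nat assume \<rho>: "1 / 2 \<le> \<rho>" "\<rho> < 1"
  define S where "S = T \<rho> * (\<Sum>n<N. \<rho> ^ (2 * n) / ((real n + 1) * g (2 * n + 1)))"
  have S0: "0 \<le> S" unfolding S_def using \<rho> g_nonneg T_nonneg
    by (intro mult_nonneg_nonneg sum_nonneg) auto
  define E where "E = {z \<in> space M. \<rho> \<le> cmod z}"
  have [measurable]: "E \<in> sets M" unfolding E_def by measurable
  have [simp]: "E \<inter> ball 0 1 = E" by (auto simp: E_def)
  define m where "m = measure M E"
  have m: "0 < m" using T_le_measure_annulus[OF \<rho>(1)] T_pos[of \<rho>] \<rho> by (simp add: m_def E_def)
  define f :: "complex \<Rightarrow> complex" where "f z = of_real (indicator {z. \<rho> \<le> cmod z} z)" for z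
  have f_meas: "f \<in> borel_measurable M" unfolding f_def by measurable
  have f_eq: "cmod (f z) powr p = indicator E z" if "z \<in> space M" for z
    using that p by (auto simp: f_def E_def indicator_def)
  have "integrable M (\<lambda>z. cmod (f z) powr p) \<longleftrightarrow> integrable M (indicator E :: complex \<Rightarrow> real)"
    by (rule Bochner_Integration.integrable_cong) (auto simp: f_eq)
  moreover have E_int [simp]: "integrable M (indicator E :: complex \<Rightarrow> real)"
    by (intro integrable_real_indicator) (auto simp: M.emeasure_eq_measure)
  ultimately have f_int: "integrable M (\<lambda>z. cmod (f z) powr p)" by simp
  have f_norm: "(LINT z|M. cmod (f z) powr p) = m"
  proof -
    have "(LINT z|M. cmod (f z) powr p) = (LINT z|M. indicator E z)"
      by (rule Bochner_Integration.integral_cong) (auto simp: f_eq)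
    then show ?thesis by (simp add: m_def)
  qed
  note bd = bounded[OF f_meas f_int]
  have lower: "(S / (2 * pi)) powr p * indicator E z \<le> cmod (proj f z) powr p" if "z \<in> space M" for z
  proof (cases "z \<in> E")
    case True
    then have z: "\<rho> \<le> cmod z" "cmod z < 1" by (auto simp: E_def)
    have "proj f z = of_real (LINT \<zeta>|M. indicator {\<zeta>. \<rho> \<le> cmod \<zeta>} \<zeta> * k z \<zeta>)"
      unfolding f_def of_real_mult[symmetric] by (rule integral_complex_of_real)
    moreover have "S / (2 * pi) \<le> (LINT \<zeta>|M. indicator {\<zeta>. \<rho> \<le> cmod \<zeta>} \<zeta> * k z \<zeta>)"
      unfolding S_def by (rule integral_k_annulus_ge[OF \<rho> z])
    ultimately have "S / (2 * pi) \<le> cmod (proj f z)" by simp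
    then have "(S / (2 * pi)) powr p \<le> cmod (proj f z) powr p" using S0 p by (intro powr_mono2) auto
    then show ?thesis using True by simp
  qed simp
  have "(S / (2 * pi)) powr p * m = (LINT z|M. (S / (2 * pi)) powr p * indicator E z)"
    by (simp add: m_def)
  also have "\<dots> \<le> (LINT z|M. cmod (proj f z) powr p)"
    by (rule integral_mono[OF _ _ lower]) (use bd in auto)
  finally have "((S / (2 * pi)) powr p * m) powr (1 / p) \<le> (LINT z|M. cmod (proj f z) powr p) powr (1 / p)"
    using p m by (intro powr_mono2) auto
  also have "\<dots> \<le> A * m powr (1 / p)" using bd f_norm by simp
  finally have "S / (2 * pi) * m powr (1 / p) \<le> A * m powr (1 / p)"
    using S0 m p by (simp add: powr_mult powr_powr)
  then have "S / (2 * pi) \<le> A" by (rule mult_right_le_imp_le) (use m in simp)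
  then show "T \<rho> * (\<Sum>n<N. \<rho> ^ (2 * n) / ((real n + 1) * g (2 * n + 1))) \<le> A * (2 * pi)"
    by (simp add: S_def divide_le_eq)
qed

end

section \<open>Sufficiency: the kernel against powers of the tail\<close>

locale regular_weight = doubling_weight w C + regular_measure "density lborel (\<lambda>r. ennreal (w r))" C L
  for w C L
begin

text \<open>Polar coordinates reduce the kernel to its circular means, which are dominated by a
  power series in |z| * r. Integrating in r term by term produces the \<open>I a n\<close>.\<close>

lemma nn_integral_k_\<Phi>_le:
  assumes a: "0 < a" "a < 1"
  shows "\<exists>A>0. \<forall>z\<in>ball 0 1. (\<integral>\<^sup>+\<zeta>. ennreal (k z \<zeta> * \<Phi> a (cmod \<zeta>)) \<partial>M) \<le> ennreal (A * \<Phi> a (cmod z))"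
proof -
  obtain A1 where A1: "0 < A1" "\<And>x. 0 \<le> x \<Longrightarrow> x < 1 \<Longrightarrow>
    circ x
      \<le> (\<Sum>n. ennreal (A1 * (x ^ n / (g (2 * n + 1) * (real n + 1)))))"
    using circle_integral_K_le by blast
  obtain A2 where A2: "0 < A2" "\<And>x. 0 \<le> x \<Longrightarrow> x < 1 \<Longrightarrow>
    (\<Sum>n. ennreal (x ^ n / (g (2 * n + 1) * (real n + 1))) *
      I a n)
      \<le> ennreal (A2 * \<Phi> a x)"
    using suminf_moments_\<Phi>_le[OF a] by blast
  define c where "c = A1 / (2 * pi)"
  have c: "0 < c" using A1 by (simp add: c_def)
  show ?thesis
  proof (intro exI conjI ballI)
    show "0 < c * A2" using c A2 by simp
    fix z :: complex assume "z \<in> ball 0 1"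
    then have z: "cmod z < 1" by simp
    define e where "e n = cmod z ^ n / (g (2 * n + 1) * (real n + 1))" for n
    have e0: "0 \<le> e n" for n using g_nonneg by (simp add: e_def)
    have "(\<integral>\<^sup>+\<zeta>. ennreal (k z \<zeta> * \<Phi> a (cmod \<zeta>)) \<partial>M) = (\<integral>\<^sup>+\<zeta>. ennreal (k z \<zeta>) * ennreal (\<Phi> a (cmod \<zeta>)) \<partial>M)"
      by (intro nn_integral_cong ennreal_mult k_nonneg \<Phi>_nonneg)
    also have "\<dots> = (\<integral>\<^sup>+r. ennreal (w r) * (ennreal (r / (2 * pi)) *
        circ (cmod z * r)
          * ennreal (\<Phi> a r)) \<partial>lborel)"
      by (rule nn_integral_k_radial) measurable
    also have "\<dots> \<le> (\<integral>\<^sup>+r. ennreal (w r) * (\<Sum>n. ennreal (c * e n) * ennreal (r ^ (n + 1) * \<Phi> a r)) \<partial>lborel)"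
    proof (rule nn_integral_mono)
      fix r
      show "ennreal (w r) * (ennreal (r / (2 * pi)) *
        circ (cmod z * r)
          * ennreal (\<Phi> a r))
        \<le> ennreal (w r) * (\<Sum>n. ennreal (c * e n) * ennreal (r ^ (n + 1) * \<Phi> a r))"
      proof (cases "r \<in> {0..<1}")
        case True
        then have r: "0 \<le> r" "r < 1" by auto
        have zr: "0 \<le> cmod z * r" "cmod z * r < 1"
          using r z mult_strict_mono[of "cmod z" 1 r 1] by auto
        have "ennreal (r / (2 * pi)) *
          circ (cmod z * r)
            * ennreal (\<Phi> a r)
          \<le> ennreal (r / (2 * pi)) * (\<Sum>n. ennreal (A1 * ((cmod z * r) ^ n / (g (2 * n + 1) * (real n + 1))))) * ennreal (\<Phi> a r)"
          by (intro mult_right_mono mult_left_mono A1 zr) auto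
        also have "\<dots> = (\<Sum>n. ennreal (r / (2 * pi)) * ennreal (A1 * ((cmod z * r) ^ n / (g (2 * n + 1) * (real n + 1)))) * ennreal (\<Phi> a r))"
          unfolding ennreal_suminf_multc ennreal_suminf_cmult ..
        also have "\<dots> = (\<Sum>n. ennreal (c * e n) * ennreal (r ^ (n + 1) * \<Phi> a r))"
        proof (rule suminf_cong)
          fix n
          have "ennreal (r / (2 * pi)) * ennreal (A1 * ((cmod z * r) ^ n / (g (2 * n + 1) * (real n + 1)))) * ennreal (\<Phi> a r)
              = ennreal (r / (2 * pi) * (A1 * ((cmod z * r) ^ n / (g (2 * n + 1) * (real n + 1)))) * \<Phi> a r)"
          proof -
            have "0 \<le> A1 * ((cmod z * r) ^ n / (g (2 * n + 1) * (real n + 1)))"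
              using r A1(1) g_nonneg by (intro mult_nonneg_nonneg divide_nonneg_nonneg zero_le_power) auto
            moreover have triple: "ennreal (x * y * t) = ennreal x * ennreal y * ennreal t" if "0 \<le> x" "0 \<le> y" "0 \<le> t" for x y t :: real
              using that by (simp add: ennreal_mult)
            ultimately show ?thesis using r \<Phi>_nonneg by (intro triple[symmetric]) auto
          qed
          also have "r / (2 * pi) * (A1 * ((cmod z * r) ^ n / (g (2 * n + 1) * (real n + 1)))) * \<Phi> a r
              = c * e n * (r ^ (n + 1) * \<Phi> a r)"
            unfolding c_def e_def power_mult_distrib by simp
          also have "ennreal \<dots> = ennreal (c * e n) * ennreal (r ^ (n + 1) * \<Phi> a r)"
            using c e0[of n] r \<Phi>_nonneg by (intro ennreal_mult) auto
          finally show "ennreal (r / (2 * pi)) * ennreal (A1 * ((cmod z * r) ^ n / (g (2 * n + 1) * (real n + 1)))) * ennreal (\<Phi> a r)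
              = ennreal (c * e n) * ennreal (r ^ (n + 1) * \<Phi> a r)" .
        qed
        finally show ?thesis by (rule mult_left_mono) simp
      qed (simp add: w_zero)
    qed
    also have "\<dots> = (\<integral>\<^sup>+r. (\<Sum>n. ennreal (c * e n) * ennreal (r ^ (n + 1) * \<Phi> a r)) \<partial>W)"
      by (rule nn_integral_W[symmetric]) measurable
    also have "\<dots> = (\<Sum>n. \<integral>\<^sup>+r. ennreal (c * e n) * ennreal (r ^ (n + 1) * \<Phi> a r) \<partial>W)"
      by (rule nn_integral_suminf) measurable
    also have "\<dots> = (\<Sum>n. ennreal c * (ennreal (e n) * I a n))"
    proof (rule suminf_cong)
      fix n
      have 1: "(\<integral>\<^sup>+r. ennreal (c * e n) * ennreal (r ^ (n + 1) * \<Phi> a r) \<partial>W)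
          = ennreal (c * e n) * I a n"
        by (rule nn_integral_cmult) measurable
      have 2: "ennreal (c * e n) = ennreal c * ennreal (e n)" using c e0[of n] by (intro ennreal_mult) auto
      show "(\<integral>\<^sup>+r. ennreal (c * e n) * ennreal (r ^ (n + 1) * \<Phi> a r) \<partial>W)
          = ennreal c * (ennreal (e n) * I a n)"
        unfolding 1 unfolding 2 mult.assoc ..
    qed
    also have "\<dots> = ennreal c * (\<Sum>n. ennreal (e n) * I a n)"
      by (rule ennreal_suminf_cmult)
    also have "\<dots> \<le> ennreal c * ennreal (A2 * \<Phi> a (cmod z))"
      unfolding e_def by (intro mult_left_mono A2) (use z in auto)
    also have "\<dots> = ennreal (c * A2 * \<Phi> a (cmod z))"
      using c by (simp add: ennreal_mult'[symmetric] mult.assoc)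
    finally show "(\<integral>\<^sup>+\<zeta>. ennreal (k z \<zeta> * \<Phi> a (cmod \<zeta>)) \<partial>M) \<le> ennreal (c * A2 * \<Phi> a (cmod z))" .
  qed
qed

lemma projection_bounded:
  assumes p: "1 < p"
  shows "\<exists>A>0. \<forall>f :: complex \<Rightarrow> complex. f \<in> borel_measurable M \<longrightarrow>
    (\<integral>\<^sup>+z. ennreal (cmod (proj f z) powr p) \<partial>M)
      \<le> ennreal A * (\<integral>\<^sup>+\<zeta>. ennreal (cmod (f \<zeta>) powr p) \<partial>M)"
proof -
  interpret M: finite_measure M by (rule finite_measure_M)
  obtain A where A: "0 < A"
    "\<And>z. z \<in> ball 0 1 \<Longrightarrow> (\<integral>\<^sup>+\<zeta>. ennreal (k z \<zeta> * \<Phi> (1 / p) (cmod \<zeta>)) \<partial>M) \<le> ennreal (A * \<Phi> (1 / p) (cmod z))"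
    using nn_integral_k_\<Phi>_le[of "1 / p"] p by auto
  obtain B where B: "0 < B"
    "\<And>z. z \<in> ball 0 1 \<Longrightarrow> (\<integral>\<^sup>+\<zeta>. ennreal (k z \<zeta> * \<Phi> ((p - 1) / p) (cmod \<zeta>)) \<partial>M) \<le> ennreal (B * \<Phi> ((p - 1) / p) (cmod z))"
    using nn_integral_k_\<Phi>_le[of "(p - 1) / p"] p by auto
  \<comment> \<open>Makes the second Schur condition an instance of the same kernel estimate, at the
    exponent (p - 1)/p.\<close>
  have pow: "\<Phi> (1 / p) s powr (p - 1) = \<Phi> ((p - 1) / p) s" for s
    by (simp add: \<Phi>_def powr_powr)
  show ?thesis
  proof (intro exI conjI allI impI)
    show "0 < A powr (p - 1) * B" using A B by simp
    fix f :: "complex \<Rightarrow> complex" assume f: "f \<in> borel_measurable M"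
    show "(\<integral>\<^sup>+z. ennreal (cmod (proj f z) powr p) \<partial>M)
      \<le> ennreal (A powr (p - 1) * B) * (\<integral>\<^sup>+\<zeta>. ennreal (cmod (f \<zeta>) powr p) \<partial>M)"
    proof (rule schur_test[where \<phi> = "\<lambda>z. \<Phi> (1 / p) (cmod z)"])
      show "sigma_finite_measure M" by (rule M.sigma_finite_measure_axioms)
      show "(\<integral>\<^sup>+z. ennreal (k z \<zeta> * \<Phi> (1 / p) (cmod z) powr (p - 1)) \<partial>M) \<le> ennreal (B * \<Phi> (1 / p) (cmod \<zeta>) powr (p - 1))"
        if "\<zeta> \<in> space M" for \<zeta>
      proof -
        have "(\<integral>\<^sup>+z. ennreal (k z \<zeta> * \<Phi> ((p - 1) / p) (cmod z)) \<partial>M)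
            = (\<integral>\<^sup>+z. ennreal (k \<zeta> z * \<Phi> ((p - 1) / p) (cmod z)) \<partial>M)"
          using that by (intro nn_integral_cong) (auto simp: k_sym[of _ \<zeta>])
        then show ?thesis using B(2)[of \<zeta>] that unfolding pow by simp
      qed
    qed (use p f A B k_nonneg \<Phi>_pos in auto)
  qed
qed

end

section \<open>From Lebesgue measurable weights to Borel profiles\<close>

lemma ex_borel_profile:
  assumes "radial_weight \<omega>"
  shows "\<exists>w. w \<in> borel_measurable borel \<and> (\<forall>r. 0 \<le> w r) \<and> (\<forall>r. r \<notin> {0..<1} \<longrightarrow> w r = 0) \<and>
    (AE r in lborel. r \<in> {0..<1} \<longrightarrow> w r = \<omega> r)"
proof -
  have "(\<lambda>r. indicator {0..<1} r *\<^sub>R \<omega> r) \<in> borel_measurable lebesgue"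
    using assms by (auto simp: radial_weight_def set_integrable_def dest: borel_measurable_integrable)
  from completion_ex_borel_measurable_real[OF this]
  obtain h where h: "h \<in> borel_measurable lborel" "AE r in lborel. indicator {0..<1} r *\<^sub>R \<omega> r = h r"
    by auto
  have [measurable]: "h \<in> borel_measurable borel" using h(1) by simp
  show ?thesis
  proof (intro exI conjI allI impI)
    \<comment> \<open>Cutting off outside [0,1) and clipping at 0 enforce everywhere what the Borel
      version \<open>h\<close> satisfies only almost everywhere.\<close>
    show "(\<lambda>r. indicator {0..<1} r * max 0 (h r)) \<in> borel_measurable borel" by measurable
    show "AE r in lborel. r \<in> {0..<1} \<longrightarrow> indicator {0..<1} r * max 0 (h r) = \<omega> r"
      using h(2)
    proof eventually_elim
      case (elim r)
      have "r \<in> {0..<1} \<Longrightarrow> 0 \<le> \<omega> r" using assms by (simp add: radial_weight_def)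
      with elim show ?case by auto
    qed
  qed auto
qed

lemma integral_lebesgue_profile:
  fixes h :: "real \<Rightarrow> real"
  assumes \<omega>: "radial_weight \<omega>" and [measurable]: "w \<in> borel_measurable borel" "h \<in> borel_measurable borel"
    and w: "\<And>r. 0 \<le> w r" "\<And>r. r \<notin> {0..<1} \<Longrightarrow> w r = 0"
    and ae: "AE r in lborel. r \<in> {0..<1} \<longrightarrow> w r = \<omega> r"
  shows "(LINT r:{0..<1}|lebesgue. h r * \<omega> r) = (LINT r|density lborel (\<lambda>r. ennreal (w r)). h r)"
proof -
  have [measurable]: "(\<lambda>r. indicator {0..<1} r *\<^sub>R \<omega> r) \<in> borel_measurable lebesgue"
    using \<omega> by (auto simp: radial_weight_def set_integrable_def dest: borel_measurable_integrable)
  have [measurable]: "h \<in> borel_measurable lebesgue" "w \<in> borel_measurable lebesgue"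
    by (simp_all add: measurable_completion)
  have "(LINT r:{0..<1}|lebesgue. h r * \<omega> r) = (LINT r|lebesgue. h r * (indicator {0..<1} r *\<^sub>R \<omega> r))"
    unfolding set_lebesgue_integral_def by (rule Bochner_Integration.integral_cong) auto
  also have "\<dots> = (LINT r|lebesgue. w r * h r)"
  proof (rule integral_cong_AE)
    show "AE r in lebesgue. h r * (indicator {0..<1} r *\<^sub>R \<omega> r) = w r * h r"
      using AE_completion[OF ae] by eventually_elim (use w in \<open>auto simp: indicator_def\<close>)
  qed measurable
  also have "\<dots> = (LINT r|lborel. w r * h r)" by (rule integral_completion) measurable
  also have "\<dots> = (LINT r|density lborel (\<lambda>r. ennreal (w r)). h r)"
    using w by (subst integral_density) auto
  finally show ?thesis .
qed

lemma tail_integral_eq_measure: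
  assumes "radial_weight \<omega>" "w \<in> borel_measurable borel" "\<And>r. 0 \<le> w r" "\<And>r. r \<notin> {0..<1} \<Longrightarrow> w r = 0"
    and "AE r in lborel. r \<in> {0..<1} \<longrightarrow> w r = \<omega> r" and r: "0 \<le> r"
  shows "tail_integral \<omega> r = measure (density lborel (\<lambda>r. ennreal (w r))) {r..}"
proof -
  have "tail_integral \<omega> r = (LINT s:{0..<1}|lebesgue. indicator {r..} s * \<omega> s)"
    unfolding tail_integral_def set_lebesgue_integral_def
    using r by (intro Bochner_Integration.integral_cong) (auto simp: indicator_def)
  also have "\<dots> = (LINT s|density lborel (\<lambda>r. ennreal (w r)). indicator {r..} s)"
    by (rule integral_lebesgue_profile) (use assms in auto)
  finally show ?thesis by simp
qed

locale weight_profile = doubling_weight w C for w C +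
  fixes \<omega> :: "real \<Rightarrow> real"
  assumes radial: "radial_weight \<omega>"
    and AE_profile: "AE r in lborel. r \<in> {0..<1} \<longrightarrow> w r = \<omega> r"
begin

lemma tail_integral_eq_T: "0 \<le> r \<Longrightarrow> tail_integral \<omega> r = T r"
  unfolding T_def
  by (rule tail_integral_eq_measure[OF radial w_measurable w_nonneg w_zero AE_profile])

lemma weight_moment_eq_g:
  assumes "0 < n"
  shows "weight_moment \<omega> (real n) = g n"
proof -
  have "weight_moment \<omega> (real n) = (LINT r:{0..<1}|lebesgue. r ^ n * \<omega> r)"
    unfolding weight_moment_def set_lebesgue_integral_def
  proof (rule Bochner_Integration.integral_cong)
    show "indicator {0..<1} r *\<^sub>R (r powr real n * \<omega> r) = indicator {0..<1} r *\<^sub>R (r ^ n * \<omega> r)" for r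
      \<comment> \<open>The exponent must be positive for agreement at r = 0:
        \<open>0 powr 0\<close> is 0, but \<open>0 ^ 0\<close> is 1.\<close>
      using assms by (cases "r = 0") (auto simp: indicator_def powr_realpow)
  qed simp
  also have "\<dots> = g n"
    unfolding g_def by (rule integral_lebesgue_profile[OF radial _ _ w_nonneg w_zero AE_profile]) auto
  finally show ?thesis .
qed

lemma cmod_bergman_kernel:
  assumes "z \<in> ball 0 1" "\<zeta> \<in> ball 0 1"
  shows "cmod (bergman_kernel \<omega> z \<zeta>) = k z \<zeta>"
proof -
  have u: "cmod (cnj z * \<zeta>) < 1"
    using assms mult_strict_mono[of "cmod z" 1 "cmod \<zeta>" 1] by (simp add: norm_mult)
  have m: "weight_moment \<omega> (2 * real n + 1) = g (2 * n + 1)" for n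
    using weight_moment_eq_g[of "2 * n + 1"] by (simp add: add.commute)
  have "bergman_kernel \<omega> z \<zeta> = (\<Sum>n. 1 / 2 * (of_real (q n) * (cnj z * \<zeta>) ^ n))"
    unfolding bergman_kernel_def m by (simp add: q_def)
  also have "\<dots> = 1 / 2 * K (cnj z * \<zeta>)"
    unfolding K_def by (rule suminf_mult[OF summable_K[OF u]])
  finally have "cmod (bergman_kernel \<omega> z \<zeta>) = cmod (1 / 2 * K (cnj z * \<zeta>))" by (rule arg_cong)
  then show ?thesis by (simp add: k_def norm_mult)
qed

lemma measurable_M_iff: "f \<in> measurable M N \<longleftrightarrow> f \<in> measurable disc_area N"
  by (simp only: measurable_cong_sets[OF sets_M refl])

lemma AE_disc_profile: "AE z in disc_area. w (cmod z) = \<omega> (cmod z)"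
  using AE_disc_area_radial[OF AE_profile] AE_space by eventually_elim auto

lemma \<omega>_measurable [measurable]: "(\<lambda>z. \<omega> (cmod z)) \<in> borel_measurable disc_area"
  by (rule borel_measurable_disc_area_AE[OF _ AE_disc_profile]) measurable

lemma
  fixes h :: "complex \<Rightarrow> real"
  assumes [measurable]: "h \<in> borel_measurable disc_area"
  shows integrable_profile: "integrable disc_area (\<lambda>z. h z * \<omega> (cmod z)) \<longleftrightarrow> integrable M h"
    and integral_profile: "(LINT z|disc_area. h z * \<omega> (cmod z)) = (LINT z|M. h z)"
proof -
  have ae: "AE z in disc_area. h z * \<omega> (cmod z) = w (cmod z) * h z"
    using AE_disc_profile by eventually_elim simp
  have "integrable disc_area (\<lambda>z. h z * \<omega> (cmod z)) \<longleftrightarrow> integrable disc_area (\<lambda>z. w (cmod z) * h z)"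
    by (rule integrable_cong_AE[OF _ _ ae]) measurable
  also have "\<dots> \<longleftrightarrow> integrable M h"
    unfolding M_def using w_nonneg by (subst integrable_density) auto
  finally show "integrable disc_area (\<lambda>z. h z * \<omega> (cmod z)) \<longleftrightarrow> integrable M h" .
  have "(LINT z|disc_area. h z * \<omega> (cmod z)) = (LINT z|disc_area. w (cmod z) * h z)"
    by (rule integral_cong_AE[OF _ _ ae]) measurable
  also have "\<dots> = (LINT z|M. h z)"
    unfolding M_def using w_nonneg by (subst integral_density) auto
  finally show "(LINT z|disc_area. h z * \<omega> (cmod z)) = (LINT z|M. h z)" .
qed

lemma projection_eq:
  assumes [measurable]: "f \<in> borel_measurable disc_area" and z: "z \<in> ball 0 1"
  shows "maximal_bergman_projection \<omega> f z = (proj f z)"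
proof -
  have "maximal_bergman_projection \<omega> f z
      = (LINT \<zeta>|disc_area. f \<zeta> * of_real (k z \<zeta>) * of_real (\<omega> (cmod \<zeta>)))"
    unfolding maximal_bergman_projection_def
    by (rule Bochner_Integration.integral_cong) (use z in \<open>auto simp: cmod_bergman_kernel\<close>)
  also have "\<dots> = (LINT \<zeta>|disc_area. w (cmod \<zeta>) *\<^sub>R (f \<zeta> * of_real (k z \<zeta>)))"
  proof (rule integral_cong_AE)
    show "AE \<zeta> in disc_area. f \<zeta> * of_real (k z \<zeta>) * of_real (\<omega> (cmod \<zeta>))
        = w (cmod \<zeta>) *\<^sub>R (f \<zeta> * of_real (k z \<zeta>))"
      using AE_disc_profile by eventually_elim (simp add: scaleR_conv_of_real)
  qed measurable
  also have "\<dots> = (proj f z)"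
    unfolding M_def using w_nonneg by (subst integral_density) auto
  finally show ?thesis .
qed

lemma Lp_space_iff: "f \<in> Lp_space \<omega> p \<longleftrightarrow> f \<in> borel_measurable disc_area \<and> integrable M (\<lambda>z. cmod (f z) powr p)"
  unfolding Lp_space_def by (auto simp: integrable_profile)

lemma Lp_norm_eq: "f \<in> borel_measurable disc_area \<Longrightarrow> Lp_norm \<omega> p f = (LINT z|M. cmod (f z) powr p) powr (1 / p)"
  unfolding Lp_norm_def by (subst integral_profile) auto

text \<open>Measurability in z is that of an integral with a parameter over the sigma-finite
  \<open>M\<close>. Agreement of the two operators on the disc suffices, as the disc is the whole
  space of the measure.\<close>

lemma projection_measurable:
  assumes f: "f \<in> borel_measurable disc_area"
  shows "maximal_bergman_projection \<omega> f \<in> borel_measurable disc_area"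
proof -
  interpret M: finite_measure M by (rule finite_measure_M)
  have [measurable]: "f \<in> borel_measurable M" using f by (simp only: measurable_M_iff)
  have "(\<lambda>(z, \<zeta>). f \<zeta> * of_real (k z \<zeta>)) \<in> borel_measurable (M \<Otimes>\<^sub>M M)"
    by measurable
  then have "proj f \<in> borel_measurable M"
    by (rule M.borel_measurable_lebesgue_integral)
  then have "proj f \<in> borel_measurable disc_area"
    by (simp only: measurable_M_iff)
  then show ?thesis
    by (subst measurable_cong[where g = "proj f"])
       (use f in \<open>auto simp: projection_eq\<close>)
qed

lemma
  assumes f: "f \<in> borel_measurable disc_area"
  shows integrable_projection_iff: "integrable M (\<lambda>z. cmod (maximal_bergman_projection \<omega> f z) powr p)
      \<longleftrightarrow> integrable M (\<lambda>z. cmod (proj f z) powr p)"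
    and integral_projection_eq: "(LINT z|M. cmod (maximal_bergman_projection \<omega> f z) powr p)
      = (LINT z|M. cmod (proj f z) powr p)"
  by (rule Bochner_Integration.integrable_cong Bochner_Integration.integral_cong; simp add: projection_eq[OF f])+

section \<open>The two implications\<close>

lemma D_check_if_bounded:
  assumes p: "1 < p" and bd: "bounded_on_Lp \<omega> p (maximal_bergman_projection \<omega>)"
  shows "\<omega> \<in> D_check"
proof -
  obtain A where A: "\<And>f. f \<in> Lp_space \<omega> p \<Longrightarrow> maximal_bergman_projection \<omega> f \<in> Lp_space \<omega> p \<and>
      Lp_norm \<omega> p (maximal_bergman_projection \<omega> f) \<le> A * Lp_norm \<omega> p f"
    using bd unfolding bounded_on_Lp_def by blast
  have "\<exists>K>1. \<exists>c>1. \<forall>r\<in>{0..<1}. c * T (1 - (1 - r) / K) \<le> T r"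
  proof (rule reverse_doubling_of_bounded)
    fix f :: "complex \<Rightarrow> complex"
    assume "f \<in> borel_measurable M" and i: "integrable M (\<lambda>z. cmod (f z) powr p)"
    then have f: "f \<in> borel_measurable disc_area" by (simp only: measurable_M_iff)
    have "f \<in> Lp_space \<omega> p" using f i by (simp add: Lp_space_iff)
    from A[OF this] show "integrable M (\<lambda>z. cmod (proj f z) powr p) \<and>
      (LINT z|M. cmod (proj f z) powr p) powr (1 / p)
        \<le> A * (LINT z|M. cmod (f z) powr p) powr (1 / p)"
      using f projection_measurable[OF f]
      by (simp add: Lp_space_iff Lp_norm_eq integrable_projection_iff integral_projection_eq)
  qed (use p in simp)
  then obtain K c where K: "1 < K" "1 < c" "\<And>r. r \<in> {0..<1} \<Longrightarrow> c * T (1 - (1 - r) / K) \<le> T r"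
    by blast
  have rev: "c * tail_integral \<omega> (1 - (1 - r) / K) \<le> tail_integral \<omega> r" if r: "r \<in> {0..<1}" for r
  proof -
    \<comment> \<open>Keeps the point 1 - (1 - r)/K nonnegative, where \<open>tail_integral\<close>
      and \<open>T\<close> agree.\<close>
    have "(1 - r) / K \<le> 1" using r K by (simp add: divide_le_eq)
    then show ?thesis using K(3)[OF r] r by (simp add: tail_integral_eq_T)
  qed
  show ?thesis
    unfolding D_check_def using radial K(1,2) rev by (simp only: mem_Collect_eq) blast
qed

lemma bounded_if_D_check:
  assumes p: "1 < p" and chk: "\<omega> \<in> D_check"
  shows "bounded_on_Lp \<omega> p (maximal_bergman_projection \<omega>)"
proof -
  obtain K c where K: "1 < K" "1 < c"
    "\<And>r. r \<in> {0..<1} \<Longrightarrow> c * tail_integral \<omega> (1 - (1 - r) / K) \<le> tail_integral \<omega> r"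
    using chk unfolding D_check_def by auto
  have "\<exists>L\<ge>2. \<forall>n\<ge>1. g (L * n) \<le> g n / 2"
  proof (rule g_reverse_doubling[OF K(1,2)])
    fix r :: real assume r: "0 \<le> r" "r < 1"
    have "(1 - r) / K \<le> 1" using r K by (simp add: divide_le_eq)
    then show "c * T (1 - (1 - r) / K) \<le> T r"
      using K(3)[of r] r by (simp add: tail_integral_eq_T)
  qed
  then obtain L where L: "2 \<le> L" "\<And>n. 1 \<le> n \<Longrightarrow> g (L * n) \<le> g n / 2" by blast
  interpret regular_weight w C L
    by unfold_locales (use L in auto)
  obtain A where A: "0 < A" "\<And>f :: complex \<Rightarrow> complex. f \<in> borel_measurable M \<Longrightarrow>
    (\<integral>\<^sup>+z. ennreal (cmod (proj f z) powr p) \<partial>M)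
      \<le> ennreal A * (\<integral>\<^sup>+\<zeta>. ennreal (cmod (f \<zeta>) powr p) \<partial>M)"
    using projection_bounded[OF p] by blast
  show ?thesis
    unfolding bounded_on_Lp_def
  proof (intro exI ballI)
    fix f assume "f \<in> Lp_space \<omega> p"
    then have f: "f \<in> borel_measurable disc_area" and i: "integrable M (\<lambda>z. cmod (f z) powr p)"
      by (auto simp: Lp_space_iff)
    have fM: "f \<in> borel_measurable M" using f by (simp only: measurable_M_iff)
    define P where "P = maximal_bergman_projection \<omega> f"
    have P [measurable]: "P \<in> borel_measurable disc_area" unfolding P_def by (rule projection_measurable[OF f])
    define X where "X = (LINT z|M. cmod (f z) powr p)"
    have X: "0 \<le> X" by (simp add: X_def)
    \<comment> \<open>The estimate is made in the extended reals first, since integrability of the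
      image is itself part of the claim.\<close>
    have "(\<integral>\<^sup>+z. ennreal (cmod (P z) powr p) \<partial>M)
        = (\<integral>\<^sup>+z. ennreal (cmod (proj f z) powr p) \<partial>M)"
      by (rule nn_integral_cong) (simp add: P_def projection_eq[OF f])
    also have "\<dots> \<le> ennreal A * (\<integral>\<^sup>+\<zeta>. ennreal (cmod (f \<zeta>) powr p) \<partial>M)" by (rule A(2)[OF fM])
    also have "(\<integral>\<^sup>+\<zeta>. ennreal (cmod (f \<zeta>) powr p) \<partial>M) = ennreal X"
      unfolding X_def by (rule nn_integral_eq_integral[OF i]) simp
    finally have le: "(\<integral>\<^sup>+z. ennreal (cmod (P z) powr p) \<partial>M) \<le> ennreal (A * X)"
      using A(1) by (simp add: ennreal_mult')
    have int: "integrable M (\<lambda>z. cmod (P z) powr p)"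
    proof (rule integrableI_bounded)
      have "(\<integral>\<^sup>+z. ennreal (norm (cmod (P z) powr p)) \<partial>M) \<le> ennreal (A * X)" using le by simp
      then show "(\<integral>\<^sup>+z. ennreal (norm (cmod (P z) powr p)) \<partial>M) < \<infinity>"
        using ennreal_less_top le_less_trans by (metis infinity_ennreal_def)
    qed measurable
    have "ennreal (LINT z|M. cmod (P z) powr p) = (\<integral>\<^sup>+z. ennreal (cmod (P z) powr p) \<partial>M)"
      by (rule nn_integral_eq_integral[OF int, symmetric]) simp
    with le have "ennreal (LINT z|M. cmod (P z) powr p) \<le> ennreal (A * X)" by simp
    then have "(LINT z|M. cmod (P z) powr p) \<le> A * X"
      using A(1) X by (subst (asm) ennreal_le_iff) auto
    then have "(LINT z|M. cmod (P z) powr p) powr (1 / p) \<le> (A * X) powr (1 / p)"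
      using p by (intro powr_mono2) auto
    also have "\<dots> = A powr (1 / p) * X powr (1 / p)" using A(1) X by (simp add: powr_mult)
    finally show "maximal_bergman_projection \<omega> f \<in> Lp_space \<omega> p \<and>
        Lp_norm \<omega> p (maximal_bergman_projection \<omega> f) \<le> A powr (1 / p) * Lp_norm \<omega> p f"
      unfolding P_def[symmetric] by (simp add: Lp_space_iff P int Lp_norm_eq f X_def)
  qed
qed

end

theorem theorem9:
  fixes \<omega> :: "real \<Rightarrow> real" and p :: real
  assumes "\<omega> \<in> D_hat" and "1 < p"
  shows "bounded_on_Lp \<omega> p (maximal_bergman_projection \<omega>) \<longleftrightarrow> \<omega> \<in> D_class"
proof -
  have rw: "radial_weight \<omega>" using assms(1) by (simp add: D_hat_def)
  obtain C where C: "1 \<le> C" "\<And>r. r \<in> {0..<1} \<Longrightarrow> tail_integral \<omega> r \<le> C * tail_integral \<omega> ((1 + r) / 2)"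
    using assms(1) by (auto simp: D_hat_def)
  obtain w where w: "w \<in> borel_measurable borel" "\<And>r. 0 \<le> w r" "\<And>r. r \<notin> {0..<1} \<Longrightarrow> w r = 0"
    "AE r in lborel. r \<in> {0..<1} \<longrightarrow> w r = \<omega> r"
    using ex_borel_profile[OF rw] by blast
  let ?W = "density lborel (\<lambda>r. ennreal (w r))"
  have tail: "tail_integral \<omega> r = measure ?W {r..}" if "0 \<le> r" for r
    by (rule tail_integral_eq_measure[OF rw]) (use w that in auto)
  have [measurable]: "w \<in> borel_measurable borel" by fact
  interpret finite_measure "?W"
  proof (rule finite_measureI)
    \<comment> \<open>Finiteness is read off on the Lebesgue side, where the integrability of the
      weight is given.\<close>
    have "emeasure ?W UNIV = (\<integral>\<^sup>+r. ennreal (w r) \<partial>lebesgue)"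
      by (simp add: emeasure_density nn_integral_completion)
    also have "\<dots> = (\<integral>\<^sup>+r. ennreal (norm (indicator {0..<1} r *\<^sub>R \<omega> r)) \<partial>lebesgue)"
    proof (rule nn_integral_cong_AE)
      show "AE r in lebesgue. ennreal (w r) = ennreal (norm (indicator {0..<1} r *\<^sub>R \<omega> r))"
        using AE_completion[OF w(4)]
        by eventually_elim (use w(3) rw in \<open>auto simp: indicator_def radial_weight_def\<close>)
    qed
    also have "\<dots> < \<infinity>"
      using rw unfolding radial_weight_def set_integrable_def integrable_iff_bounded by blast
    finally show "emeasure ?W (space ?W) \<noteq> \<infinity>"
      by simp
  qed
  interpret weight_profile w C \<omega>
  proof unfold_locales
    show "AE r in ?W. 0 \<le> r \<and> r < 1"
      using w by (subst AE_density) (auto intro!: AE_I2 simp: less_le)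
    show "0 < measure ?W {r..}" if "0 \<le> r" "r < 1" for r
    proof -
      have "0 < tail_integral \<omega> r" using rw that by (simp add: radial_weight_def)
      then show ?thesis using tail[OF that(1)] by simp
    qed
    show "measure ?W {r..} \<le> C * measure ?W {(1 + r) / 2..}"
      if "0 \<le> r" "r < 1" for r
      using C(2)[of r] tail[of r] tail[of "(1 + r) / 2"] that by simp
  qed (use w C rw in auto)
  show ?thesis
    using D_check_if_bounded[OF assms(2)] bounded_if_D_check[OF assms(2)] assms(1)
    unfolding D_class_def by blast
qed

end
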